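(* Let $n\ge 2$ and $a>0$, and let $\sigma(a)\in\,]0,T(a)[$ be the number such that the domain $\mathcal{D}_a(-\sigma(a),\sigma(a))$ of the catenoid $\mathcal{C}_a\subset\mathbb{H}^n\times\mathbb{R}$ is stable-unstable. Then $\mathcal{D}_a(-\sigma(a),\sigma(a))$ is precisely the symmetric, rotation invariant, relatively compact domain of $\mathcal{C}_a$ bounded by the two spheres where the catenoid $\mathcal{C}_a$ touches the envelope of the family $\{\mathcal{C}_b\}_{b>0}$.
   Context: $\mathbb{H}^n$ is hyperbolic space in the ball model $\mathbb{B}=\{x\in\mathbb{R}^n:|x|<1\}$ with metric $\big(\frac{2}{1-|x|^2}\big)^2(dx_1^2+\cdots+dx_n^2)$, and $\mathbb{H}^n\times\mathbb{R}$ carries the product metric $\hat g$ with $dt^2$. For $a>0$, let $f(a,\cdot)$, defined on a symmetric interval $]-T(a),T(a)[$ with $0<T(a)<\infty$, be the maximal solution of $f_{tt}=(n-1)\coth(f)(1+f_t^2)$, $f(0)=a$, $f_t(0)=0$. The catenoid $\mathcal{C}_a$ is the complete minimal hypersurface parametrized by $X(a,t,\xi)=(\tanh(f(a,t)/2)\,\xi,\,t)$, $t\in\,]-T(a),T(a)[$, $\xi\in S^{n-1}$; its generating catenary is $C_a: t\mapsto(\tanh(f(a,t)/2),t)$. For $-T(a)\le\alpha<\beta\le T(a)$, $\mathcal{D}_a(\alpha,\beta)=X(a,]\alpha,\beta[,S^{n-1})$. Envelope: for a family of plane curves $t\mapsto(x(a,t),y(a,t))$ depending on $a$, the curve with parameter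 $a$ touches the envelope of the family at the parameter values $t$ for which $x_a(a,t)\,y_t(a,t)-x_t(a,t)\,y_a(a,t)=0$. The catenoid $\mathcal{C}_a$ touches the envelope of the family $\{\mathcal{C}_b\}_{b>0}$ along the spheres $X(a,\{t\},S^{n-1})$ for those $t$ at which the catenary $C_a$ touches the envelope of the family of catenaries $\{C_b\}_{b>0}$. For an oriented minimal hypersurface $M$ in $\mathbb{H}^n\times\mathbb{R}$ with unit normal $N_M$ and second fundamental form $A_M$, the Jacobi operator is $J_M=-\Delta_M+(n-1)(1-v_M^2)-|A_M|^2$, where $\Delta_M$ is the (non-positive) Laplacian and $v_M=\hat g(N_M,\partial_t)$. A relatively compact regular domain $\Omega\subset M$ is stable-unstable if the least eigenvalue of $J_M$ with Dirichlet boundary conditions in $\Omega$ is $0$. By strict domain monotonicity of Dirichlet eigenvalues, there is at most one $\sigma\in\,]0,T(a)[$ with $\mathcal{D}_a(-\sigma,\sigma)$ stable-unstable; such a $\sigma=\sigma(a)$ exists. *)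

theory Defs
  imports "HOL-Analysis.Analysis"
begin

section \<open>Parametrized hypersurfaces in hyperbolic space times the line\<close>

text \<open>
  The index type \<open>'n\<close> has \<open>n\<close> elements; \<open>real^'n\<close> serves both as the ambient space of the ball
  model and as the parameter space of hypersurfaces, which have dimension \<open>n\<close>.
  A hypersurface is given by a parametrization \<open>\<phi>\<close> on an open set \<open>V\<close>; functions and unit normals
  live on the image \<open>\<phi> ` V\<close>, and geometric quantities are computed in the coordinates \<open>\<phi>\<close>.
\<close>

type_synonym 'n ambient = "(real^'n) \<times> real"

definition hyp_metric :: "'n::finite ambient \<Rightarrow> 'n ambient \<Rightarrow> 'n ambient \<Rightarrow> real" where
  "hyp_metric p u v =
     (2 / (1 - (norm (fst p))\<^sup>2))\<^sup>2 * (fst u \<bullet> fst v) + snd u * snd v"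

text \<open>
  For a metric \<open>G\<close> on (an open part of) a Euclidean space and fixed vectors \<open>u\<close>, \<open>v\<close>, \<open>w\<close>, this is
  \<open>G(\<nabla>\<^sub>u v, w)\<close> for the Levi-Civita connection of \<open>G\<close>, by the Koszul formula.
\<close>

definition christoffel ::
    "('a::real_normed_vector \<Rightarrow> 'a \<Rightarrow> 'a \<Rightarrow> real) \<Rightarrow> 'a \<Rightarrow> 'a \<Rightarrow> 'a \<Rightarrow> 'a \<Rightarrow> real" where
  "christoffel G p u v w =
     (frechet_derivative (\<lambda>q. G q v w) (at p) u
      + frechet_derivative (\<lambda>q. G q u w) (at p) v
      - frechet_derivative (\<lambda>q. G q u v) (at p) w) / 2"

definition partial :: "'n \<Rightarrow> (real^'n::finite \<Rightarrow> 'b::real_normed_vector) \<Rightarrow> real^'n \<Rightarrow> 'b" where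
  "partial i w y = frechet_derivative w (at y) (axis i 1)"

definition C1_on :: "(real^'n::finite) set \<Rightarrow> (real^'n \<Rightarrow> 'b::real_normed_vector) \<Rightarrow> bool" where
  "C1_on V w \<longleftrightarrow> (\<forall>y\<in>V. w differentiable (at y)) \<and> (\<forall>i. continuous_on V (partial i w))"

definition C2_on :: "(real^'n::finite) set \<Rightarrow> (real^'n \<Rightarrow> 'b::real_normed_vector) \<Rightarrow> bool" where
  "C2_on V w \<longleftrightarrow> C1_on V w \<and> (\<forall>i. C1_on V (partial i w))"

definition induced_metric ::
    "(real^'n::finite \<Rightarrow> 'n ambient) \<Rightarrow> real^'n \<Rightarrow> real^'n \<Rightarrow> real^'n \<Rightarrow> real" where
  "induced_metric \<phi> y u v =
     hyp_metric (\<phi> y) (frechet_derivative \<phi> (at y) u) (frechet_derivative \<phi> (at y) v)"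

definition gram :: "(real^'n::finite \<Rightarrow> 'n ambient) \<Rightarrow> real^'n \<Rightarrow> real^'n^'n" where
  "gram \<phi> y = (\<chi> i j. induced_metric \<phi> y (axis i 1) (axis j 1))"

definition inv_gram :: "(real^'n::finite \<Rightarrow> 'n ambient) \<Rightarrow> real^'n \<Rightarrow> real^'n^'n" where
  "inv_gram \<phi> y = matrix_inv (gram \<phi> y)"

text \<open>\<open>Hess w (\<partial>\<^sub>i, \<partial>\<^sub>j) = \<partial>\<^sub>i \<partial>\<^sub>j w - \<Gamma>\<^sup>k\<^sub>i\<^sub>j \<partial>\<^sub>k w\<close>, with the connection of the induced metric.\<close>

definition hess ::
    "(real^'n::finite \<Rightarrow> 'n ambient) \<Rightarrow> (real^'n \<Rightarrow> real) \<Rightarrow> real^'n \<Rightarrow> 'n \<Rightarrow> 'n \<Rightarrow> real" where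
  "hess \<phi> w y i j = partial i (partial j w) y
     - (\<Sum>k\<in>UNIV. \<Sum>l\<in>UNIV. inv_gram \<phi> y $ k $ l
          * christoffel (induced_metric \<phi>) y (axis i 1) (axis j 1) (axis l 1) * partial k w y)"

text \<open>The (non-positive) Laplacian is the trace of the Hessian.\<close>

definition laplacian ::
    "(real^'n::finite \<Rightarrow> 'n ambient) \<Rightarrow> (real^'n \<Rightarrow> real) \<Rightarrow> real^'n \<Rightarrow> real" where
  "laplacian \<phi> w y = (\<Sum>i\<in>UNIV. \<Sum>j\<in>UNIV. inv_gram \<phi> y $ i $ j * hess \<phi> w y i j)"

definition unit_normal ::
    "(real^'n::finite \<Rightarrow> 'n ambient) \<Rightarrow> (real^'n) set \<Rightarrow> ('n ambient \<Rightarrow> 'n ambient) \<Rightarrow> bool" where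
  "unit_normal \<phi> V N \<longleftrightarrow> continuous_on (\<phi> ` V) N \<and>
     (\<forall>y\<in>V. hyp_metric (\<phi> y) (N (\<phi> y)) (N (\<phi> y)) = 1 \<and>
        (\<forall>u. hyp_metric (\<phi> y) (N (\<phi> y)) (frechet_derivative \<phi> (at y) u) = 0))"

text \<open>\<open>A(\<partial>\<^sub>i, \<partial>\<^sub>j)\<close> is the normal component of the ambient covariant derivative of \<open>\<partial>\<^sub>j \<phi>\<close> along \<open>\<partial>\<^sub>i \<phi>\<close>.\<close>

definition second_ff ::
    "(real^'n::finite \<Rightarrow> 'n ambient) \<Rightarrow> ('n ambient \<Rightarrow> 'n ambient) \<Rightarrow> real^'n \<Rightarrow> 'n \<Rightarrow> 'n \<Rightarrow> real" where
  "second_ff \<phi> N y i j = hyp_metric (\<phi> y) (partial i (partial j \<phi>) y) (N (\<phi> y))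
     + christoffel hyp_metric (\<phi> y) (partial i \<phi> y) (partial j \<phi> y) (N (\<phi> y))"

definition second_ff_norm2 ::
    "(real^'n::finite \<Rightarrow> 'n ambient) \<Rightarrow> ('n ambient \<Rightarrow> 'n ambient) \<Rightarrow> real^'n \<Rightarrow> real" where
  "second_ff_norm2 \<phi> N y = (\<Sum>i\<in>UNIV. \<Sum>j\<in>UNIV. \<Sum>k\<in>UNIV. \<Sum>l\<in>UNIV.
     inv_gram \<phi> y $ i $ k * inv_gram \<phi> y $ j $ l * second_ff \<phi> N y i j * second_ff \<phi> N y k l)"

definition vertical_component ::
    "(real^'n::finite \<Rightarrow> 'n ambient) \<Rightarrow> ('n ambient \<Rightarrow> 'n ambient) \<Rightarrow> real^'n \<Rightarrow> real" where
  "vertical_component \<phi> N y = hyp_metric (\<phi> y) (N (\<phi> y)) (0, 1)"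

definition jacobi_op ::
    "(real^'n::finite \<Rightarrow> 'n ambient) \<Rightarrow> ('n ambient \<Rightarrow> 'n ambient) \<Rightarrow> (real^'n \<Rightarrow> real) \<Rightarrow> real^'n \<Rightarrow> real" where
  "jacobi_op \<phi> N w y = - laplacian \<phi> w y
     + ((real CARD('n) - 1) * (1 - (vertical_component \<phi> N y)\<^sup>2) - second_ff_norm2 \<phi> N y) * w y"

definition relatively_compact_domain :: "'a::topological_space set \<Rightarrow> 'a set \<Rightarrow> bool" where
  "relatively_compact_domain M \<Omega> \<longleftrightarrow>
     \<Omega> \<noteq> {} \<and> openin (top_of_set M) \<Omega> \<and> connected \<Omega> \<and> compact (closure \<Omega>) \<and> closure \<Omega> \<subseteq> M"

text \<open>Boundary, relative to \<open>M\<close>, of a relatively open subset of \<open>M\<close>.\<close>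

definition boundary_in :: "'a::topological_space set \<Rightarrow> 'a set \<Rightarrow> 'a set" where
  "boundary_in M \<Omega> = M \<inter> closure \<Omega> - \<Omega>"

text \<open>
  Classical Dirichlet eigenvalues of the Jacobi operator. On relatively compact regular domains
  these agree with the spectrum of the self-adjoint Dirichlet realization, by elliptic regularity.
\<close>

definition dirichlet_eigenvalue ::
    "(real^'n::finite \<Rightarrow> 'n ambient) \<Rightarrow> (real^'n) set \<Rightarrow> ('n ambient \<Rightarrow> 'n ambient) \<Rightarrow>
     'n ambient set \<Rightarrow> real \<Rightarrow> bool" where
  "dirichlet_eigenvalue \<phi> V N \<Omega> l \<longleftrightarrow>
     (\<exists>u :: 'n ambient \<Rightarrow> real.
        (\<exists>p\<in>\<Omega>. u p \<noteq> 0) \<and>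
        continuous_on (closure \<Omega>) u \<and>
        (\<forall>p\<in>boundary_in (\<phi> ` V) \<Omega>. u p = 0) \<and>
        C2_on {y\<in>V. \<phi> y \<in> \<Omega>} (u \<circ> \<phi>) \<and>
        (\<forall>y\<in>V. \<phi> y \<in> \<Omega> \<longrightarrow> jacobi_op \<phi> N (u \<circ> \<phi>) y = l * u (\<phi> y)))"

definition stable_unstable ::
    "(real^'n::finite \<Rightarrow> 'n ambient) \<Rightarrow> (real^'n) set \<Rightarrow> ('n ambient \<Rightarrow> 'n ambient) \<Rightarrow>
     'n ambient set \<Rightarrow> bool" where
  "stable_unstable \<phi> V N \<Omega> \<longleftrightarrow>
     relatively_compact_domain (\<phi> ` V) \<Omega> \<and>
     dirichlet_eigenvalue \<phi> V N \<Omega> 0 \<and>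
     (\<forall>l. dirichlet_eigenvalue \<phi> V N \<Omega> l \<longrightarrow> 0 \<le> l)"

section \<open>Catenoids\<close>

text \<open>\<open>f > 0\<close> keeps the solution in the domain of the hyperbolic cotangent.\<close>

definition catenary_solution :: "nat \<Rightarrow> real \<Rightarrow> real set \<Rightarrow> (real \<Rightarrow> real) \<Rightarrow> bool" where
  "catenary_solution n a I f \<longleftrightarrow>
     open I \<and> is_interval I \<and> 0 \<in> I \<and> f 0 = a \<and>
     (\<exists>f'. f' 0 = 0 \<and>
        (\<forall>t\<in>I. f t > 0 \<and>
           (f has_real_derivative f' t) (at t) \<and>
           (f' has_real_derivative (real n - 1) * (cosh (f t) / sinh (f t)) * (1 + (f' t)\<^sup>2)) (at t)))"

definition maximal_catenary_solution :: "nat \<Rightarrow> real \<Rightarrow> real set \<Rightarrow> (real \<Rightarrow> real) \<Rightarrow> bool" where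
  "maximal_catenary_solution n a I f \<longleftrightarrow>
     catenary_solution n a I f \<and>
     (\<forall>J g. catenary_solution n a J g \<and> I \<subseteq> J \<and> (\<forall>t\<in>I. g t = f t) \<longrightarrow> J = I)"

definition catenoid_param ::
    "(real \<Rightarrow> real \<Rightarrow> real) \<Rightarrow> real \<Rightarrow> real \<Rightarrow> real^'n::finite \<Rightarrow> 'n ambient" where
  "catenoid_param f a t \<xi> = (tanh (f a t / 2) *\<^sub>R \<xi>, t)"

definition catenoid_domain ::
    "(real \<Rightarrow> real \<Rightarrow> real) \<Rightarrow> real \<Rightarrow> real \<Rightarrow> real \<Rightarrow> 'n::finite ambient set" where
  "catenoid_domain f a \<alpha> \<beta> = {catenoid_param f a t \<xi> | t \<xi>. \<alpha> < t \<and> t < \<beta> \<and> \<xi> \<in> sphere 0 1}"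

definition catenoid ::
    "(real \<Rightarrow> real \<Rightarrow> real) \<Rightarrow> (real \<Rightarrow> real) \<Rightarrow> real \<Rightarrow> 'n::finite ambient set" where
  "catenoid f T a = catenoid_domain f a (- T a) (T a)"

definition catenoid_sphere ::
    "(real \<Rightarrow> real \<Rightarrow> real) \<Rightarrow> real \<Rightarrow> real \<Rightarrow> 'n::finite ambient set" where
  "catenoid_sphere f a t = catenoid_param f a t ` sphere 0 1"

text \<open>
  A single global chart of the catenoid: \<open>y \<mapsto> (ln \<bar>y\<bar>, y / \<bar>y\<bar>)\<close> is a diffeomorphism of the annulus
  \<open>exp (- T) < \<bar>y\<bar> < exp T\<close> in \<open>real^'n\<close> onto \<open>]-T, T[ \<times> S\<^sup>n\<^sup>-\<^sup>1\<close>, and it is composed with the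
  parametrization above.
\<close>

definition catenoid_chart ::
    "(real \<Rightarrow> real \<Rightarrow> real) \<Rightarrow> real \<Rightarrow> real^'n::finite \<Rightarrow> 'n ambient" where
  "catenoid_chart f a y = catenoid_param f a (ln (norm y)) (y /\<^sub>R norm y)"

definition annulus :: "real \<Rightarrow> real \<Rightarrow> (real^'n::finite) set" where
  "annulus \<alpha> \<beta> = {y. exp \<alpha> < norm y \<and> norm y < exp \<beta>}"

lemma catenoid_chart_image:
  "catenoid_chart f a ` annulus \<alpha> \<beta> = (catenoid_domain f a \<alpha> \<beta> :: 'n::finite ambient set)"
proof (intro set_eqI iffI)
  fix p :: "'n ambient"
  assume "p \<in> catenoid_chart f a ` annulus \<alpha> \<beta>"
  then obtain y :: "real^'n" where y: "exp \<alpha> < norm y" "norm y < exp \<beta>" and p: "p = catenoid_chart f a y"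
    by (auto simp: annulus_def)
  have pos: "0 < norm y"
    using y(1) exp_gt_zero[of \<alpha>] by linarith
  have "\<alpha> < ln (norm y)" "ln (norm y) < \<beta>"
    using y pos by (metis exp_less_cancel_iff exp_ln)+
  moreover have "y /\<^sub>R norm y \<in> sphere 0 1"
    using pos by simp
  ultimately show "p \<in> catenoid_domain f a \<alpha> \<beta>"
    unfolding catenoid_domain_def p catenoid_chart_def by blast
next
  fix p :: "'n ambient"
  assume "p \<in> catenoid_domain f a \<alpha> \<beta>"
  then obtain t and \<xi> :: "real^'n" where t: "\<alpha> < t" "t < \<beta>" and \<xi>: "norm \<xi> = 1"
      and p: "p = catenoid_param f a t \<xi>"
    by (auto simp: catenoid_domain_def)
  have "p = catenoid_chart f a (exp t *\<^sub>R \<xi>)"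
    by (simp add: catenoid_chart_def p \<xi>)
  moreover have "exp t *\<^sub>R \<xi> \<in> annulus \<alpha> \<beta>"
    using t by (simp add: annulus_def \<xi>)
  ultimately show "p \<in> catenoid_chart f a ` annulus \<alpha> \<beta>"
    by blast
qed

lemma inj_on_catenoid_chart:
  assumes "\<And>t. \<alpha> < t \<Longrightarrow> t < \<beta> \<Longrightarrow> f a t > 0"
  shows "inj_on (catenoid_chart f a) (annulus \<alpha> \<beta> :: (real^'n::finite) set)"
proof (rule inj_onI)
  fix x y :: "real^'n"
  assume x: "x \<in> annulus \<alpha> \<beta>" and y: "y \<in> annulus \<alpha> \<beta>"
    and eq: "catenoid_chart f a x = catenoid_chart f a y"
  have pos: "0 < norm x" "0 < norm y"
    using x y exp_gt_zero[of \<alpha>] unfolding annulus_def mem_Collect_eq by linarith+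
  have "ln (norm x) = ln (norm y)"
    using eq by (simp add: catenoid_chart_def catenoid_param_def)
  then have n: "norm x = norm y"
    using pos by simp
  have "\<alpha> < ln (norm x)" "ln (norm x) < \<beta>"
    using x pos unfolding annulus_def mem_Collect_eq by (metis exp_less_cancel_iff exp_ln)+
  then have "f a (ln (norm x)) > 0"
    using assms by blast
  then have "tanh (f a (ln (norm x)) / 2) \<noteq> 0"
    by simp
  then show "x = y"
    using eq pos n by (simp add: catenoid_chart_def catenoid_param_def)
qed

section \<open>Envelopes\<close>

definition touches_envelope ::
    "(real \<Rightarrow> real \<Rightarrow> real) \<Rightarrow> (real \<Rightarrow> real \<Rightarrow> real) \<Rightarrow> real \<Rightarrow> real \<Rightarrow> bool" where
  "touches_envelope x y a t \<longleftrightarrow>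
     (\<exists>x_a x_t y_a y_t.
        ((\<lambda>b. x b t) has_real_derivative x_a) (at a) \<and>
        ((\<lambda>s. x a s) has_real_derivative x_t) (at t) \<and>
        ((\<lambda>b. y b t) has_real_derivative y_a) (at a) \<and>
        ((\<lambda>s. y a s) has_real_derivative y_t) (at t) \<and>
        x_a * y_t - x_t * y_a = 0)"

text \<open>The parameters \<open>t\<close> for which \<open>C\<^sub>a\<close> touches the envelope along the sphere at height \<open>t\<close>.\<close>

definition envelope_heights ::
    "(real \<Rightarrow> real \<Rightarrow> real) \<Rightarrow> (real \<Rightarrow> real) \<Rightarrow> real \<Rightarrow> real set" where
  "envelope_heights f T a =
     {t. - T a < t \<and> t < T a \<and> touches_envelope (\<lambda>b t. tanh (f b t / 2)) (\<lambda>b t. t) a t}"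

text \<open>Symmetry with respect to the slice \<open>t = 0\<close>, and invariance under rotations about the axis.\<close>

definition symmetric_set :: "'n::finite ambient set \<Rightarrow> bool" where
  "symmetric_set \<Omega> \<longleftrightarrow> (\<lambda>(x, t). (x, - t)) ` \<Omega> = \<Omega>"

definition rotation_invariant :: "'n::finite ambient set \<Rightarrow> bool" where
  "rotation_invariant \<Omega> \<longleftrightarrow>
     (\<forall>R :: real^'n^'n. rotation_matrix R \<longrightarrow> (\<lambda>(x, t). (R *v x, t)) ` \<Omega> = \<Omega>)"

end

theory Submission
  imports Defs
begin

text \<open>
  Write \<open>m = n - 1\<close>, \<open>E\<^sup>2 = 1 + f\<^sub>t\<^sup>2\<close> and \<open>p = m (n coth\<^sup>2 f - 1)\<close>. The height is a harmonic function on a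
  minimal hypersurface, and in the chart \<open>t = ln \<bar>y\<bar>\<close> the Jacobi operator acts on functions \<open>W\<close> of
  \<open>t\<close> alone as \<open>J W = (- W'' - p W) / E\<^sup>2\<close> (\<open>jacobi_op_radial\<close>).

  The catenary is explicit in the angle \<open>\<theta> = arctan f\<^sub>t\<close>: \<open>sinh f = sinh b / cos\<^sup>1\<^sup>/\<^sup>m \<theta>\<close> and
  \<open>t = (1/m) \<integral>\<^sub>0\<^sup>\<theta> tanh f\<close>. This determines the maximal interval and gives the derivative in the initial value
  \<open>b\<close>. Two solutions of \<open>W'' = - p W\<close> result: \<open>v = sin \<theta>\<close>, from vertical translations,
  which is odd and positive for \<open>t > 0\<close>, and \<open>u = f\<^sub>b cos \<theta>\<close>, from the variation of \<open>b\<close>, which is even with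
  \<open>u 0 = 1\<close>. The catenary touches the envelope exactly where \<open>u = 0\<close> (\<open>touches_envelope_iff\<close>). As the
  Wronskian of \<open>u\<close> and \<open>v\<close> is constant, \<open>u / v\<close> is strictly decreasing on \<open>]0, T[\<close>, so that \<open>u\<close> has at most
  one positive zero. It remains to see that \<open>u \<sigma> = 0\<close>.

  If \<open>u \<sigma> > 0\<close>, then \<open>u > 0\<close> on \<open>[-\<sigma>, \<sigma>]\<close>; multiplication by a suitable function turns \<open>u\<close> into a strict
  positive supersolution, and by the maximum principle no function, radial or not, is a Dirichlet
  eigenfunction with eigenvalue \<open>0\<close> (\<open>no_dirichlet_kernel_if_positive_solution\<close>). If \<open>u \<sigma> < 0\<close>, the
  solution of \<open>W'' = (\<mu> E\<^sup>2 - p) W\<close> with \<open>W (-\<sigma>) = 0\<close>, \<open>W' (-\<sigma>) > 0\<close> is negative at \<open>\<sigma>\<close> for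
  \<open>\<mu> = 0\<close> and positive for large \<open>\<mu>\<close>, so that it vanishes there for some \<open>\<mu> > 0\<close>
  (\<open>exists_dirichlet_mode\<close>), and \<open>-\<mu>\<close> is a negative eigenvalue. Either case contradicts stability-instability.

  The description of the domain by its boundary is topological: the spheres at heights \<open>\<plusminus>\<sigma>\<close>
  cut the catenoid into three connected pieces, and only the middle one has compact closure in the
  catenoid (\<open>domain_eq_if_boundary_spheres\<close>).
\<close>

section \<open>Radial tensors and radial functions\<close>

text \<open>
  The symmetric matrix \<open>a I + b y y\<^sup>T\<close>. At a point \<open>y\<close> of the annulus, the metric, its inverse, the second
  fundamental form and the Hessians of functions of \<open>\<bar>y\<bar>\<close> all have this form, so that contractions
  reduce to arithmetic with two coefficients.
\<close>

definition radial_tensor :: "real \<Rightarrow> real \<Rightarrow> real^'n::finite \<Rightarrow> 'n \<Rightarrow> 'n \<Rightarrow> real" where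
  "radial_tensor a b y i j = a * of_bool (i = j) + b * (y $ i) * (y $ j)"

lemma radial_tensor_mult:
  "(\<Sum>k\<in>UNIV. radial_tensor a b y i k * radial_tensor c d y k j)
     = radial_tensor (a * c) (a * d + b * c + b * d * (y \<bullet> y)) y i j"
proof -
  have "(\<Sum>k\<in>UNIV. radial_tensor a b y i k * radial_tensor c d y k j)
     = (\<Sum>k\<in>UNIV. (if k = i then a * c * of_bool (i = j) + a * d * y$i * y$j else 0)
         + (if k = j then b * c * y$i * y$j else 0) + b * d * y$i * y$j * (y$k * y$k))"
    by (intro sum.cong) (auto simp: radial_tensor_def algebra_simps)
  also have "\<dots> = radial_tensor (a * c) (a * d + b * c + b * d * (y \<bullet> y)) y i j"
    unfolding sum.distrib sum_distrib_left[symmetric] inner_vec_def inner_real_def radial_tensor_def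
    by (simp add: algebra_simps)
  finally show ?thesis .
qed

lemma radial_tensor_sym: "radial_tensor a b y i j = radial_tensor a b y j i"
  by (auto simp: radial_tensor_def)

lemma radial_tensor_trace:
  "(\<Sum>i\<in>UNIV. radial_tensor a b y i i) = real CARD('n) * a + b * (y \<bullet> y)"
  for y :: "real^'n::finite"
  by (simp add: radial_tensor_def sum.distrib inner_vec_def sum_distrib_left mult.assoc)

lemma radial_tensor_contract:
  "(\<Sum>i\<in>UNIV. \<Sum>j\<in>UNIV. radial_tensor a b y i j * radial_tensor c d y i j)
     = real CARD('n) * (a * c) + (a * d + b * c + b * d * (y \<bullet> y)) * (y \<bullet> y)"
  for y :: "real^'n::finite"
  by (subst (2) radial_tensor_sym) (simp add: radial_tensor_mult radial_tensor_trace)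

lemma radial_tensor_vec:
  "(\<Sum>j\<in>UNIV. radial_tensor a b y i j * y $ j) = (a + b * (y \<bullet> y)) * y $ i"
proof -
  have "(\<Sum>j\<in>UNIV. radial_tensor a b y i j * y $ j)
     = (\<Sum>j\<in>UNIV. (if j = i then a * y$i else 0) + b * y$i * (y$j * y$j))"
    by (intro sum.cong) (auto simp: radial_tensor_def algebra_simps)
  then show ?thesis
    unfolding sum.distrib sum_distrib_left[symmetric] inner_vec_def inner_real_def
    by (simp add: algebra_simps)
qed

lemma matrix_inv_radial_tensor:
  fixes y :: "real^'n::finite"
  assumes "a \<noteq> 0" "a + b * (y \<bullet> y) \<noteq> 0"
  shows "matrix_inv (\<chi> i j. radial_tensor a b y i j)
       = (\<chi> i j. radial_tensor (1 / a) (- b / (a * (a + b * (y \<bullet> y)))) y i j)"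
proof -
  let ?A = "(\<chi> i j. radial_tensor a b y i j) :: real^'n^'n"
  let ?B = "(\<chi> i j. radial_tensor (1 / a) (- b / (a * (a + b * (y \<bullet> y)))) y i j) :: real^'n^'n"
  let ?b = "- b / (a * (a + b * (y \<bullet> y)))"
  have e: "a * ?b + b * (1 / a) + b * ?b * (y \<bullet> y) = 0" "(1 / a) * b + ?b * a + ?b * b * (y \<bullet> y) = 0"
    using assms by (simp_all add: divide_simps) (simp_all add: algebra_simps)
  have "?A ** ?B = mat 1"
    unfolding matrix_matrix_mult_def mat_def vec_eq_iff vec_lambda_beta radial_tensor_mult e(1)
    using assms by (simp add: radial_tensor_def)
  moreover have "?B ** ?A = mat 1"
    unfolding matrix_matrix_mult_def mat_def vec_eq_iff vec_lambda_beta radial_tensor_mult e(2)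
    using assms by (simp add: radial_tensor_def)
  ultimately have 1: "?A ** ?B = mat 1 \<and> ?B ** ?A = mat 1" ..
  have "?A ** matrix_inv ?A = mat 1"
    unfolding matrix_inv_def
    by (rule conjunct1[OF someI[of "\<lambda>X. ?A ** X = mat 1 \<and> X ** ?A = mat 1" ?B, OF 1]])
  then have "(?B ** ?A) ** matrix_inv ?A = ?B" by (simp add: matrix_mul_assoc[symmetric])
  then show ?thesis
    using 1 by simp
qed

lemma has_derivative_ln_norm:
  fixes y :: "'a::real_inner"
  assumes "y \<noteq> 0"
  shows "((\<lambda>y. ln (norm y)) has_derivative (\<lambda>u. (y \<bullet> u) / (norm y)\<^sup>2)) (at y)"
  using assms
  by (auto intro!: derivative_eq_intros has_derivative_norm simp: sgn_div_norm power2_eq_square divide_simps inner_commute)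

lemma has_derivative_radial:
  fixes y :: "'a::real_inner"
  assumes "(W has_real_derivative W') (at (ln (norm y)))" "y \<noteq> 0"
  shows "((\<lambda>y. W (ln (norm y))) has_derivative (\<lambda>u. W' * ((y \<bullet> u) / (norm y)\<^sup>2))) (at y)"
  using has_derivative_compose[OF has_derivative_ln_norm[OF assms(2)]
      assms(1)[unfolded has_field_derivative_def]]
  by simp

lemma open_annulus: "open (annulus \<alpha> \<beta> :: (real^'n::finite) set)"
proof -
  have "annulus \<alpha> \<beta> = {y :: real^'n. exp \<alpha> < norm y} \<inter> {y. norm y < exp \<beta>}"
    by (auto simp: annulus_def)
  moreover have "open {y :: real^'n. exp \<alpha> < norm y}" "open {y :: real^'n. norm y < exp \<beta>}"
    by (intro open_Collect_less continuous_intros)+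
  ultimately show ?thesis by (metis open_Int)
qed

lemma annulus_iff: "y \<in> annulus \<alpha> \<beta> \<longleftrightarrow> y \<noteq> 0 \<and> \<alpha> < ln (norm y) \<and> ln (norm y) < \<beta>"
  for y :: "real^'n::finite"
proof (cases "y = 0")
  case True
  then show ?thesis using exp_gt_zero[of \<alpha>] by (auto simp: annulus_def)
next
  case False
  then have e: "exp (ln (norm y)) = norm y" by simp
  have "exp \<alpha> < norm y \<longleftrightarrow> \<alpha> < ln (norm y)" "norm y < exp \<beta> \<longleftrightarrow> ln (norm y) < \<beta>"
    using exp_less_cancel_iff[of \<alpha> "ln (norm y)"] exp_less_cancel_iff[of "ln (norm y)" \<beta>]
    unfolding e by blast+
  then show ?thesis using False by (simp add: annulus_def)
qed

lemma frechet_derivative_eq: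
  "(g has_derivative g') (at y) \<Longrightarrow> frechet_derivative g (at y) = g'"
  using frechet_derivative_at by fastforce

lemma partial_eq:
  "(w has_derivative w') (at y) \<Longrightarrow> partial i w y = w' (axis i 1)"
  by (simp add: partial_def frechet_derivative_eq)

lemma partial_cong_open:
  assumes "open S" "y \<in> S" "\<And>q. q \<in> S \<Longrightarrow> w q = w2 q"
  shows "partial i w y = partial i w2 y"
proof -
  have "(w has_derivative D) (at y) \<longleftrightarrow> (w2 has_derivative D) (at y)" for D
    using assms
    by (auto intro: has_derivative_transform_within_open[of w _ _ _ S w2]
        has_derivative_transform_within_open[of w2 _ _ _ S w])
  then show ?thesis
    by (simp add: partial_def frechet_derivative_def)
qed

lemma has_derivative_axis_component:
  "((\<lambda>y. y $ i) has_derivative (\<lambda>u. u $ i)) (at y)" for y :: "real^'n::finite"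
  by (rule bounded_linear_imp_has_derivative) (rule bounded_linear_vec_nth)

lemma partial_radial:
  fixes y :: "real^'n::finite"
  assumes "(W has_real_derivative W') (at (ln (norm y)))" "y \<noteq> 0"
  shows "partial i (\<lambda>y. W (ln (norm y))) y = W' * (y $ i / (norm y)\<^sup>2)"
  using partial_eq[OF has_derivative_radial[OF assms]] by (simp add: inner_axis)

lemma has_derivative_component_over_norm2:
  fixes y :: "real^'n::finite"
  assumes "y \<noteq> 0"
  shows "((\<lambda>y. y $ j / (norm y)\<^sup>2) has_derivative
     (\<lambda>u. u $ j / (norm y)\<^sup>2 - 2 * (y $ j) * (y \<bullet> u) / (norm y)^4)) (at y)"
proof -
  have "((\<lambda>y. y $ j / (y \<bullet> y)) has_derivative
     (\<lambda>u. u $ j / (y \<bullet> y) - 2 * (y $ j) * (y \<bullet> u) / (y \<bullet> y)^2)) (at y)"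
    using assms
    by (auto intro!: derivative_eq_intros has_derivative_axis_component simp: field_simps power2_eq_square inner_commute)
  moreover have "(norm y)^4 = (y \<bullet> y)^2"
    by (simp flip: power2_norm_eq_inner)
  ultimately show ?thesis by (simp add: power2_norm_eq_inner)
qed

lemma partial_partial_radial:
  fixes y :: "real^'n::finite"
  assumes y: "y \<in> annulus \<alpha> \<beta>"
    and W: "\<And>t. \<alpha> < t \<Longrightarrow> t < \<beta> \<Longrightarrow> (W has_real_derivative W1 t) (at t)"
    and W1: "(W1 has_real_derivative W2) (at (ln (norm y)))"
  shows "partial i (partial j (\<lambda>y. W (ln (norm y)))) y
      = radial_tensor (W1 (ln (norm y)) / (norm y)\<^sup>2)
          ((W2 - 2 * W1 (ln (norm y))) / (norm y)^4) y i j"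
proof -
  have y0: "y \<noteq> 0" using y by (simp add: annulus_iff)
  have "partial i (partial j (\<lambda>y. W (ln (norm y)))) y
      = partial i (\<lambda>y. W1 (ln (norm y)) * (y $ j / (norm y)\<^sup>2)) y"
    by (rule partial_cong_open[OF open_annulus y], rule partial_radial) (auto simp: annulus_iff intro!: W)
  also have "\<dots> = W1 (ln (norm y)) * (axis i 1 $ j / (norm y)\<^sup>2 - 2 * (y $ j) * (y \<bullet> axis i 1) / (norm y)^4)
       + W2 * ((y \<bullet> axis i 1) / (norm y)\<^sup>2) * (y $ j / (norm y)\<^sup>2)"
    by (rule partial_eq, rule has_derivative_mult[OF has_derivative_radial[OF W1 y0]
          has_derivative_component_over_norm2[OF y0]])
  also have "\<dots> = radial_tensor (W1 (ln (norm y)) / (norm y)\<^sup>2)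
          ((W2 - 2 * W1 (ln (norm y))) / (norm y)^4) y i j"
  proof -
    have "axis i (1::real) $ j = of_bool (i = j)" by (auto simp: axis_def)
    moreover have "y \<bullet> axis i 1 = y $ i" by (simp add: inner_axis)
    moreover have "(norm y)\<^sup>2 * (norm y)\<^sup>2 = (norm y)^4" by (simp flip: power_add)
    ultimately show ?thesis using y0
      by (simp add: radial_tensor_def diff_divide_distrib algebra_simps)
  qed
  finally show ?thesis .
qed

lemma has_derivative_hyp_metric:
  assumes "norm (fst p) < 1"
  shows "((\<lambda>q. hyp_metric q v w) has_derivative
      (\<lambda>u. 16 * (fst p \<bullet> fst u) / (1 - (norm (fst p))\<^sup>2)^3 * (fst v \<bullet> fst w))) (at p)"
proof -
  let ?x = "1 - fst p \<bullet> fst p"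
  have "(norm (fst p))\<^sup>2 < 1"
    using assms by (simp add: abs_square_less_1)
  then have ne: "?x \<noteq> 0"
    by (simp add: power2_norm_eq_inner)
  have 1: "((\<lambda>q. 1 - fst q \<bullet> fst q) has_derivative (\<lambda>u. - 2 * (fst p \<bullet> fst u))) (at p)"
    by (auto intro!: derivative_eq_intros simp: inner_commute)
  have "((\<lambda>x. (2 / x)\<^sup>2 * c + d) has_real_derivative - 8 / x^3 * c) (at x)" if "x \<noteq> 0" for x c d :: real
    using that by (auto intro!: derivative_eq_intros simp: field_simps power2_eq_square power3_eq_cube)
  note 2 = this[OF ne, of "fst v \<bullet> fst w" "snd v * snd w"]
  from has_derivative_compose[OF 1 2[unfolded has_field_derivative_def]]
  have "((\<lambda>q. (2 / (1 - fst q \<bullet> fst q))\<^sup>2 * (fst v \<bullet> fst w) + snd v * snd w) has_derivative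
      (\<lambda>u. 16 * (fst p \<bullet> fst u) / ?x^3 * (fst v \<bullet> fst w))) (at p)"
    by (simp add: mult_ac)
  then show ?thesis
    by (simp add: hyp_metric_def power2_norm_eq_inner)
qed

text \<open>
  Only the conformal factor of the horizontal part depends on the point, whence the formula for a
  conformally flat metric.
\<close>

lemma christoffel_hyp_metric:
  assumes "norm (fst p) < 1"
  shows "christoffel hyp_metric p u v w = (2 / (1 - (norm (fst p))\<^sup>2))^3 *
     ((fst p \<bullet> fst u) * (fst v \<bullet> fst w) + (fst p \<bullet> fst v) * (fst u \<bullet> fst w)
        - (fst p \<bullet> fst w) * (fst u \<bullet> fst v))"
  unfolding christoffel_def frechet_derivative_eq[OF has_derivative_hyp_metric[OF assms]]
  by (simp add: power_divide diff_divide_distrib add_divide_distrib algebra_simps)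

lemma sum_swap_outer:
  "(\<Sum>j\<in>A. \<Sum>k\<in>B. \<Sum>l\<in>C. F j k l) = (\<Sum>l\<in>C. \<Sum>k\<in>B. \<Sum>j\<in>A. F j k l)"
proof -
  have "(\<Sum>j\<in>A. \<Sum>k\<in>B. \<Sum>l\<in>C. F j k l) = (\<Sum>k\<in>B. \<Sum>j\<in>A. \<Sum>l\<in>C. F j k l)"
    by (rule sum.swap)
  also have "\<dots> = (\<Sum>k\<in>B. \<Sum>l\<in>C. \<Sum>j\<in>A. F j k l)"
    by (intro sum.cong refl) (rule sum.swap)
  also have "\<dots> = (\<Sum>l\<in>C. \<Sum>k\<in>B. \<Sum>j\<in>A. F j k l)"
    by (rule sum.swap)
  finally show ?thesis .
qed

text \<open>
  A solution \<open>f a\<close> of the catenary equation on \<open>]-T, T[\<close> with derivative \<open>f1\<close>. The dimension enters only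
  through the real number \<open>n\<close>. In the names below, \<open>t = ln (norm y)\<close> is the height of the point with coordinate \<open>y\<close>.
\<close>

locale catenary_chart =
  fixes f :: "real \<Rightarrow> real \<Rightarrow> real" and a T :: real and f1 :: "real \<Rightarrow> real" and n :: real
  assumes f_pos: "\<And>t. - T < t \<Longrightarrow> t < T \<Longrightarrow> f a t > 0"
    and f_deriv: "\<And>t. - T < t \<Longrightarrow> t < T \<Longrightarrow> (f a has_real_derivative f1 t) (at t)"
    and f1_deriv: "\<And>t. - T < t \<Longrightarrow> t < T \<Longrightarrow> (f1 has_real_derivative
        (n - 1) * (cosh (f a t) / sinh (f a t)) * (1 + (f1 t)\<^sup>2)) (at t)"
begin

text \<open>
  \<open>f2\<close> is the second derivative of the solution, \<open>rho\<close> the Euclidean radius in the ball model with derivatives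
  \<open>rho1\<close>, \<open>rho2\<close>, and \<open>H\<close>, with derivatives \<open>H1\<close>, \<open>H2\<close>, the factor for which the horizontal part of the chart is
  \<open>H t *\<^sub>R y\<close>.
\<close>

definition f2 :: "real \<Rightarrow> real" where
  "f2 t = (n - 1) * (cosh (f a t) / sinh (f a t)) * (1 + (f1 t)\<^sup>2)"
definition rho :: "real \<Rightarrow> real" where "rho t = tanh (f a t / 2)"
definition rho1 :: "real \<Rightarrow> real" where "rho1 t = f1 t * (1 - (rho t)\<^sup>2) / 2"
definition rho2 :: "real \<Rightarrow> real" where
  "rho2 t = (f2 t - (f1 t)\<^sup>2 * rho t) * (1 - (rho t)\<^sup>2) / 2"
definition H :: "real \<Rightarrow> real" where "H t = rho t * exp (- t)"
definition H1 :: "real \<Rightarrow> real" where "H1 t = (rho1 t - rho t) * exp (- t)"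
definition H2 :: "real \<Rightarrow> real" where "H2 t = (rho2 t - 2 * rho1 t + rho t) * exp (- t)"

lemma rho_bounds: "- T < t \<Longrightarrow> t < T \<Longrightarrow> 0 < rho t \<and> rho t < 1"
  using f_pos[of t] by (simp add: rho_def tanh_real_lt_1)

lemma rho_deriv: "- T < t \<Longrightarrow> t < T \<Longrightarrow> (rho has_real_derivative rho1 t) (at t)"
  unfolding rho_def[abs_def] rho1_def
  by (auto intro!: derivative_eq_intros f_deriv simp: cosh_real_nonzero)

lemma rho1_deriv: "- T < t \<Longrightarrow> t < T \<Longrightarrow> (rho1 has_real_derivative rho2 t) (at t)"
  unfolding rho1_def[abs_def] rho2_def f2_def
  by (auto intro!: derivative_eq_intros f1_deriv rho_deriv)
     (simp add: rho1_def field_simps power2_eq_square)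

lemma H_deriv: "- T < t \<Longrightarrow> t < T \<Longrightarrow> (H has_real_derivative H1 t) (at t)"
  unfolding H_def[abs_def] H1_def
  by (auto intro!: derivative_eq_intros rho_deriv simp: algebra_simps)

lemma H1_deriv: "- T < t \<Longrightarrow> t < T \<Longrightarrow> (H1 has_real_derivative H2 t) (at t)"
  unfolding H1_def[abs_def] H2_def
  by (auto intro!: derivative_eq_intros rho_deriv rho1_deriv simp: algebra_simps)

lemma sinh_eq_rho: "sinh (f a t) = 2 * rho t / (1 - (rho t)\<^sup>2)"
  and cosh_eq_rho: "cosh (f a t) = (1 + (rho t)\<^sup>2) / (1 - (rho t)\<^sup>2)"
proof -
  define x where "x = f a t / 2"
  have x: "f a t = 2 * x" by (simp add: x_def)
  have c: "cosh x \<noteq> 0" by simp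
  have k: "1 - (rho t)\<^sup>2 = 1 / (cosh x)\<^sup>2" "1 + (rho t)\<^sup>2 = ((cosh x)\<^sup>2 + (sinh x)\<^sup>2) / (cosh x)\<^sup>2"
    using hyperbolic_pythagoras[of x] c
    by (simp_all add: rho_def tanh_def power_divide diff_divide_eq_iff add_divide_eq_iff eq_divide_eq flip: x_def)
  show "sinh (f a t) = 2 * rho t / (1 - (rho t)\<^sup>2)"
    unfolding k x sinh_double using c by (simp add: rho_def tanh_def power2_eq_square flip: x_def)
  show "cosh (f a t) = (1 + (rho t)\<^sup>2) / (1 - (rho t)\<^sup>2)"
    unfolding k x cosh_double using c by simp
qed

lemma has_derivative_chart:
  fixes y :: "real^'n::finite"
  assumes y: "y \<in> annulus (- T) T"
  defines "t \<equiv> ln (norm y)"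
  shows "(catenoid_chart f a has_derivative
     (\<lambda>u. (H t *\<^sub>R u + (H1 t * ((y \<bullet> u) / (norm y)\<^sup>2)) *\<^sub>R y, (y \<bullet> u) / (norm y)\<^sup>2))) (at y)"
proof -
  have y0: "y \<noteq> 0" and t: "- T < t" "t < T" using y by (auto simp: annulus_iff t_def)
  have 1: "((\<lambda>y. (H (ln (norm y)) *\<^sub>R y, ln (norm y))) has_derivative
     (\<lambda>u. (H t *\<^sub>R u + (H1 t * ((y \<bullet> u) / (norm y)\<^sup>2)) *\<^sub>R y, (y \<bullet> u) / (norm y)\<^sup>2))) (at y)"
    unfolding t_def
    by (intro has_derivative_Pair has_derivative_scaleR has_derivative_ident has_derivative_ln_norm
        has_derivative_radial H_deriv t[unfolded t_def] y0)
  show ?thesis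
  proof (rule has_derivative_transform_within_open[OF 1])
    show "open (- {0 :: real^'n})" by (intro open_Compl closed_singleton)
    show "y \<in> - {0}" using y0 by simp
    fix x :: "real^'n" assume "x \<in> - {0}"
    then have "x \<noteq> 0" by simp
    then have "exp (- ln (norm x)) = inverse (norm x)"
      by (simp add: exp_minus)
    then show "(H (ln (norm x)) *\<^sub>R x, ln (norm x)) = catenoid_chart f a x"
      unfolding catenoid_chart_def catenoid_param_def H_def rho_def by simp
  qed
qed

section \<open>The induced metric and the Laplacian of a catenoid\<close>

text \<open>
  The induced metric at \<open>y\<close> is \<open>B t I + C t y y\<^sup>T\<close>; \<open>B1\<close> and \<open>C1\<close> are the derivatives of the coefficients.
\<close>

definition B :: "real \<Rightarrow> real" where "B t = (sinh (f a t))\<^sup>2 * exp (- 2 * t)"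
definition B1 :: "real \<Rightarrow> real" where
  "B1 t = (2 * sinh (f a t) * cosh (f a t) * f1 t - 2 * (sinh (f a t))\<^sup>2) * exp (- 2 * t)"
definition C :: "real \<Rightarrow> real" where "C t = (1 + (f1 t)\<^sup>2 - (sinh (f a t))\<^sup>2) * exp (- 4 * t)"
definition C1 :: "real \<Rightarrow> real" where
  "C1 t = (2 * f1 t * f2 t - 2 * sinh (f a t) * cosh (f a t) * f1 t
      - 4 * (1 + (f1 t)\<^sup>2 - (sinh (f a t))\<^sup>2)) * exp (- 4 * t)"

lemma B_deriv: "- T < t \<Longrightarrow> t < T \<Longrightarrow> (B has_real_derivative B1 t) (at t)"
  unfolding B_def[abs_def] B1_def
  by (auto intro!: derivative_eq_intros f_deriv simp: algebra_simps power2_eq_square)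

lemma C_deriv: "- T < t \<Longrightarrow> t < T \<Longrightarrow> (C has_real_derivative C1 t) (at t)"
  unfolding C_def[abs_def] C1_def
  by (auto intro!: derivative_eq_intros f_deriv f1_deriv[folded f2_def]
      simp: algebra_simps power2_eq_square)

lemma exp_minus_ln_norm:
  "y \<noteq> 0 \<Longrightarrow> exp (- ln (norm y)) = 1 / norm y"
  "y \<noteq> 0 \<Longrightarrow> exp (- 2 * ln (norm y)) = 1 / (norm y)\<^sup>2"
  "y \<noteq> 0 \<Longrightarrow> exp (- 4 * ln (norm y)) = 1 / (norm y)^4" for y :: "'b::real_normed_vector"
proof -
  assume y: "y \<noteq> 0"
  then show 1: "exp (- ln (norm y)) = 1 / norm y" by (simp add: exp_minus divide_inverse)
  have "exp (- 2 * ln (norm y)) = (exp (- ln (norm y)))\<^sup>2" "exp (- 4 * ln (norm y)) = (exp (- ln (norm y)))^4"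
    by (simp_all flip: exp_of_nat_mult)
  then show "exp (- 2 * ln (norm y)) = 1 / (norm y)\<^sup>2" "exp (- 4 * ln (norm y)) = 1 / (norm y)^4"
    by (simp_all add: 1 power_divide)
qed

lemma fst_chart_norm:
  fixes y :: "real^'n::finite"
  assumes "y \<in> annulus (- T) T"
  shows "norm (fst (catenoid_chart f a y)) = rho (ln (norm y))"
  using assms rho_bounds[of "ln (norm y)"]
  by (auto simp: annulus_iff catenoid_chart_def catenoid_param_def simp flip: rho_def)

lemma chart_eq:
  fixes y :: "real^'n::finite"
  assumes "y \<noteq> 0"
  shows "catenoid_chart f a y = ((rho (ln (norm y)) / norm y) *\<^sub>R y, ln (norm y))"
  unfolding catenoid_chart_def catenoid_param_def rho_def[symmetric] by (simp add: divide_inverse)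

lemma induced_metric_chart:
  fixes y :: "real^'n::finite"
  assumes y: "y \<in> annulus (- T) T"
  shows "induced_metric (catenoid_chart f a) y u v
     = B (ln (norm y)) * (u \<bullet> v) + C (ln (norm y)) * (y \<bullet> u) * (y \<bullet> v)"
proof -
  define t r where "t = ln (norm y)" and "r = norm y"
  have y0: "y \<noteq> 0" and t: "- T < t" "t < T" using y by (auto simp: annulus_iff t_def)
  have r: "r > 0" using y0 by (simp add: r_def)
  define K where "K = 1 - (rho t)\<^sup>2"
  have K: "K > 0" using rho_bounds[OF t] by (simp add: K_def abs_square_less_1)
  have ex: "exp (- t) = 1 / r" "exp (- 2 * t) = 1 / r\<^sup>2" "exp (- 4 * t) = 1 / r^4"
    unfolding t_def r_def by (rule exp_minus_ln_norm[OF y0])+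
  have yy: "y \<bullet> y = r\<^sup>2" by (simp add: r_def power2_norm_eq_inner)
  have "induced_metric (catenoid_chart f a) y u v = (2 / K)\<^sup>2 *
     ((H t)\<^sup>2 * (u \<bullet> v) + (2 * H t * H1 t + (H1 t)\<^sup>2) * (y \<bullet> u) * (y \<bullet> v) / r\<^sup>2)
      + (y \<bullet> u) * (y \<bullet> v) / r^4"
    using r K unfolding induced_metric_def hyp_metric_def frechet_derivative_eq[OF has_derivative_chart[OF y]]
      fst_chart_norm[OF y] t_def[symmetric]
    unfolding r_def[symmetric] K_def[symmetric]
    by (simp add: inner_add_left inner_add_right yy inner_commute[of u y] power2_eq_square power4_eq_xxxx)
      (simp add: field_simps)
  also have "\<dots> = B t * (u \<bullet> v) + C t * (y \<bullet> u) * (y \<bullet> v)"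
  proof -
    have f1K: "f1 t = 2 / K * rho1 t" using K by (simp add: rho1_def K_def[symmetric])
    then show ?thesis
    using K r unfolding B_def C_def H_def H1_def ex sinh_eq_rho K_def[symmetric] f1K
    by (simp add: field_simps power2_eq_square power4_eq_xxxx)
  qed
  finally show ?thesis by (simp add: t_def)
qed

lemma gram_chart:
  fixes y :: "real^'n::finite"
  assumes y: "y \<in> annulus (- T) T"
  shows "gram (catenoid_chart f a) y = (\<chi> i j. radial_tensor (B (ln (norm y))) (C (ln (norm y))) y i j)"
proof -
  have "axis i (1::real) \<bullet> axis j 1 = of_bool (i = j)" for i j :: 'n
    by (auto simp: inner_axis_axis)
  moreover have "y \<bullet> axis i 1 = y $ i" for i by (simp add: inner_axis)
  ultimately show ?thesis
    by (simp add: gram_def induced_metric_chart[OF y] radial_tensor_def)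
qed

lemma inv_gram_chart:
  fixes y :: "real^'n::finite"
  assumes y: "y \<in> annulus (- T) T"
  defines "t \<equiv> ln (norm y)"
  shows "inv_gram (catenoid_chart f a) y $ i $ j =
    radial_tensor ((norm y)\<^sup>2 / (sinh (f a t))\<^sup>2) (1 / (1 + (f1 t)\<^sup>2) - 1 / (sinh (f a t))\<^sup>2) y i j"
proof -
  have y0: "y \<noteq> 0" and t: "- T < t" "t < T" using y by (auto simp: annulus_iff t_def)
  have r: "norm y > 0" using y0 by simp
  have S: "sinh (f a t) > 0" using f_pos[OF t] by simp
  have E: "1 + (f1 t)\<^sup>2 > 0" by (simp add: add_pos_nonneg)
  have yy: "y \<bullet> y = (norm y)\<^sup>2" by (simp add: power2_norm_eq_inner)
  have B: "B t = (sinh (f a t))\<^sup>2 / (norm y)\<^sup>2" and C: "C t = (1 + (f1 t)\<^sup>2 - (sinh (f a t))\<^sup>2) / (norm y)^4"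
    unfolding B_def C_def t_def exp_minus_ln_norm[OF y0] by simp_all
  have sum: "B t + C t * (y \<bullet> y) = (1 + (f1 t)\<^sup>2) / (norm y)\<^sup>2"
    using r unfolding B C yy by (simp add: field_simps power2_eq_square power4_eq_xxxx)
  have "B t \<noteq> 0" "B t + C t * (y \<bullet> y) \<noteq> 0"
    unfolding sum unfolding B using r S E by auto
  then have "inv_gram (catenoid_chart f a) y $ i $ j
      = radial_tensor (1 / B t) (- C t / (B t * (B t + C t * (y \<bullet> y)))) y i j"
    unfolding inv_gram_def gram_chart[OF y] t_def[symmetric]
    by (subst matrix_inv_radial_tensor) auto
  moreover have "- C t / (B t * (B t + C t * (y \<bullet> y))) = 1 / (1 + (f1 t)\<^sup>2) - 1 / (sinh (f a t))\<^sup>2"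
    unfolding sum unfolding B C using r S E
    by (simp add: divide_simps)
  ultimately show ?thesis by (simp add: B)
qed

lemma christoffel_chart:
  fixes y :: "real^'n::finite"
  assumes y: "y \<in> annulus (- T) T"
  defines "t \<equiv> ln (norm y)"
  shows "christoffel (induced_metric (catenoid_chart f a)) y u v w =
     (B1 t * ((y \<bullet> u) * (v \<bullet> w) + (y \<bullet> v) * (u \<bullet> w) - (y \<bullet> w) * (u \<bullet> v)) / (norm y)\<^sup>2
      + C1 t * (y \<bullet> u) * (y \<bullet> v) * (y \<bullet> w) / (norm y)\<^sup>2 + 2 * C t * (u \<bullet> v) * (y \<bullet> w)) / 2"
proof -
  have y0: "y \<noteq> 0" and t: "- T < t" "t < T" using y by (auto simp: annulus_iff t_def)
  have "frechet_derivative (\<lambda>q. induced_metric (catenoid_chart f a) q v w) (at y) =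
     (\<lambda>u. B1 t * ((y \<bullet> u) / (norm y)\<^sup>2) * (v \<bullet> w) +
          (C t * ((y \<bullet> v) * (u \<bullet> w) + (u \<bullet> v) * (y \<bullet> w)) +
           C1 t * ((y \<bullet> u) / (norm y)\<^sup>2) * ((y \<bullet> v) * (y \<bullet> w))))" for v w
  proof (rule frechet_derivative_eq)
    have "((\<lambda>q. B (ln (norm q)) * (v \<bullet> w) + C (ln (norm q)) * ((q \<bullet> v) * (q \<bullet> w))) has_derivative
      (\<lambda>u. B1 t * ((y \<bullet> u) / (norm y)\<^sup>2) * (v \<bullet> w) +
          (C t * ((y \<bullet> v) * (u \<bullet> w) + (u \<bullet> v) * (y \<bullet> w)) +
           C1 t * ((y \<bullet> u) / (norm y)\<^sup>2) * ((y \<bullet> v) * (y \<bullet> w))))) (at y)"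
      unfolding t_def
      by (intro has_derivative_add has_derivative_mult_left has_derivative_mult
          has_derivative_radial B_deriv C_deriv t[unfolded t_def] y0 has_derivative_inner_left has_derivative_ident)
    then show "((\<lambda>q. induced_metric (catenoid_chart f a) q v w) has_derivative
      (\<lambda>u. B1 t * ((y \<bullet> u) / (norm y)\<^sup>2) * (v \<bullet> w) +
          (C t * ((y \<bullet> v) * (u \<bullet> w) + (u \<bullet> v) * (y \<bullet> w)) +
           C1 t * ((y \<bullet> u) / (norm y)\<^sup>2) * ((y \<bullet> v) * (y \<bullet> w))))) (at y)"
      by (rule has_derivative_transform_within_open[OF _ open_annulus y])
         (simp add: induced_metric_chart)
  qed
  then show ?thesis
    unfolding christoffel_def
    by (simp add: inner_commute algebra_simps add_divide_distrib diff_divide_distrib)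
qed

text \<open>
  The first-order term drops out: \<open>\<surd> det g\<close> times \<open>g\<^sup>t\<^sup>t\<close> does not depend on the height by the first integral of the
  catenary equation, which is to say that the height is harmonic.
\<close>

lemma laplacian_radial:
  fixes y :: "real^'n::finite"
  assumes n: "n = real CARD('n)" and y: "y \<in> annulus \<alpha> \<beta>" and sub: "- T \<le> \<alpha>" "\<beta> \<le> T"
    and W: "\<And>t. \<alpha> < t \<Longrightarrow> t < \<beta> \<Longrightarrow> (W has_real_derivative W1 t) (at t)"
    and W1: "(W1 has_real_derivative W2) (at (ln (norm y)))"
  shows "laplacian (catenoid_chart f a) (\<lambda>y. W (ln (norm y))) y = W2 / (1 + (f1 (ln (norm y)))\<^sup>2)"
proof -
  define t r where "t = ln (norm y)" and "r = norm y"
  have y': "y \<in> annulus (- T) T" using y sub by (auto simp: annulus_iff)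
  have y0: "y \<noteq> 0" and t: "- T < t" "t < T" "\<alpha> < t" "t < \<beta>" using y sub by (auto simp: annulus_iff t_def)
  have r: "r > 0" using y0 by (simp add: r_def)
  define S Ch E where "S = sinh (f a t)" and "Ch = cosh (f a t)" and "E = 1 + (f1 t)\<^sup>2"
  have S: "S > 0" using f_pos[OF t(1,2)] by (simp add: S_def)
  have E: "E > 0" by (simp add: E_def add_pos_nonneg)
  have yy: "y \<bullet> y = r\<^sup>2" by (simp add: r_def power2_norm_eq_inner)
  let ?g = "radial_tensor (r\<^sup>2 / S\<^sup>2) (1 / E - 1 / S\<^sup>2) y"
  have g: "inv_gram (catenoid_chart f a) y $ i $ j = ?g i j" for i j
    using inv_gram_chart[OF y'] by (simp add: S_def E_def r_def t_def)
  have gy: "(\<Sum>k\<in>UNIV. ?g k l * y $ k) = r\<^sup>2 / E * y $ l" for l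
    by (subst radial_tensor_sym, subst radial_tensor_vec) (use S E r in \<open>simp add: yy field_simps\<close>)
  let ?c = "\<lambda>i j l. christoffel (induced_metric (catenoid_chart f a)) y (axis i 1) (axis j 1) (axis l 1)"
  have ax: "axis i (1::real) \<bullet> axis j 1 = of_bool (i = j)" for i j :: 'n
    by (auto simp: inner_axis_axis)
  have c: "(\<Sum>l\<in>UNIV. ?c i j l * y $ l)
      = radial_tensor ((2 * C t * r\<^sup>2 - B1 t) / 2) ((2 * B1 t / r\<^sup>2 + C1 t) / 2) y i j" for i j
  proof -
    have "(\<Sum>l\<in>UNIV. ?c i j l * y $ l) = (\<Sum>l\<in>UNIV. (if l = j then B1 t * (y $ i) * (y $ j) / r\<^sup>2 / 2 else 0)
        + (if l = i then B1 t * (y $ i) * (y $ j) / r\<^sup>2 / 2 else 0)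
        + (- B1 t / r\<^sup>2 * of_bool (i = j) / 2 + C1 t * (y $ i) * (y $ j) / r\<^sup>2 / 2
           + C t * of_bool (i = j)) * (y $ l * y $ l))"
      unfolding christoffel_chart[OF y'] ax t_def[symmetric]
      unfolding r_def[symmetric]
      by (intro sum.cong) (auto simp: inner_axis add_divide_distrib diff_divide_distrib algebra_simps)
    also have "\<dots> = B1 t * (y $ i) * (y $ j) / r\<^sup>2
        + (- B1 t / r\<^sup>2 * of_bool (i = j) / 2 + C1 t * (y $ i) * (y $ j) / r\<^sup>2 / 2
           + C t * of_bool (i = j)) * r\<^sup>2"
      unfolding sum.distrib sum_distrib_left[symmetric] yy[symmetric] inner_vec_def inner_real_def
      by simp
    also have "\<dots> = radial_tensor ((2 * C t * r\<^sup>2 - B1 t) / 2) ((2 * B1 t / r\<^sup>2 + C1 t) / 2) y i j"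
      unfolding radial_tensor_def using r by (simp add: field_simps)
    finally show ?thesis .
  qed
  let ?w = "\<lambda>y :: real^'n. W (ln (norm y))"
  have sm: "(\<Sum>k\<in>UNIV. \<Sum>l\<in>UNIV. inv_gram (catenoid_chart f a) y $ k $ l * ?c i j l * partial k ?w y)
      = W1 t / E * (\<Sum>l\<in>UNIV. ?c i j l * y $ l)" for i j
  proof -
    have "(\<Sum>k\<in>UNIV. \<Sum>l\<in>UNIV. inv_gram (catenoid_chart f a) y $ k $ l * ?c i j l * partial k ?w y)
      = (\<Sum>l\<in>UNIV. \<Sum>k\<in>UNIV. W1 t / r\<^sup>2 * ?c i j l * (?g k l * y $ k))"
      by (subst sum.swap, intro sum.cong refl)
         (simp add: g partial_radial[OF W[OF t(3,4), unfolded t_def] y0] t_def r_def)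
    also have "\<dots> = W1 t / E * (\<Sum>l\<in>UNIV. ?c i j l * y $ l)"
      unfolding sum_distrib_left[symmetric] gy using r
      by (simp add: sum_distrib_left field_simps)
    finally show ?thesis .
  qed
  have pp: "partial i (partial j ?w) y = radial_tensor (W1 t / r\<^sup>2) ((W2 - 2 * W1 t) / r^4) y i j" for i j
    unfolding t_def r_def by (rule partial_partial_radial[OF y W W1])
  have h: "hess (catenoid_chart f a) ?w y i j =
      radial_tensor (W1 t / r\<^sup>2 - W1 t / E * ((2 * C t * r\<^sup>2 - B1 t) / 2))
        ((W2 - 2 * W1 t) / r^4 - W1 t / E * ((2 * B1 t / r\<^sup>2 + C1 t) / 2)) y i j" for i j
    unfolding hess_def pp sm c by (simp add: radial_tensor_def algebra_simps)
  have ex: "exp (- 2 * t) = 1 / r\<^sup>2" "exp (- 4 * t) = 1 / r^4"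
    unfolding t_def r_def by (rule exp_minus_ln_norm[OF y0])+
  have BC: "B1 t = (2 * S * Ch * f1 t - 2 * S\<^sup>2) / r\<^sup>2" "C t = (E - S\<^sup>2) / r^4"
    "C1 t = (2 * f1 t * ((n - 1) * (Ch / S) * E) - 2 * S * Ch * f1 t - 4 * (E - S\<^sup>2)) / r^4"
    unfolding B1_def C_def C1_def f2_def ex S_def Ch_def E_def by simp_all
  define R where "R = r\<^sup>2"
  have R: "R > 0" using r by (simp add: R_def)
  have r4: "r^4 = R\<^sup>2" by (simp add: R_def)
  have "W1 t / R - W1 t / E * ((2 * C t * R - B1 t) / 2) = W1 t * S * Ch * f1 t / (E * R)"
    unfolding BC r4 R_def[symmetric] using R E by (simp add: field_simps power2_eq_square)
  moreover have "(W2 - 2 * W1 t) / R\<^sup>2 - W1 t / E * ((2 * B1 t / R + C1 t) / 2)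
     = (W2 - W1 t * S * Ch * f1 t / E - (n - 1) * W1 t * f1 t * Ch / S) / R\<^sup>2"
    unfolding BC r4 R_def[symmetric] using R E S by (simp add: field_simps power2_eq_square)
  ultimately have h': "hess (catenoid_chart f a) ?w y i j =
      radial_tensor (W1 t * S * Ch * f1 t / (E * R))
        ((W2 - W1 t * S * Ch * f1 t / E - (n - 1) * W1 t * f1 t * Ch / S) / R\<^sup>2) y i j" for i j
    using h[of i j] by (simp add: r4 flip: R_def)
  have "laplacian (catenoid_chart f a) ?w y = W2 / E"
    unfolding laplacian_def g h' radial_tensor_contract n[symmetric] yy R_def[symmetric]
    using R S E by (simp add: field_simps power2_eq_square)
  then show ?thesis by (simp add: E_def t_def)
qed

section \<open>The second fundamental form and the Jacobi operator\<close>

text \<open>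
  The sign \<open>\<plusminus>\<close> of the normal is hidden in \<open>k = \<plusminus> 1 / E\<close>; only \<open>k\<^sup>2\<close> enters the Jacobi operator.
\<close>

lemma unit_normal_chart:
  fixes y :: "real^'n::finite"
  assumes y: "y \<in> annulus (- T) T"
    and N: "unit_normal (catenoid_chart f a) (annulus (- T) T) N"
  defines "t \<equiv> ln (norm y)"
  obtains k where "N (catenoid_chart f a y) =
      ((k * (1 - (rho t)\<^sup>2) / (2 * norm y)) *\<^sub>R y, - k * f1 t)" "k\<^sup>2 * (1 + (f1 t)\<^sup>2) = 1"
proof -
  define p where "p = catenoid_chart f a y"
  define Nx Nt where "Nx = fst (N p)" and "Nt = snd (N p)"
  define K r where "K = 1 - (rho t)\<^sup>2" and "r = norm y"
  have y0: "y \<noteq> 0" and t: "- T < t" "t < T" using y by (auto simp: annulus_iff t_def)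
  have r: "r > 0" using y0 by (simp add: r_def)
  have K: "K > 0" using rho_bounds[OF t] by (simp add: K_def abs_square_less_1)
  have yy: "y \<bullet> y = r\<^sup>2" by (simp add: r_def power2_norm_eq_inner)
  have ex: "exp (- t) = 1 / r"
    unfolding t_def r_def by (rule exp_minus_ln_norm[OF y0])
  have H: "H t > 0" using rho_bounds[OF t] by (simp add: H_def)
  have hm: "hyp_metric p (N p) v = (2 / K)\<^sup>2 * (Nx \<bullet> fst v) + Nt * snd v" for v
    unfolding hyp_metric_def p_def fst_chart_norm[OF y] K_def t_def Nx_def Nt_def by simp
  have orth: "(2 / K)\<^sup>2 * (Nx \<bullet> (H t *\<^sub>R u + (H1 t * ((y \<bullet> u) / r\<^sup>2)) *\<^sub>R y)) + Nt * ((y \<bullet> u) / r\<^sup>2) = 0" for u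
    using N y hm unfolding unit_normal_def p_def[symmetric] frechet_derivative_eq[OF has_derivative_chart[OF y]]
    by (auto simp: p_def t_def r_def frechet_derivative_eq[OF has_derivative_chart[OF y]])
  have unit: "(2 / K)\<^sup>2 * (Nx \<bullet> Nx) + Nt * Nt = 1"
    using N y hm[of "N p"] unfolding unit_normal_def p_def by (simp add: Nx_def Nt_def p_def)
  define c where "c = (Nx \<bullet> y) / r"
  define u where "u = Nx - (c / r) *\<^sub>R y"
  have yu: "y \<bullet> u = 0"
    using r by (simp add: u_def inner_diff_right yy c_def inner_commute power2_eq_square)
  have "Nx \<bullet> u = 0"
    using orth[of u] K H by (simp add: yu)
  then have "u \<bullet> u = 0"
    using yu by (simp add: u_def inner_diff_left)
  then have Nx: "Nx = (c / r) *\<^sub>R y" by (simp add: u_def)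
  have "(2 / K)\<^sup>2 * (c * r * (H t + H1 t)) + Nt = 0"
    using orth[of y] r unfolding Nx by (simp add: yy inner_add_right power2_eq_square algebra_simps)
  moreover have "r * (H t + H1 t) = rho1 t"
    using r unfolding H_def H1_def ex by (simp add: field_simps)
  moreover have "c * r * (H t + H1 t) = c * (r * (H t + H1 t))" by simp
  ultimately have "Nt = - ((2 / K)\<^sup>2 * (c * rho1 t))" by simp
  moreover have "rho1 t = f1 t * K / 2" by (simp add: rho1_def K_def)
  ultimately have Nt: "Nt = - (2 / K) * c * f1 t"
    using K by (simp add: power2_eq_square)
  have "(2 / K)\<^sup>2 * c\<^sup>2 * (1 + (f1 t)\<^sup>2) = 1"
  proof -
    have "Nx \<bullet> Nx = c\<^sup>2" using r by (simp add: Nx yy power2_eq_square)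
    moreover have "Nt * Nt = (2 / K)\<^sup>2 * c\<^sup>2 * (f1 t)\<^sup>2" by (simp add: Nt power2_eq_square)
    ultimately show ?thesis using unit by (simp add: distrib_left)
  qed
  moreover have "(2 * c / K)\<^sup>2 = (2 / K)\<^sup>2 * c\<^sup>2" by (simp add: power_divide power_mult_distrib)
  ultimately have sq: "(2 * c / K)\<^sup>2 * (1 + (f1 t)\<^sup>2) = 1" by simp
  have Np: "N p = ((2 * c / K * K / (2 * r)) *\<^sub>R y, - (2 * c / K) * f1 t)"
    using K Nx Nt by (simp add: Nx_def Nt_def prod_eq_iff)
  show ?thesis using that[of "2 * c / K"] sq Np unfolding p_def K_def r_def by blast
qed

lemma partial_chart:
  fixes y :: "real^'n::finite"
  assumes y: "y \<in> annulus (- T) T"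
  shows "partial j (catenoid_chart f a) y = (H (ln (norm y)) *\<^sub>R axis j 1
      + (H1 (ln (norm y)) * (y $ j / (norm y)\<^sup>2)) *\<^sub>R y, y $ j / (norm y)\<^sup>2)"
  using partial_eq[OF has_derivative_chart[OF y], of j] by (simp add: inner_axis)

lemma partial_partial_chart:
  fixes y :: "real^'n::finite"
  assumes y: "y \<in> annulus (- T) T"
  defines "t \<equiv> ln (norm y)" and "r \<equiv> norm y"
  shows "partial i (partial j (catenoid_chart f a)) y =
     ((H1 t * (y $ i / r\<^sup>2)) *\<^sub>R axis j 1 +
        ((H1 t * (y $ j / r\<^sup>2)) *\<^sub>R axis i 1
        + (H1 t * radial_tensor (1 / r\<^sup>2) (- 2 / r^4) y i j + H2 t * (y $ i / r\<^sup>2) * (y $ j / r\<^sup>2)) *\<^sub>R y),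
      radial_tensor (1 / r\<^sup>2) (- 2 / r^4) y i j)"
proof -
  have y0: "y \<noteq> 0" and t: "- T < t" "t < T" using y by (auto simp: annulus_iff t_def)
  have D: "axis i 1 $ j / r\<^sup>2 - 2 * (y $ j) * (y \<bullet> axis i 1) / r^4 = radial_tensor (1 / r\<^sup>2) (- 2 / r^4) y i j"
  proof -
    have "axis i (1::real) $ j = of_bool (i = j)" by (auto simp: axis_def)
    moreover have "y \<bullet> axis i 1 = y $ i" by (simp add: inner_axis)
    ultimately show ?thesis by (simp add: radial_tensor_def)
  qed
  have "partial i (partial j (catenoid_chart f a)) y
      = partial i (\<lambda>y. (H (ln (norm y)) *\<^sub>R axis j 1
      + (H1 (ln (norm y)) * (y $ j / (norm y)\<^sup>2)) *\<^sub>R y, y $ j / (norm y)\<^sup>2)) y"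
    by (rule partial_cong_open[OF open_annulus y]) (rule partial_chart)
  also have "\<dots> = ((H1 t * ((y \<bullet> axis i 1) / (norm y)\<^sup>2)) *\<^sub>R axis j 1
      + ((H1 t * (y $ j / (norm y)\<^sup>2)) *\<^sub>R axis i 1 +
         (H1 t * (axis i 1 $ j / (norm y)\<^sup>2 - 2 * (y $ j) * (y \<bullet> axis i 1) / (norm y)^4)
          + H2 t * ((y \<bullet> axis i 1) / (norm y)\<^sup>2) * (y $ j / (norm y)\<^sup>2)) *\<^sub>R y),
        axis i 1 $ j / (norm y)\<^sup>2 - 2 * (y $ j) * (y \<bullet> axis i 1) / (norm y)^4)"
    unfolding t_def
    by (rule partial_eq, intro has_derivative_Pair has_derivative_add has_derivative_scaleR_left
        has_derivative_scaleR has_derivative_mult has_derivative_component_over_norm2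
        has_derivative_radial H_deriv H1_deriv t[unfolded t_def] y0 has_derivative_ident)
  finally show ?thesis unfolding D[unfolded r_def] r_def by (simp add: inner_axis)
qed

text \<open>
  Both principal curvatures can be read off: \<open>(n - 1) coth f / E\<close> along the profile and \<open>- coth f / E\<close> along the
  spheres, up to the choice of the normal.
\<close>

lemma second_ff_chart:
  fixes y :: "real^'n::finite"
  assumes y: "y \<in> annulus (- T) T"
  defines "t \<equiv> ln (norm y)" and "r \<equiv> norm y"
  assumes N: "N (catenoid_chart f a y) = ((k * (1 - (rho t)\<^sup>2) / (2 * norm y)) *\<^sub>R y, - k * f1 t)"
  shows "second_ff (catenoid_chart f a) N y i j =
     radial_tensor (- k * sinh (f a t) * cosh (f a t) / r\<^sup>2)
       (k * (f2 t + sinh (f a t) * cosh (f a t)) / r^4) y i j"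
proof -
  define p where "p = catenoid_chart f a y"
  define K where "K = 1 - (rho t)\<^sup>2"
  have y0: "y \<noteq> 0" and t: "- T < t" "t < T" using y by (auto simp: annulus_iff t_def)
  have r: "r > 0" using y0 by (simp add: r_def)
  have K: "K > 0" using rho_bounds[OF t] by (simp add: K_def abs_square_less_1)
  have yy: "y \<bullet> y = r\<^sup>2" by (simp add: r_def power2_norm_eq_inner)
  have ex: "exp (- t) = 1 / r"
    unfolding t_def r_def by (rule exp_minus_ln_norm[OF y0])
  have np: "norm (fst p) = rho t" unfolding p_def t_def by (rule fst_chart_norm[OF y])
  then have np1: "norm (fst p) < 1" using rho_bounds[OF t] by simp
  have fp: "fst p = (rho t / r) *\<^sub>R y" using chart_eq[OF y0] by (simp add: p_def t_def r_def)
  have N': "N p = ((k * K / (2 * r)) *\<^sub>R y, - k * f1 t)" using N by (simp add: p_def K_def r_def)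
  have ax: "axis i (1::real) \<bullet> axis j 1 = of_bool (i = j)" "y \<bullet> axis i 1 = y $ i" "axis i 1 \<bullet> y = y $ i" for i j :: 'n
    by (auto simp: inner_axis_axis) (simp_all add: inner_axis inner_axis')
  define R where "R = r\<^sup>2"
  have R: "R > 0" using r by (simp add: R_def)
  have r4: "r^4 = R\<^sup>2" by (simp add: R_def)
  define q d where "q = (y $ i) * (y $ j)" and "d = (of_bool (i = j) :: real)"
  have rt: "radial_tensor a b y i j = a * d + b * q" for a b by (simp add: radial_tensor_def q_def d_def)
  have Hs: "H t = rho t / r" "H1 t = (rho1 t - rho t) / r" "H2 t = (rho2 t - 2 * rho1 t + rho t) / r"
    unfolding H_def H1_def H2_def ex by simp_all
  let ?X = "fst (partial i (partial j (catenoid_chart f a)) y)"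
  have X: "?X \<bullet> y = H1 t * d + H2 t * q / R"
    unfolding partial_partial_chart[OF y] t_def[symmetric] unfolding r_def[symmetric] r4 R_def[symmetric] rt
    using R yy[folded R_def] by (simp add: inner_add_left ax q_def power2_eq_square field_simps)
  have "hyp_metric p (partial i (partial j (catenoid_chart f a)) y) (N p) =
     (2 / K)\<^sup>2 * (k * K / (2 * r) * (?X \<bullet> y)) - k * f1 t * (d / R - 2 * q / R\<^sup>2)"
    unfolding hyp_metric_def np K_def[symmetric] N'
    by (simp add: partial_partial_chart[OF y] rt r4 flip: r_def R_def)
  also have "\<dots> = (2 / K)\<^sup>2 * (k * K / 2) * ((rho2 t - rho1 t) * q / R\<^sup>2 + (rho1 t - rho t) * (d / R - q / R\<^sup>2))
       - k * f1 t * (d / R - 2 * q / R\<^sup>2)"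
    unfolding X Hs R_def using r K by (simp add: field_simps power2_eq_square)
  finally have hm: "hyp_metric p (partial i (partial j (catenoid_chart f a)) y) (N p) = \<dots>" .
  let ?P = "\<lambda>i. fst (partial i (catenoid_chart f a) y)"
  have P: "?P i = H t *\<^sub>R axis i 1 + (H1 t * (y $ i / R)) *\<^sub>R y" for i
    unfolding partial_chart[OF y] t_def[symmetric] unfolding r_def[symmetric] R_def[symmetric] by simp
  have yP: "y \<bullet> ?P i = rho1 t * y $ i / r" for i
    unfolding P Hs using R r by (simp add: inner_add_right ax yy R_def field_simps)
  have PP: "?P i \<bullet> ?P j = (rho t)\<^sup>2 / R * d + ((rho1 t)\<^sup>2 - (rho t)\<^sup>2) * q / R\<^sup>2"
    unfolding P Hs using r
    by (simp add: inner_add_right inner_add_left ax yy R_def q_def d_def power2_eq_square inner_commute)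
       (simp add: field_simps)
  have chr: "christoffel hyp_metric p (partial i (catenoid_chart f a) y) (partial j (catenoid_chart f a) y) (N p)
     = (2 / K)^3 * (k * K / 2) * rho t * ((rho1 t)\<^sup>2 * q / R\<^sup>2 - (rho t)\<^sup>2 * (d / R - q / R\<^sup>2))"
  proof -
    have 1: "fst p \<bullet> ?P i = rho t * rho1 t * y $ i / R" for i
      unfolding fp using yP[of i] by (simp add: R_def power2_eq_square)
    have 2: "?P i \<bullet> fst (N p) = k * K / 2 * rho1 t * y $ i / R" for i
      unfolding N' using yP[of i] by (simp add: R_def power2_eq_square inner_commute)
    have 3: "fst p \<bullet> fst (N p) = k * K / 2 * rho t"
      unfolding N' fp using r by (simp add: yy power2_eq_square)
    show ?thesis
      unfolding christoffel_hyp_metric[OF np1] np K_def[symmetric] 1 2 3 PP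
      using R K by (simp add: q_def power2_eq_square field_simps)
  qed
  have rhos: "rho1 t = f1 t * K / 2" "rho2 t = (f2 t - (f1 t)\<^sup>2 * rho t) * K / 2"
     by (simp_all add: rho1_def rho2_def K_def)
  have rK: "(rho t)\<^sup>2 = 1 - K" by (simp add: K_def)
  define w z where "w = q / R\<^sup>2" and "z = d / R - q / R\<^sup>2"
  have "second_ff (catenoid_chart f a) N y i j =
     (2 / K)\<^sup>2 * (k * K / 2) * ((rho2 t - rho1 t) * w + (rho1 t - rho t) * z) - k * f1 t * (z - w)
     + (2 / K)^3 * (k * K / 2) * rho t * ((rho1 t)\<^sup>2 * w - (1 - K) * z)"
    unfolding second_ff_def p_def[symmetric] hm chr w_def z_def rK[symmetric]
    by (simp add: algebra_simps diff_divide_distrib add_divide_distrib)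
  also have "\<dots> = k * (f2 t * w - 2 * rho t * (2 - K) / K\<^sup>2 * z)"
    unfolding rhos using K by (simp add: field_simps power2_eq_square power3_eq_cube)
  also have "\<dots> = k * (f2 t * q / R\<^sup>2 - 2 * rho t * (1 + (rho t)\<^sup>2) / K\<^sup>2 * (d / R - q / R\<^sup>2))"
    unfolding rK w_def z_def by simp
  finally have "second_ff (catenoid_chart f a) N y i j = \<dots>" .
  moreover have "sinh (f a t) * cosh (f a t) = 2 * rho t * (1 + (rho t)\<^sup>2) / K\<^sup>2"
    unfolding sinh_eq_rho cosh_eq_rho K_def[symmetric] by (simp add: power2_eq_square)
  ultimately have "second_ff (catenoid_chart f a) N y i j =
      k * (f2 t * q / R\<^sup>2 - sinh (f a t) * cosh (f a t) * (d / R - q / R\<^sup>2))" by simp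
  then show ?thesis
    unfolding rt r4 R_def[symmetric] by (simp add: algebra_simps add_divide_distrib)
qed

lemma second_ff_norm2_chart:
  fixes y :: "real^'n::finite"
  assumes n: "n = real CARD('n)" and y: "y \<in> annulus (- T) T"
    and N: "unit_normal (catenoid_chart f a) (annulus (- T) T) N"
  defines "t \<equiv> ln (norm y)"
  shows "second_ff_norm2 (catenoid_chart f a) N y
     = n * (n - 1) * (cosh (f a t) / sinh (f a t))\<^sup>2 / (1 + (f1 t)\<^sup>2)"
proof -
  define r where "r = norm y"
  have y0: "y \<noteq> 0" and t: "- T < t" "t < T" using y by (auto simp: annulus_iff t_def)
  define R where "R = r\<^sup>2"
  have R: "R > 0" using y0 by (simp add: R_def r_def)
  have r4: "r^4 = R\<^sup>2" by (simp add: R_def)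
  have yy: "y \<bullet> y = R" by (simp add: r_def R_def power2_norm_eq_inner)
  define S Ch E where "S = sinh (f a t)" and "Ch = cosh (f a t)" and "E = 1 + (f1 t)\<^sup>2"
  have S: "S > 0" using f_pos[OF t(1,2)] by (simp add: S_def)
  have E: "E > 0" by (simp add: E_def add_pos_nonneg)
  obtain k where k: "N (catenoid_chart f a y) =
      ((k * (1 - (rho t)\<^sup>2) / (2 * norm y)) *\<^sub>R y, - k * f1 t)" "k\<^sup>2 * E = 1"
    using unit_normal_chart[OF y N] unfolding t_def E_def by blast
  let ?g = "radial_tensor (R / S\<^sup>2) (1 / E - 1 / S\<^sup>2) y"
  let ?A = "radial_tensor (- k * S * Ch / R) (k * (f2 t + S * Ch) / R\<^sup>2) y"
  have g: "inv_gram (catenoid_chart f a) y $ i $ j = ?g i j" for i j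
    using inv_gram_chart[OF y] by (simp add: S_def E_def r_def R_def t_def)
  have A: "second_ff (catenoid_chart f a) N y i j = ?A i j" for i j
    using second_ff_chart[of y N k i j, OF y k(1)[unfolded t_def]] unfolding t_def[symmetric]
    unfolding r_def[symmetric] r4 R_def[symmetric] by (simp add: S_def Ch_def)
  have gA: "(\<Sum>k\<in>UNIV. ?g i k * ?A k l) = radial_tensor (- k * Ch / S) ((k * f2 t / E + k * Ch / S) / R) y i l" for i l
  proof -
    have "R / S\<^sup>2 * (- k * S * Ch / R) = - k * Ch / S" using R S by (simp add: field_simps power2_eq_square)
    moreover have "R / S\<^sup>2 * (k * (f2 t + S * Ch) / R\<^sup>2) + (1 / E - 1 / S\<^sup>2) * (- k * S * Ch / R)
        + (1 / E - 1 / S\<^sup>2) * (k * (f2 t + S * Ch) / R\<^sup>2) * R = (k * f2 t / E + k * Ch / S) / R"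
      using R S E by (simp add: field_simps power2_eq_square)
    ultimately show ?thesis unfolding radial_tensor_mult yy by simp
  qed
  have "second_ff_norm2 (catenoid_chart f a) N y
      = (\<Sum>i\<in>UNIV. \<Sum>l\<in>UNIV. (\<Sum>k\<in>UNIV. ?g i k * ?A k l) * (\<Sum>j\<in>UNIV. ?g l j * ?A j i))"
  proof -
    have "second_ff_norm2 (catenoid_chart f a) N y
        = (\<Sum>i\<in>UNIV. \<Sum>j\<in>UNIV. \<Sum>k\<in>UNIV. \<Sum>l\<in>UNIV. (?g i k * ?A k l) * (?g l j * ?A j i))"
      unfolding second_ff_norm2_def g A
      by (intro sum.cong refl) (simp add: radial_tensor_sym[of _ _ y j l for j l] radial_tensor_sym[of _ _ y i j for i j] mult_ac)
    also have "\<dots> = (\<Sum>i\<in>UNIV. \<Sum>l\<in>UNIV. (\<Sum>k\<in>UNIV. ?g i k * ?A k l) * (\<Sum>j\<in>UNIV. ?g l j * ?A j i))"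
      unfolding sum_product by (subst sum_swap_outer) (rule refl)
    finally show ?thesis .
  qed
  also have "\<dots> = n * (k * Ch / S)\<^sup>2 + ((k * f2 t / E)\<^sup>2 - (k * Ch / S)\<^sup>2)"
  proof -
    let ?M = "radial_tensor (- k * Ch / S) ((k * f2 t / E + k * Ch / S) / R) y"
    have "(\<Sum>i\<in>UNIV. \<Sum>l\<in>UNIV. (\<Sum>k\<in>UNIV. ?g i k * ?A k l) * (\<Sum>j\<in>UNIV. ?g l j * ?A j i))
       = (\<Sum>i\<in>UNIV. \<Sum>l\<in>UNIV. ?M i l * ?M i l)"
      unfolding gA by (intro sum.cong refl arg_cong2[where f="(*)"] radial_tensor_sym)
    also have "\<dots> = n * (k * Ch / S)\<^sup>2 + ((k * f2 t / E)\<^sup>2 - (k * Ch / S)\<^sup>2)"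
      unfolding radial_tensor_contract n[symmetric] yy using R S E
      by (simp add: field_simps power2_eq_square)
    finally show ?thesis .
  qed
  also have "\<dots> = n * (n - 1) * (Ch / S)\<^sup>2 / E"
  proof -
    have "f2 t = (n - 1) * (Ch / S) * E" by (simp add: f2_def Ch_def S_def E_def)
    then have "k * f2 t / E = k * ((n - 1) * (Ch / S))" using E by simp
    then have "n * (k * Ch / S)\<^sup>2 + ((k * f2 t / E)\<^sup>2 - (k * Ch / S)\<^sup>2) = n * (n - 1) * (Ch / S)\<^sup>2 * k\<^sup>2"
      unfolding times_divide_eq_right[symmetric] power_mult_distrib by algebra
    moreover have "k\<^sup>2 = 1 / E" using k(2) E by (simp add: field_simps)
    ultimately show ?thesis by simp
  qed
  finally show ?thesis by (simp add: S_def Ch_def E_def)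
qed

lemma jacobi_op_radial:
  fixes y :: "real^'n::finite"
  assumes n: "n = real CARD('n)" and y: "y \<in> annulus \<alpha> \<beta>" and sub: "- T \<le> \<alpha>" "\<beta> \<le> T"
    and N: "unit_normal (catenoid_chart f a) (annulus (- T) T) N"
    and W: "\<And>t. \<alpha> < t \<Longrightarrow> t < \<beta> \<Longrightarrow> (W has_real_derivative W1 t) (at t)"
    and W1: "(W1 has_real_derivative W2) (at (ln (norm y)))"
  defines "t \<equiv> ln (norm y)"
  shows "jacobi_op (catenoid_chart f a) N (\<lambda>y. W (ln (norm y))) y
    = (- W2 - (n - 1) * (n * (cosh (f a t) / sinh (f a t))\<^sup>2 - 1) * W t) / (1 + (f1 t)\<^sup>2)"
proof -
  have y': "y \<in> annulus (- T) T" using y sub by (auto simp: annulus_iff)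
  have E: "1 + (f1 t)\<^sup>2 > 0" by (simp add: add_pos_nonneg)
  obtain k where k: "N (catenoid_chart f a y) =
      ((k * (1 - (rho t)\<^sup>2) / (2 * norm y)) *\<^sub>R y, - k * f1 t)" "k\<^sup>2 * (1 + (f1 t)\<^sup>2) = 1"
    using unit_normal_chart[OF y' N] unfolding t_def by blast
  then have "k\<^sup>2 = 1 / (1 + (f1 t)\<^sup>2)" using E by (simp add: field_simps)
  then have "(k * f1 t)\<^sup>2 = (f1 t)\<^sup>2 / (1 + (f1 t)\<^sup>2)" by (simp add: power_mult_distrib)
  then have v: "1 - (vertical_component (catenoid_chart f a) N y)\<^sup>2 = 1 / (1 + (f1 t)\<^sup>2)"
    unfolding vertical_component_def hyp_metric_def k(1) using E by (simp add: field_simps)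
  have l: "laplacian (catenoid_chart f a) (\<lambda>y. W (ln (norm y))) y = W2 / (1 + (f1 t)\<^sup>2)"
    unfolding t_def by (rule laplacian_radial[OF n y sub W W1])
  have s: "second_ff_norm2 (catenoid_chart f a) N y
     = n * (n - 1) * (cosh (f a t) / sinh (f a t))\<^sup>2 / (1 + (f1 t)\<^sup>2)"
    unfolding t_def by (rule second_ff_norm2_chart[OF n y' N])
  show ?thesis
    unfolding jacobi_op_def n[symmetric] v l s t_def[symmetric]
    by (simp add: add_divide_distrib diff_divide_distrib algebra_simps)
qed

end

section \<open>The maximum principle for the Jacobi operator\<close>

lemma second_derivative_nonpos_at_max:
  fixes g :: "real \<Rightarrow> real"
  assumes d: "d > 0" and g: "\<And>s. \<bar>s\<bar> < d \<Longrightarrow> (g has_real_derivative g' s) (at s)"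
    and g': "(g' has_real_derivative D) (at 0)" and le: "\<And>s. \<bar>s\<bar> < d \<Longrightarrow> g s \<le> g 0"
  shows "g' 0 = 0" "D \<le> 0"
proof -
  show 0: "g' 0 = 0"
    using DERIV_local_max[OF g[of 0] d] d le by simp
  show "D \<le> 0"
  proof (rule ccontr)
    assume "\<not> D \<le> 0"
    then obtain e where e: "e > 0" "\<And>h. 0 < h \<Longrightarrow> h < e \<Longrightarrow> g' 0 < g' (0 + h)"
      using DERIV_pos_inc_right[OF g'] by force
    define h where "h = min d e / 2"
    have h: "0 < h" "h < d" "h < e" using d e(1) by (auto simp: h_def)
    have "\<exists>z. 0 < z \<and> z < h \<and> g h - g 0 = (h - 0) * g' z"
      by (rule MVT2) (use h g in auto)
    then obtain z where z: "0 < z" "z < h" "g h - g 0 = h * g' z" by auto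
    have "g' z > 0" using e(2)[of z] z h 0 by simp
    then have "h * g' z > 0" using h(1) by simp
    then have "g h > g 0" using z(3) by simp
    then show False using le[of h] h by simp
  qed
qed

lemma frechet_derivative_partial:
  fixes w :: "real^'n::finite \<Rightarrow> real"
  assumes "w differentiable (at q)"
  shows "frechet_derivative w (at q) \<xi> = (\<Sum>j\<in>UNIV. \<xi> $ j * partial j w q)"
proof -
  interpret linear "frechet_derivative w (at q)"
    by (rule linear_frechet_derivative[OF assms])
  have "\<xi> = (\<Sum>j\<in>UNIV. \<xi> $ j *\<^sub>R axis j 1)"
    by (simp add: basis_expansion flip: scalar_mult_eq_scaleR)
  then have "frechet_derivative w (at q) \<xi> = frechet_derivative w (at q) (\<Sum>j\<in>UNIV. \<xi> $ j *\<^sub>R axis j 1)"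
    by simp
  then show ?thesis by (simp add: sum scaleR partial_def)
qed

lemma has_derivative_along_line:
  fixes w :: "real^'n::finite \<Rightarrow> real"
  assumes "w differentiable (at (y + s *\<^sub>R \<xi>))"
  shows "((\<lambda>s. w (y + s *\<^sub>R \<xi>)) has_real_derivative (\<Sum>j\<in>UNIV. \<xi> $ j * partial j w (y + s *\<^sub>R \<xi>))) (at s)"
proof -
  have 1: "((\<lambda>s. y + s *\<^sub>R \<xi>) has_derivative (\<lambda>t. t *\<^sub>R \<xi>)) (at s)"
    by (auto intro!: derivative_eq_intros)
  interpret linear "frechet_derivative w (at (y + s *\<^sub>R \<xi>))"
    by (rule linear_frechet_derivative[OF assms])
  have "frechet_derivative w (at (y + s *\<^sub>R \<xi>)) (t *\<^sub>R \<xi>)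
      = (\<Sum>j\<in>UNIV. \<xi> $ j * partial j w (y + s *\<^sub>R \<xi>)) * t" for t
    unfolding scaleR by (simp add: frechet_derivative_partial[OF assms])
  then show ?thesis
    using has_derivative_compose[OF 1 frechet_derivative_works[THEN iffD1, OF assms]]
    by (simp add: has_field_derivative_def)
qed

lemma hessian_nonpos_at_max:
  fixes h :: "real^'n::finite \<Rightarrow> real"
  assumes S: "open S" "y \<in> S" and h: "\<And>q. q \<in> S \<Longrightarrow> h differentiable (at q)"
    and h2: "\<And>j. partial j h differentiable (at y)" and le: "\<And>q. q \<in> S \<Longrightarrow> h q \<le> h y"
  shows "partial k h y = 0" "(\<Sum>i\<in>UNIV. \<Sum>j\<in>UNIV. \<xi> $ i * \<xi> $ j * partial i (partial j h) y) \<le> 0"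
proof -
  have *: "(\<Sum>j\<in>UNIV. \<xi> $ j * partial j h y) = 0 \<and>
      (\<Sum>i\<in>UNIV. \<Sum>j\<in>UNIV. \<xi> $ i * \<xi> $ j * partial i (partial j h) y) \<le> 0" for \<xi>
  proof -
    obtain e where e: "e > 0" "ball y e \<subseteq> S" using S by (meson open_contains_ball)
    define d where "d = e / (norm \<xi> + 1)"
    have d: "d > 0" using e by (simp add: d_def add_nonneg_pos)
    have inS: "y + s *\<^sub>R \<xi> \<in> S" if "\<bar>s\<bar> < d" for s
    proof -
      have "\<bar>s\<bar> * norm \<xi> \<le> \<bar>s\<bar> * (norm \<xi> + 1)" by (simp add: mult_left_mono)
      also have "\<dots> < e" using that by (simp add: d_def pos_less_divide_eq add_nonneg_pos)
      finally show ?thesis using e(2) by (auto simp: dist_norm)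
    qed
    have 1: "((\<lambda>s. h (y + s *\<^sub>R \<xi>)) has_real_derivative (\<Sum>j\<in>UNIV. \<xi> $ j * partial j h (y + s *\<^sub>R \<xi>))) (at s)"
      if "\<bar>s\<bar> < d" for s by (rule has_derivative_along_line) (rule h[OF inS[OF that]])
    have "((\<lambda>s. partial j h (y + s *\<^sub>R \<xi>)) has_real_derivative (\<Sum>i\<in>UNIV. \<xi> $ i * partial i (partial j h) (y + 0 *\<^sub>R \<xi>))) (at 0)" for j
      by (rule has_derivative_along_line) (simp add: h2)
    then have 2: "((\<lambda>s. \<Sum>j\<in>UNIV. \<xi> $ j * partial j h (y + s *\<^sub>R \<xi>)) has_real_derivative
       (\<Sum>j\<in>UNIV. \<xi> $ j * (\<Sum>i\<in>UNIV. \<xi> $ i * partial i (partial j h) (y + 0 *\<^sub>R \<xi>)))) (at 0)"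
      by (intro DERIV_sum DERIV_cmult)
    have 3: "h (y + s *\<^sub>R \<xi>) \<le> h (y + 0 *\<^sub>R \<xi>)" if "\<bar>s\<bar> < d" for s
      using le[OF inS[OF that]] by simp
    have "(\<Sum>i\<in>UNIV. \<Sum>j\<in>UNIV. \<xi> $ i * \<xi> $ j * partial i (partial j h) y)
      = (\<Sum>j\<in>UNIV. \<xi> $ j * (\<Sum>i\<in>UNIV. \<xi> $ i * partial i (partial j h) y))"
      by (subst sum.swap) (simp add: sum_distrib_left mult_ac)
    then show ?thesis
      using second_derivative_nonpos_at_max[OF d 1 2 3] by simp
  qed
  show "(\<Sum>i\<in>UNIV. \<Sum>j\<in>UNIV. \<xi> $ i * \<xi> $ j * partial i (partial j h) y) \<le> 0" using * by blast
  have "(\<Sum>j\<in>UNIV. axis k 1 $ j * partial j h y) = (\<Sum>j\<in>UNIV. if j = k then partial j h y else 0)"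
    by (intro sum.cong) (auto simp: axis_def)
  then show "partial k h y = 0" using *[of "axis k 1"] by simp
qed

text \<open>
  A positive definite radial tensor is the square of another one, which reduces its contraction with a
  negative semidefinite form to a sum of values of that form.
\<close>

lemma radial_tensor_trace_nonpos:
  fixes y :: "real^'n::finite" and M :: "'n \<Rightarrow> 'n \<Rightarrow> real"
  assumes a: "a > 0" "a + b * (y \<bullet> y) > 0" and y: "y \<noteq> 0"
    and M: "\<And>\<xi> :: real^'n. (\<Sum>i\<in>UNIV. \<Sum>j\<in>UNIV. \<xi> $ i * \<xi> $ j * M i j) \<le> 0"
  shows "(\<Sum>i\<in>UNIV. \<Sum>j\<in>UNIV. radial_tensor a b y i j * M i j) \<le> 0"
proof -
  define p where "p = sqrt a"
  define q where "q = (sqrt (a + b * (y \<bullet> y)) - p) / (y \<bullet> y)"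
  have pp: "p * p = a" using a by (simp add: p_def)
  have yy: "y \<bullet> y \<noteq> 0" using y by simp
  have "(p + q * (y \<bullet> y)) * (p + q * (y \<bullet> y)) = a + b * (y \<bullet> y)"
    using a yy by (simp add: q_def)
  then have "(p * q + q * p + q * q * (y \<bullet> y)) * (y \<bullet> y) = b * (y \<bullet> y)"
    using pp by (simp add: algebra_simps)
  then have qq: "p * q + q * p + q * q * (y \<bullet> y) = b" using yy by simp
  have "radial_tensor a b y i j = (\<Sum>k\<in>UNIV. radial_tensor p q y i k * radial_tensor p q y k j)" for i j
    unfolding radial_tensor_mult pp qq ..
  then have "(\<Sum>i\<in>UNIV. \<Sum>j\<in>UNIV. radial_tensor a b y i j * M i j)
      = (\<Sum>i\<in>UNIV. \<Sum>j\<in>UNIV. \<Sum>k\<in>UNIV. radial_tensor p q y k i * radial_tensor p q y k j * M i j)"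
    by (simp add: sum_distrib_right radial_tensor_sym[of p q y k i for k i])
  also have "\<dots> = (\<Sum>k\<in>UNIV. \<Sum>j\<in>UNIV. \<Sum>i\<in>UNIV. radial_tensor p q y k i * radial_tensor p q y k j * M i j)"
    by (rule sum_swap_outer)
  also have "\<dots> = (\<Sum>k\<in>UNIV. \<Sum>i\<in>UNIV. \<Sum>j\<in>UNIV. radial_tensor p q y k i * radial_tensor p q y k j * M i j)"
    by (rule sum.cong[OF refl], rule sum.swap)
  also have "\<dots> \<le> 0"
  proof (rule sum_nonpos)
    fix k
    show "(\<Sum>i\<in>UNIV. \<Sum>j\<in>UNIV. radial_tensor p q y k i * radial_tensor p q y k j * M i j) \<le> 0"
      using M[of "\<chi> i. radial_tensor p q y k i"] by simp
  qed
  finally show ?thesis .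
qed

lemma partial_lincomb:
  fixes v w :: "real^'n::finite \<Rightarrow> real"
  assumes "w differentiable (at y)" "v differentiable (at y)"
  shows "partial i (\<lambda>q. s * w q - c * v q) y = s * partial i w y - c * partial i v y"
proof -
  have "((\<lambda>q. s * w q - c * v q) has_derivative
     (\<lambda>u. s * frechet_derivative w (at y) u - c * frechet_derivative v (at y) u)) (at y)"
    by (intro has_derivative_diff has_derivative_mult_right frechet_derivative_works[THEN iffD1] assms)
  then show ?thesis unfolding partial_def by (simp add: frechet_derivative_eq)
qed

lemma differentiable_radial:
  fixes y :: "real^'n::finite"
  assumes "(W has_real_derivative W') (at (ln (norm y)))" "y \<noteq> 0"
  shows "(\<lambda>y. W (ln (norm y))) differentiable (at y)"
  using has_derivative_radial[OF assms] by (rule differentiableI)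

lemma differentiable_partial_radial:
  fixes y :: "real^'n::finite"
  assumes y: "y \<in> annulus \<alpha> \<beta>"
    and W: "\<And>t. \<alpha> < t \<Longrightarrow> t < \<beta> \<Longrightarrow> (W has_real_derivative W1 t) (at t)"
    and W1: "(W1 has_real_derivative W2) (at (ln (norm y)))"
  shows "partial j (\<lambda>y. W (ln (norm y))) differentiable (at y)"
proof -
  have y0: "y \<noteq> 0" using y by (simp add: annulus_iff)
  have "((\<lambda>y. W1 (ln (norm y)) * (y $ j / (norm y)\<^sup>2)) has_derivative
      (\<lambda>u. W1 (ln (norm y)) * (u $ j / (norm y)\<^sup>2 - 2 * (y $ j) * (y \<bullet> u) / (norm y)^4)
       + W2 * ((y \<bullet> u) / (norm y)\<^sup>2) * (y $ j / (norm y)\<^sup>2))) (at y)"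
    by (rule has_derivative_mult[OF has_derivative_radial[OF W1 y0]
          has_derivative_component_over_norm2[OF y0]])
  then have "(partial j (\<lambda>y. W (ln (norm y))) has_derivative
      (\<lambda>u. W1 (ln (norm y)) * (u $ j / (norm y)\<^sup>2 - 2 * (y $ j) * (y \<bullet> u) / (norm y)^4)
       + W2 * ((y \<bullet> u) / (norm y)\<^sup>2) * (y $ j / (norm y)\<^sup>2))) (at y)"
  proof (rule has_derivative_transform_within_open[OF _ open_annulus y])
    fix x :: "real^'n" assume "x \<in> annulus \<alpha> \<beta>"
    then have "x \<noteq> 0" "\<alpha> < ln (norm x)" "ln (norm x) < \<beta>" by (auto simp: annulus_iff)
    then show "W1 (ln (norm x)) * (x $ j / (norm x)\<^sup>2) = partial j (\<lambda>y. W (ln (norm y))) x"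
      by (intro partial_radial[symmetric] W)
  qed
  then show ?thesis by (rule differentiableI)
qed

lemma chart_mem_domain_iff:
  fixes y :: "real^'n::finite"
  assumes "y \<noteq> 0"
  shows "catenoid_chart f a y \<in> catenoid_domain f a \<alpha> \<beta> \<longleftrightarrow> y \<in> annulus \<alpha> \<beta>"
proof
  assume "catenoid_chart f a y \<in> catenoid_domain f a \<alpha> \<beta>"
  then show "y \<in> annulus \<alpha> \<beta>"
    using assms by (auto simp: catenoid_domain_def catenoid_chart_def catenoid_param_def annulus_iff)
next
  assume "y \<in> annulus \<alpha> \<beta>"
  then show "catenoid_chart f a y \<in> catenoid_domain f a \<alpha> \<beta>"
    unfolding catenoid_chart_image[symmetric] by blast
qed

lemma chart_preimage_domain:
  assumes "- T \<le> \<alpha>" "\<beta> \<le> T"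
  shows "{y \<in> annulus (- T) T. catenoid_chart f a y \<in> catenoid_domain f a \<alpha> \<beta>} = (annulus \<alpha> \<beta> :: (real^'n::finite) set)"
proof -
  have "y \<noteq> 0" if "y \<in> annulus (- T) T" for y :: "real^'n" using that by (simp add: annulus_iff)
  moreover have "annulus \<alpha> \<beta> \<subseteq> (annulus (- T) T :: (real^'n) set)" using assms by (auto simp: annulus_iff)
  ultimately show ?thesis by (auto simp: chart_mem_domain_iff)
qed

lemma snd_closure_domain:
  fixes p :: "'n::finite ambient"
  shows "p \<in> closure (catenoid_domain f a \<alpha> \<beta>) \<Longrightarrow> \<alpha> \<le> snd p \<and> snd p \<le> \<beta>"
proof -
  have "closed {p :: 'n ambient. \<alpha> \<le> snd p \<and> snd p \<le> \<beta>}"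
    by (intro closed_Collect_conj closed_Collect_le continuous_intros)
  moreover have "catenoid_domain f a \<alpha> \<beta> \<subseteq> {p. \<alpha> \<le> snd p \<and> snd p \<le> \<beta>}"
    by (auto simp: catenoid_domain_def catenoid_param_def)
  ultimately show "p \<in> closure (catenoid_domain f a \<alpha> \<beta>) \<Longrightarrow> \<alpha> \<le> snd p \<and> snd p \<le> \<beta>"
    using closure_minimal by blast
qed

context catenary_chart begin

text \<open>
  The eigenfunction \<open>u\<close> is arbitrary, not assumed rotation invariant. At an interior maximum of
  \<open>\<bar>u\<bar> / V\<close>, the function \<open>s w - c V\<close> with \<open>s = sgn u\<close> and \<open>w = u \<circ> \<phi>\<close> vanishes together with its gradient and has nonpositive
  Hessian. Hence \<open>J (s w - c V) \<ge> 0\<close> there, while \<open>J w = 0\<close> and \<open>J V > 0\<close>.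
\<close>

lemma no_dirichlet_kernel_if_supersolution:
  fixes N :: "'n::finite ambient \<Rightarrow> 'n ambient"
  assumes n: "n = real CARD('n)" and sub: "- T \<le> \<alpha>" "\<beta> \<le> T"
    and N: "unit_normal (catenoid_chart f a) (annulus (- T) T) N"
    and rel: "relatively_compact_domain (catenoid_chart f a ` annulus (- T) T) (catenoid_domain f a \<alpha> \<beta> :: 'n ambient set)"
    and V0: "continuous_on {\<alpha>..\<beta>} V" "\<And>t. \<alpha> \<le> t \<Longrightarrow> t \<le> \<beta> \<Longrightarrow> V t > 0"
    and V: "\<And>t. \<alpha> < t \<Longrightarrow> t < \<beta> \<Longrightarrow> (V has_real_derivative V1 t) (at t)"
    and V1: "\<And>t. \<alpha> < t \<Longrightarrow> t < \<beta> \<Longrightarrow> (V1 has_real_derivative V2 t) (at t)"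
    and super: "\<And>t. \<alpha> < t \<Longrightarrow> t < \<beta> \<Longrightarrow>
       V2 t + (n - 1) * (n * (cosh (f a t) / sinh (f a t))\<^sup>2 - 1) * V t < 0"
  shows "\<not> dirichlet_eigenvalue (catenoid_chart f a) (annulus (- T) T) N (catenoid_domain f a \<alpha> \<beta>) 0"
proof
  define \<phi> :: "real^'n \<Rightarrow> 'n ambient" where "\<phi> = catenoid_chart f a"
  define \<Omega> :: "'n ambient set" where "\<Omega> = catenoid_domain f a \<alpha> \<beta>"
  have img: "\<phi> ` annulus \<alpha> \<beta> = \<Omega>" unfolding \<phi>_def \<Omega>_def by (rule catenoid_chart_image)
  have sub': "annulus \<alpha> \<beta> \<subseteq> (annulus (- T) T :: (real^'n) set)" using sub by (auto simp: annulus_iff)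
  have dom: "{y \<in> annulus (- T) T. \<phi> y \<in> \<Omega>} = annulus \<alpha> \<beta>"
    unfolding \<phi>_def \<Omega>_def by (rule chart_preimage_domain[OF sub])
  assume "dirichlet_eigenvalue (catenoid_chart f a) (annulus (- T) T) N (catenoid_domain f a \<alpha> \<beta>) 0"
  then obtain u where u: "\<exists>p\<in>\<Omega>. u p \<noteq> 0" "continuous_on (closure \<Omega>) u"
      "\<And>p. p \<in> boundary_in (\<phi> ` annulus (- T) T) \<Omega> \<Longrightarrow> u p = 0"
      "C2_on (annulus \<alpha> \<beta>) (u \<circ> \<phi>)" "\<And>y. y \<in> annulus \<alpha> \<beta> \<Longrightarrow> jacobi_op \<phi> N (u \<circ> \<phi>) y = 0"
    unfolding dirichlet_eigenvalue_def \<phi>_def[symmetric] \<Omega>_def[symmetric] dom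
    using dom by auto
  obtain p1 where p1: "p1 \<in> \<Omega>" "u p1 \<noteq> 0" using u(1) by blast
  have h: "snd p \<in> {\<alpha>..\<beta>}" if "p \<in> closure \<Omega>" for p
    using snd_closure_domain[of p f a \<alpha> \<beta>] that unfolding \<Omega>_def by auto
  have Vc: "continuous_on (closure \<Omega>) (\<lambda>p. V (snd p))"
    by (rule continuous_on_compose2[OF V0(1)]) (use h in \<open>auto intro!: continuous_intros\<close>)
  have Vpos: "V (snd p) > 0" if "p \<in> closure \<Omega>" for p using h[OF that] V0(2) by simp
  have Q: "continuous_on (closure \<Omega>) (\<lambda>p. \<bar>u p\<bar> / V (snd p))"
    by (intro continuous_intros u(2) Vc) (use Vpos in force)
  have cpt: "compact (closure \<Omega>)" and clM: "closure \<Omega> \<subseteq> \<phi> ` annulus (- T) T"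
    using rel unfolding relatively_compact_domain_def \<phi>_def \<Omega>_def by auto
  have p1c: "p1 \<in> closure \<Omega>" using p1(1) closure_subset by blast
  have ne: "closure \<Omega> \<noteq> {}" using p1c by auto
  obtain p0 where p0c: "p0 \<in> closure \<Omega>"
    and p0m: "\<forall>p\<in>closure \<Omega>. \<bar>u p\<bar> / V (snd p) \<le> \<bar>u p0\<bar> / V (snd p0)"
    using continuous_attains_sup[OF cpt ne Q] by (rule bexE)
  note p0 = p0c bspec[OF p0m]
  define c where "c = \<bar>u p0\<bar> / V (snd p0)"
  have c: "c > 0"
  proof -
    have "0 < \<bar>u p1\<bar> / V (snd p1)" using p1(2) Vpos[OF p1c] by simp
    then show ?thesis using p0(2)[OF p1c] by (simp add: c_def)
  qed
  have "u p0 \<noteq> 0" using c by (auto simp: c_def)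
  then have "p0 \<in> \<Omega>" using u(3)[of p0] p0(1) clM by (auto simp: boundary_in_def)
  then obtain y where y: "y \<in> annulus \<alpha> \<beta>" "p0 = \<phi> y" unfolding img[symmetric] by blast
  have snd\<phi>: "snd (\<phi> q) = ln (norm q)" for q by (simp add: \<phi>_def catenoid_chart_def catenoid_param_def)
  \<comment> \<open>The maximum point may carry a negative value of \<open>u\<close>.\<close>
  define s where "s = sgn (u p0)"
  define w where "w = u \<circ> \<phi>"
  let ?V = "\<lambda>q :: real^'n. V (ln (norm q))"
  define h where "h = (\<lambda>q. s * w q - c * ?V q)"
  have ann: "q \<noteq> 0" "\<alpha> < ln (norm q)" "ln (norm q) < \<beta>" if "q \<in> annulus \<alpha> \<beta>" for q :: "real^'n"
    using that by (auto simp: annulus_iff)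
  have wd: "w differentiable (at q)" "partial j w differentiable (at q)" if "q \<in> annulus \<alpha> \<beta>" for q j
    using u(4) that unfolding C2_on_def C1_on_def w_def by auto
  have Vd: "?V differentiable (at q)" "partial j ?V differentiable (at q)" if "q \<in> annulus \<alpha> \<beta>" for q j
    using ann[OF that] by (auto intro!: differentiable_radial differentiable_partial_radial[OF that] V V1)
  have hd: "h differentiable (at q)" if "q \<in> annulus \<alpha> \<beta>" for q
    unfolding h_def by (intro derivative_intros wd Vd that)
  have ph: "partial j h q = s * partial j w q - c * partial j ?V q" if "q \<in> annulus \<alpha> \<beta>" for q j
    unfolding h_def by (rule partial_lincomb) (rule wd Vd that)+
  have hd2: "partial j h differentiable (at y)" for j
  proof -
    have "(\<lambda>q. s * partial j w q - c * partial j ?V q) differentiable (at y)"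
      by (intro derivative_intros wd Vd y)
    then obtain D where "((\<lambda>q. s * partial j w q - c * partial j ?V q) has_derivative D) (at y)"
      by (auto simp: differentiable_def)
    then have "(partial j h has_derivative D) (at y)"
      by (rule has_derivative_transform_within_open[OF _ open_annulus y(1)]) (simp add: ph)
    then show ?thesis by (rule differentiableI)
  qed
  have pph: "partial i (partial j h) y = s * partial i (partial j w) y - c * partial i (partial j ?V) y" for i j
  proof -
    have "partial i (partial j h) y = partial i (\<lambda>q. s * partial j w q - c * partial j ?V q) y"
      by (rule partial_cong_open[OF open_annulus y(1)]) (rule ph)
    also have "\<dots> = s * partial i (partial j w) y - c * partial i (partial j ?V) y"
      by (rule partial_lincomb) (rule wd Vd y)+
    finally show ?thesis .
  qed
  have hy: "h y = 0"
  proof -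
    have "V (ln (norm y)) > 0" using Vpos[OF p0(1)] by (simp add: y snd\<phi>)
    then show ?thesis by (simp add: h_def w_def c_def s_def y snd\<phi> sgn_mult_self_eq abs_sgn mult.commute)
  qed
  have hle: "h q \<le> h y" if "q \<in> annulus \<alpha> \<beta>" for q
  proof -
    have q: "\<phi> q \<in> closure \<Omega>" using imageI[OF that, of \<phi>] closure_subset[of \<Omega>] unfolding img by (rule subsetD[rotated])
    have "V (ln (norm q)) > 0" using Vpos[OF q] by (simp add: snd\<phi>)
    then have "\<bar>u (\<phi> q)\<bar> \<le> c * V (ln (norm q))"
      using p0(2)[OF q] by (simp add: c_def snd\<phi> pos_divide_le_eq)
    moreover have "s * u (\<phi> q) \<le> \<bar>u (\<phi> q)\<bar>" by (auto simp: s_def sgn_if)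
    ultimately show ?thesis unfolding hy by (simp add: h_def w_def)
  qed
  note max = hessian_nonpos_at_max[OF open_annulus y(1) hd hd2 hle]
  have y': "y \<in> annulus (- T) T" using y sub' by auto
  have y0: "y \<noteq> 0" using y' by (simp add: annulus_iff)
  define t where "t = ln (norm y)"
  have t: "- T < t" "t < T" using y' by (auto simp: t_def annulus_iff)
  have S: "sinh (f a t) > 0" using f_pos[OF t] by simp
  have E: "1 + (f1 t)\<^sup>2 > 0" by (simp add: add_pos_nonneg)
  have yy: "y \<bullet> y = (norm y)\<^sup>2" by (simp add: power2_norm_eq_inner)
  define g where "g i j = inv_gram \<phi> y $ i $ j" for i j
  have g: "g = radial_tensor ((norm y)\<^sup>2 / (sinh (f a t))\<^sup>2) (1 / (1 + (f1 t)\<^sup>2) - 1 / (sinh (f a t))\<^sup>2) y"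
    unfolding g_def \<phi>_def t_def by (intro ext inv_gram_chart[OF y'])
  have trace: "(\<Sum>i\<in>UNIV. \<Sum>j\<in>UNIV. g i j * partial i (partial j h) y) \<le> 0"
    unfolding g
  proof (rule radial_tensor_trace_nonpos[OF _ _ y0])
    have "(norm y)\<^sup>2 / (sinh (f a t))\<^sup>2 + (1 / (1 + (f1 t)\<^sup>2) - 1 / (sinh (f a t))\<^sup>2) * (y \<bullet> y)
       = (norm y)\<^sup>2 / (1 + (f1 t)\<^sup>2)" unfolding yy by (simp add: algebra_simps)
    then show "0 < (norm y)\<^sup>2 / (sinh (f a t))\<^sup>2 + (1 / (1 + (f1 t)\<^sup>2) - 1 / (sinh (f a t))\<^sup>2) * (y \<bullet> y)"
      using y0 E by simp
  qed (use y0 S max(2) in auto)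
  have lap: "s * laplacian \<phi> w y - c * laplacian \<phi> ?V y = (\<Sum>i\<in>UNIV. \<Sum>j\<in>UNIV. g i j * partial i (partial j h) y)"
  proof -
    define b where "b i j k = (\<Sum>l\<in>UNIV. inv_gram \<phi> y $ k $ l
          * christoffel (induced_metric \<phi>) y (axis i 1) (axis j 1) (axis l 1))" for i j k
    have hess: "hess \<phi> v y i j = partial i (partial j v) y - (\<Sum>k\<in>UNIV. b i j k * partial k v y)" for v i j
      unfolding hess_def b_def by (simp add: sum_distrib_right)
    have "s * partial k w y = c * partial k ?V y" for k
      using max(1)[of k] ph[OF y(1), of k] by simp
    then have sb: "s * (b i j k * partial k w y) = c * (b i j k * partial k ?V y)" for i j k
      by (metis mult.left_commute)
    then have "s * (\<Sum>k\<in>UNIV. b i j k * partial k w y) = c * (\<Sum>k\<in>UNIV. b i j k * partial k ?V y)" for i j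
      unfolding sum_distrib_left by (intro sum.cong refl sb)
    then have "s * hess \<phi> w y i j - c * hess \<phi> ?V y i j = partial i (partial j h) y" for i j
      unfolding hess pph by (simp add: algebra_simps)
    then have gh: "g i j * partial i (partial j h) y = s * (g i j * hess \<phi> w y i j) - c * (g i j * hess \<phi> ?V y i j)" for i j
      by (metis mult.left_commute right_diff_distrib)
    then show ?thesis
      unfolding laplacian_def g_def[symmetric] gh sum_subtractf by (simp only: sum_distrib_left)
  qed
  define d where "d = (real CARD('n) - 1) * (1 - (vertical_component \<phi> N y)\<^sup>2) - second_ff_norm2 \<phi> N y"
  have J: "jacobi_op \<phi> N v y = - laplacian \<phi> v y + d * v y" for v
    by (simp add: jacobi_op_def d_def)
  have "s * jacobi_op \<phi> N w y - c * jacobi_op \<phi> N ?V y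
     = - (s * laplacian \<phi> w y - c * laplacian \<phi> ?V y) + d * h y"
    unfolding J h_def by (simp add: algebra_simps)
  then have "s * jacobi_op \<phi> N w y - c * jacobi_op \<phi> N ?V y \<ge> 0"
    using lap trace hy by simp
  moreover have "jacobi_op \<phi> N w y = 0" using u(5)[OF y(1)] by (simp add: w_def)
  moreover have "jacobi_op \<phi> N ?V y > 0"
  proof -
    have "jacobi_op \<phi> N ?V y
        = (- V2 t - (n - 1) * (n * (cosh (f a t) / sinh (f a t))\<^sup>2 - 1) * V t) / (1 + (f1 t)\<^sup>2)"
      unfolding \<phi>_def t_def by (rule jacobi_op_radial[OF n y(1) sub N V V1[OF ann(2,3)[OF y(1)]]])
    then show ?thesis
      using E super[OF ann(2,3)[OF y(1)]] by (simp add: t_def)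
  qed
  ultimately show False using c by (simp add: mult_le_0_iff)
qed

end

section \<open>Catenaries by quadrature\<close>

text \<open>
  Along a catenary with initial value \<open>b\<close>, the angle \<open>\<theta> = arctan f\<^sub>t\<close> is a parameter, with
  \<open>sinh f = sinh b / cos_root m \<theta>\<close> and \<open>dt/d\<theta> = tanh f / m\<close>, where \<open>m = n - 1\<close>. In contrast to quadrature in the variable
  \<open>f\<close>, the integrand is continuous up to both ends \<open>\<plusminus>\<pi>/2\<close>.
\<close>

definition cos_root :: "real \<Rightarrow> real \<Rightarrow> real" where
  "cos_root m \<theta> = cos \<theta> powr (1 / m)"

text \<open>
  \<open>tanh f\<close> as a function of the initial value and the angle.
\<close>

definition tanh_rad :: "real \<Rightarrow> real \<Rightarrow> real \<Rightarrow> real" where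
  "tanh_rad m b \<theta> = sinh b / sqrt ((sinh b)\<^sup>2 + (cos_root m \<theta>)\<^sup>2)"

text \<open>
  The derivative of \<open>tanh_rad\<close> with respect to the initial value.
\<close>

definition tanh_rad_b :: "real \<Rightarrow> real \<Rightarrow> real \<Rightarrow> real" where
  "tanh_rad_b m b \<theta> = cosh b * (cos_root m \<theta>)\<^sup>2 / sqrt ((sinh b)\<^sup>2 + (cos_root m \<theta>)\<^sup>2) ^ 3"

text \<open>
  The height at which the catenary has angle \<open>\<theta>\<close>. Integration starts at \<open>-\<pi>/2\<close> instead of \<open>0\<close> because integrals
  over intervals \<open>{a..b}\<close> with \<open>a > b\<close> vanish.
\<close>

definition height :: "real \<Rightarrow> real \<Rightarrow> real \<Rightarrow> real" where
  "height m b \<theta> = (integral {- pi / 2..\<theta>} (tanh_rad m b) - integral {- pi / 2..0} (tanh_rad m b)) / m"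

text \<open>
  The derivative of \<open>height\<close> with respect to the initial value.
\<close>

definition height_b :: "real \<Rightarrow> real \<Rightarrow> real \<Rightarrow> real" where
  "height_b m b \<theta> = (integral {- pi / 2..\<theta>} (tanh_rad_b m b) - integral {- pi / 2..0} (tanh_rad_b m b)) / m"

lemma cos_nonneg_closed: "\<theta> \<in> {- pi / 2..pi / 2} \<Longrightarrow> 0 \<le> cos \<theta>"
  by (rule cos_ge_zero) auto

lemma cos_root_pos: "- pi / 2 < \<theta> \<Longrightarrow> \<theta> < pi / 2 \<Longrightarrow> cos_root m \<theta> > 0"
  using cos_gt_zero_pi[of \<theta>] by (simp add: cos_root_def)

lemma continuous_on_cos_root: "m > 0 \<Longrightarrow> continuous_on {- pi / 2..pi / 2} (cos_root m)"
  unfolding cos_root_def[abs_def]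
  by (rule continuous_on_powr') (auto intro!: continuous_intros cos_nonneg_closed)

lemma cos_root_deriv:
  assumes "m > 0" "- pi / 2 < \<theta>" "\<theta> < pi / 2"
  shows "(cos_root m has_real_derivative - (tan \<theta> * cos_root m \<theta> / m)) (at \<theta>)"
proof -
  have c: "cos \<theta> > 0" using cos_gt_zero_pi[of \<theta>] assms by simp
  have "1 + (1 - m) / m = 1 / m" using assms(1) by (simp add: field_simps)
  then have "cos \<theta> * cos \<theta> powr ((1 - m) / m) = cos \<theta> powr (1 / m)"
    using powr_mult_base[of "cos \<theta>" "(1 - m) / m"] c by simp
  then show ?thesis
    unfolding cos_root_def[abs_def]
    using c assms(1)
    by (auto intro!: derivative_eq_intros simp: tan_def field_simps)
qed

lemma tanh_rad_denom_pos: "b > 0 \<Longrightarrow> (sinh b)\<^sup>2 + x\<^sup>2 > 0" for b x :: real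
  by (simp add: add_pos_nonneg)

lemma tanh_rad_pos: "b > 0 \<Longrightarrow> tanh_rad m b \<theta> > 0"
  by (simp add: tanh_rad_def tanh_rad_denom_pos)

lemma continuous_on_tanh_rad_pair:
  assumes "m > 0"
  shows "continuous_on ({0<..} \<times> {- pi / 2..pi / 2}) (\<lambda>(b, \<theta>). tanh_rad m b \<theta>)"
    "continuous_on ({0<..} \<times> {- pi / 2..pi / 2}) (\<lambda>(b, \<theta>). tanh_rad_b m b \<theta>)"
proof -
  have 1: "continuous_on ({0<..} \<times> {- pi / 2..pi / 2}) (\<lambda>p. cos_root m (snd p))"
    by (rule continuous_on_compose2[OF continuous_on_cos_root[OF assms]]) (auto intro!: continuous_intros)
  have ne: "(sinh b)\<^sup>2 + x\<^sup>2 \<noteq> 0" if "b > 0" for b x :: real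
    using tanh_rad_denom_pos[OF that, of x] by (rule less_imp_neq[THEN not_sym])
  show "continuous_on ({0<..} \<times> {- pi / 2..pi / 2}) (\<lambda>(b, \<theta>). tanh_rad m b \<theta>)"
    unfolding tanh_rad_def case_prod_beta
    by (intro continuous_intros 1) (auto dest: ne)
  show "continuous_on ({0<..} \<times> {- pi / 2..pi / 2}) (\<lambda>(b, \<theta>). tanh_rad_b m b \<theta>)"
    unfolding tanh_rad_b_def case_prod_beta
    by (intro continuous_intros 1) (auto dest: ne)
qed

lemma continuous_on_tanh_rad:
  assumes "m > 0" "b > 0"
  shows "continuous_on {- pi / 2..pi / 2} (tanh_rad m b)" "continuous_on {- pi / 2..pi / 2} (tanh_rad_b m b)"
proof -
  have c: "continuous_on {- pi / 2..pi / 2} (Pair b)" by (intro continuous_intros)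
  have sub: "Pair b ` {- pi / 2..pi / 2} \<subseteq> {0<..} \<times> {- pi / 2..pi / 2}" using assms(2) by auto
  show "continuous_on {- pi / 2..pi / 2} (tanh_rad m b)" "continuous_on {- pi / 2..pi / 2} (tanh_rad_b m b)"
    using continuous_on_compose2[OF continuous_on_tanh_rad_pair(1)[OF assms(1)] c sub]
      continuous_on_compose2[OF continuous_on_tanh_rad_pair(2)[OF assms(1)] c sub] by simp_all
qed

lemma height_deriv_within:
  assumes "m > 0" "b > 0" "\<theta> \<in> {- pi / 2..pi / 2}"
  shows "(height m b has_real_derivative tanh_rad m b \<theta> / m) (at \<theta> within {- pi / 2..pi / 2})"
    "(height_b m b has_real_derivative tanh_rad_b m b \<theta> / m) (at \<theta> within {- pi / 2..pi / 2})"
  unfolding height_def[abs_def] height_b_def[abs_def]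
  using integral_has_real_derivative[OF continuous_on_tanh_rad(1)[OF assms(1,2)] assms(3)]
    integral_has_real_derivative[OF continuous_on_tanh_rad(2)[OF assms(1,2)] assms(3)]
    assms(1)
  by (auto intro!: derivative_eq_intros)

lemma height_deriv:
  assumes "m > 0" "b > 0" "- pi / 2 < \<theta>" "\<theta> < pi / 2"
  shows "(height m b has_real_derivative tanh_rad m b \<theta> / m) (at \<theta>)"
    "(height_b m b has_real_derivative tanh_rad_b m b \<theta> / m) (at \<theta>)"
  using height_deriv_within[OF assms(1,2), of \<theta>] assms(3,4)
  by (auto simp: at_within_Icc_at)

lemma height_0 [simp]: "height m b 0 = 0" "height_b m b 0 = 0"
  by (simp_all add: height_def height_b_def)

lemma continuous_on_height: "m > 0 \<Longrightarrow> b > 0 \<Longrightarrow> continuous_on {- pi / 2..pi / 2} (height m b)"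
  by (rule DERIV_continuous_on) (rule height_deriv_within)

lemma height_strict_mono:
  assumes "m > 0" "b > 0" "- pi / 2 \<le> x" "x < y" "y \<le> pi / 2"
  shows "height m b x < height m b y"
proof (rule DERIV_pos_imp_increasing_open[OF assms(4)])
  show "\<exists>d. (height m b has_real_derivative d) (at z) \<and> 0 < d" if "x < z" "z < y" for z
    using height_deriv(1)[OF assms(1,2), of z] that assms tanh_rad_pos[of b m z]
    by (intro exI[of _ "tanh_rad m b z / m"]) auto
  show "continuous_on {x..y} (height m b)"
    by (rule continuous_on_subset[OF continuous_on_height]) (use assms in auto)
qed

lemma tanh_rad_even: "tanh_rad m b (- \<theta>) = tanh_rad m b \<theta>"
  by (simp add: tanh_rad_def cos_root_def)

lemma height_odd:
  assumes "m > 0" "b > 0" "- pi / 2 \<le> \<theta>" "\<theta> \<le> pi / 2"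
  shows "height m b (- \<theta>) = - height m b \<theta>"
proof -
  have *: "height m b (- \<theta>) + height m b \<theta> = 0" if th: "0 \<le> \<theta>" "\<theta> \<le> pi / 2" for \<theta>
  proof (cases "\<theta> = 0")
    case False
    then have pos: "0 < \<theta>" using th by simp
    let ?g = "\<lambda>x. height m b (- x) + height m b x"
    have "?g \<theta> = ?g 0"
    proof (rule DERIV_isconst2[OF pos])
      have "continuous_on {0..\<theta>} (\<lambda>x. height m b (- x))"
        by (rule continuous_on_compose2[OF continuous_on_height[OF assms(1,2)]])
          (use th in \<open>auto intro!: continuous_intros\<close>)
      moreover have "continuous_on {0..\<theta>} (height m b)"
        by (rule continuous_on_subset[OF continuous_on_height[OF assms(1,2)]]) (use th in auto)
      ultimately show "continuous_on {0..\<theta>} ?g" by (intro continuous_intros)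
      fix x assume x: "0 < x" "x < \<theta>"
      have "(height m b has_real_derivative tanh_rad m b x / m) (at x)"
        "(height m b has_real_derivative tanh_rad m b x / m) (at (- x))"
        using height_deriv(1)[OF assms(1,2), of x] height_deriv(1)[OF assms(1,2), of "- x"] x th
        by (auto simp: tanh_rad_even)
      then show "(?g has_real_derivative 0) (at x)"
        using DERIV_add[OF DERIV_mirror[THEN iffD1]] by fastforce
    qed (use pos in auto)
    then show ?thesis by simp
  qed simp
  show ?thesis using *[of \<theta>] *[of "- \<theta>"] assms by (cases "\<theta> \<ge> 0") auto
qed

lemma tanh_rad_b_deriv:
  assumes "b > 0"
  shows "((\<lambda>b. tanh_rad m b \<theta>) has_real_derivative tanh_rad_b m b \<theta>) (at b)"
proof -
  define c where "c = cos_root m \<theta>"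
  define q where "q = sqrt ((sinh b)\<^sup>2 + c\<^sup>2)"
  have pos: "(sinh b)\<^sup>2 + c\<^sup>2 > 0" by (rule tanh_rad_denom_pos[OF assms])
  then have q: "q > 0" "q * q = (sinh b)\<^sup>2 + c\<^sup>2" by (simp_all add: q_def)
  have "((\<lambda>b. sinh b / sqrt ((sinh b)\<^sup>2 + c\<^sup>2)) has_real_derivative
      (cosh b * q - sinh b * (sinh b * cosh b / q)) / (q * q)) (at b)"
    using pos by (auto intro!: derivative_eq_intros simp: q_def field_simps)
  moreover have "(cosh b * q - sinh b * (sinh b * cosh b / q)) / (q * q) = cosh b * c\<^sup>2 / q ^ 3"
  proof -
    have "cosh b * q - sinh b * (sinh b * cosh b / q) = cosh b * (q * q - (sinh b)\<^sup>2) / q"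
      using q(1) by (simp add: field_simps power2_eq_square)
    then show ?thesis using q by (simp add: power3_eq_cube)
  qed
  ultimately show ?thesis by (simp add: tanh_rad_def tanh_rad_b_def c_def q_def)
qed

lemma height_b_deriv:
  assumes m: "m > 0" and b: "b > 0" and th: "\<theta> \<in> {- pi / 2..pi / 2}"
  shows "((\<lambda>b. height m b \<theta>) has_real_derivative height_b m b \<theta>) (at b)"
proof -
  have *: "((\<lambda>b. integral {- pi / 2..\<theta>} (tanh_rad m b)) has_real_derivative integral {- pi / 2..\<theta>} (tanh_rad_b m b)) (at b)"
    if th: "\<theta> \<in> {- pi / 2..pi / 2}" for \<theta>
  proof -
    have "((\<lambda>b. integral (cbox (- pi / 2) \<theta>) (tanh_rad m b)) has_real_derivative
         integral (cbox (- pi / 2) \<theta>) (tanh_rad_b m b)) (at b within {0<..})"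
    proof (rule leibniz_rule_field_derivative)
      show "((\<lambda>x. tanh_rad m x t) has_real_derivative tanh_rad_b m x t) (at x within {0<..})" if "x \<in> {0<..}" for x t
        using tanh_rad_b_deriv[of x m t] that by (auto intro: has_field_derivative_at_within)
      show "tanh_rad m x integrable_on cbox (- pi / 2) \<theta>" if "x \<in> {0<..}" for x
        using that th m by (intro integrable_continuous continuous_on_subset[OF continuous_on_tanh_rad(1)]) auto
      show "continuous_on ({0<..} \<times> cbox (- pi / 2) \<theta>) (\<lambda>(x, t). tanh_rad_b m x t)"
        by (rule continuous_on_subset[OF continuous_on_tanh_rad_pair(2)[OF m]]) (use th in auto)
    qed (use b in auto)
    then show ?thesis using b by (simp add: at_within_open[of b "{0<..}"])
  qed
  have "0 \<in> {- pi / 2..pi / 2}" by simp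
  then show ?thesis
    unfolding height_def height_b_def
    using *[OF th] *[of 0] m by (auto intro!: derivative_eq_intros)
qed

section \<open>The catenary equation and its smooth dependence on the initial value\<close>

lemma tanh_rad_eq_tanh:
  assumes b: "b > 0" and th: "- pi / 2 < \<theta>" "\<theta> < pi / 2" and x: "sinh x * cos_root m \<theta> = sinh b"
  shows "tanh_rad m b \<theta> = sinh x / cosh x"
    "tanh_rad_b m b \<theta> = cosh b / sinh b * sinh x / cosh x ^ 3"
proof -
  define c where "c = cos_root m \<theta>"
  have c: "c > 0" using cos_root_pos[OF th] by (simp add: c_def)
  have x': "sinh b = sinh x * c" using x by (simp add: c_def)
  have "(sinh b)\<^sup>2 + c\<^sup>2 = (c * cosh x)\<^sup>2"
    unfolding x' power_mult_distrib cosh_square_eq by (simp add: algebra_simps)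
  then have sq: "sqrt ((sinh b)\<^sup>2 + c\<^sup>2) = c * cosh x"
    using c by (simp add: real_sqrt_unique)
  show "tanh_rad m b \<theta> = sinh x / cosh x"
    unfolding tanh_rad_def c_def[symmetric] sq using c by (simp add: x')
  have "sinh x \<noteq> 0" using b x' by auto
  then show "tanh_rad_b m b \<theta> = cosh b / sinh b * sinh x / cosh x ^ 3"
    unfolding tanh_rad_b_def c_def[symmetric] sq using c
    by (simp add: x' power_mult_distrib) (simp add: field_simps power2_eq_square power3_eq_cube)
qed

lemma cos_root_0 [simp]: "cos_root m 0 = 1"
  by (simp add: cos_root_def)

lemma arctan_range: "- pi / 2 < arctan x" "arctan x < pi / 2"
  using arctan_lbound[of x] arctan_ubound[of x] by auto

text \<open>
  The last two conclusions are first integrals, and determine the solution. In the proof, their derivatives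
  are shown to vanish on the interval \<open>I\<close>.
\<close>

lemma catenary_solution_quadrature:
  assumes sol: "catenary_solution n b I g" and n: "n \<ge> 2" and b: "b > 0"
  defines "m \<equiv> real n - 1"
  obtains g1 where "\<And>t. t \<in> I \<Longrightarrow> g t > 0"
    "\<And>t. t \<in> I \<Longrightarrow> (g has_real_derivative g1 t) (at t)"
    "\<And>t. t \<in> I \<Longrightarrow> (g1 has_real_derivative m * (cosh (g t) / sinh (g t)) * (1 + (g1 t)\<^sup>2)) (at t)"
    "\<And>t. t \<in> I \<Longrightarrow> sinh (g t) * cos_root m (arctan (g1 t)) = sinh b"
    "\<And>t. t \<in> I \<Longrightarrow> height m b (arctan (g1 t)) = t"
proof -
  have m: "m > 0" using n by (simp add: m_def)
  obtain g1 where g1: "g1 0 = 0" "\<And>t. t \<in> I \<Longrightarrow> g t > 0"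
    "\<And>t. t \<in> I \<Longrightarrow> (g has_real_derivative g1 t) (at t)"
    "\<And>t. t \<in> I \<Longrightarrow> (g1 has_real_derivative m * (cosh (g t) / sinh (g t)) * (1 + (g1 t)\<^sup>2)) (at t)"
    and I: "open I" "is_interval I" "0 \<in> I" "g 0 = b"
    using sol unfolding catenary_solution_def m_def by auto
  have cvx: "convex I" using I(2) is_interval_convex by blast
  have pos: "1 + (g1 t)\<^sup>2 > 0" for t by (simp add: add_pos_nonneg)
  have th: "((\<lambda>t. arctan (g1 t)) has_real_derivative m * (cosh (g t) / sinh (g t))) (at t)" if "t \<in> I" for t
  proof -
    have "inverse (1 + (g1 t)\<^sup>2) * (m * (cosh (g t) / sinh (g t)) * (1 + (g1 t)\<^sup>2)) = m * (cosh (g t) / sinh (g t))"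
      using pos[of t] by simp
    then show ?thesis using DERIV_chain2[OF DERIV_arctan g1(4)[OF that]] by (simp only:)
  qed
  have z0: "((\<lambda>t. sinh (g t) * cos_root m (arctan (g1 t))) has_real_derivative 0) (at t within I)" if t: "t \<in> I" for t
  proof -
    have S: "sinh (g t) > 0" using g1(2)[OF t] by simp
    have 1: "((\<lambda>t. cos_root m (arctan (g1 t))) has_real_derivative
       - (g1 t * cos_root m (arctan (g1 t)) / m) * (m * (cosh (g t) / sinh (g t)))) (at t)"
      using DERIV_chain2[OF cos_root_deriv[OF m arctan_range] th[OF t]] by (simp add: tan_arctan)
    have "((\<lambda>t. sinh (g t) * cos_root m (arctan (g1 t))) has_real_derivative 0) (at t)"
      using S m by (auto intro!: derivative_eq_intros g1(3)[OF t] 1)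
    then show ?thesis by (rule has_field_derivative_at_within)
  qed
  obtain c where c: "\<And>t. t \<in> I \<Longrightarrow> sinh (g t) * cos_root m (arctan (g1 t)) = c"
    using has_field_derivative_zero_constant[OF cvx z0] by blast
  have c': "sinh (g t) * cos_root m (arctan (g1 t)) = sinh b" if "t \<in> I" for t
    using c[OF I(3)] c[OF that] I(4) g1(1) by simp
  have z1: "((\<lambda>t. height m b (arctan (g1 t)) - t) has_real_derivative 0) (at t within I)" if t: "t \<in> I" for t
  proof -
    have S: "sinh (g t) > 0" using g1(2)[OF t] by simp
    have "tanh_rad m b (arctan (g1 t)) = sinh (g t) / cosh (g t)"
      by (rule tanh_rad_eq_tanh[OF b arctan_range c'[OF t]])
    then have e: "tanh_rad m b (arctan (g1 t)) / m * (m * (cosh (g t) / sinh (g t))) = 1" using S m by simp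
    have "((\<lambda>t. height m b (arctan (g1 t))) has_real_derivative 1) (at t)"
      using DERIV_chain2[OF height_deriv(1)[OF m b arctan_range] th[OF t]] unfolding e .
    then have "((\<lambda>t. height m b (arctan (g1 t)) - t) has_real_derivative 0) (at t)"
      by (auto intro!: derivative_eq_intros)
    then show ?thesis by (rule has_field_derivative_at_within)
  qed
  obtain d where d: "\<And>t. t \<in> I \<Longrightarrow> height m b (arctan (g1 t)) - t = d"
    using has_field_derivative_zero_constant[OF cvx z1] by blast
  have "height m b (arctan (g1 t)) = t" if "t \<in> I" for t
    using d[OF I(3)] d[OF that] g1(1) by simp
  then show ?thesis using that[of g1] g1 c' by blast
qed

text \<open>
  The inverse function of \<open>height m b\<close> on \<open>]-\<pi>/2, \<pi>/2[\<close>.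
\<close>

definition angle :: "real \<Rightarrow> real \<Rightarrow> real \<Rightarrow> real" where
  "angle m b t = (SOME \<theta>. - pi / 2 < \<theta> \<and> \<theta> < pi / 2 \<and> height m b \<theta> = t)"

text \<open>
  The half-width \<open>T b\<close> of the maximal interval of existence.
\<close>

definition top_height :: "real \<Rightarrow> real \<Rightarrow> real" where
  "top_height m b = height m b (pi / 2)"

text \<open>
  The maximal solution of the catenary equation with initial value \<open>b\<close>.
\<close>

definition profile :: "real \<Rightarrow> real \<Rightarrow> real \<Rightarrow> real" where
  "profile m b t = arsinh (sinh b / cos_root m (angle m b t))"

lemma angle_height:
  assumes "m > 0" "b > 0" "- pi / 2 < \<theta>" "\<theta> < pi / 2"
  shows "angle m b (height m b \<theta>) = \<theta>"
proof -
  have "\<exists>\<theta>'. - pi / 2 < \<theta>' \<and> \<theta>' < pi / 2 \<and> height m b \<theta>' = height m b \<theta>" using assms by blast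
  from someI_ex[OF this] have *: "- pi / 2 < angle m b (height m b \<theta>)" "angle m b (height m b \<theta>) < pi / 2"
    "height m b (angle m b (height m b \<theta>)) = height m b \<theta>" unfolding angle_def by auto
  then show ?thesis
    using height_strict_mono[OF assms(1,2), of "angle m b (height m b \<theta>)" \<theta>]
      height_strict_mono[OF assms(1,2), of \<theta> "angle m b (height m b \<theta>)"] assms(3,4)
    by (cases "angle m b (height m b \<theta>)" \<theta> rule: linorder_cases) auto
qed

lemma height_bound:
  assumes "m > 0" "b > 0" "- pi / 2 < \<theta>" "\<theta> < pi / 2"
  shows "- top_height m b < height m b \<theta>" "height m b \<theta> < top_height m b"
  using height_strict_mono[OF assms(1,2), of \<theta> "pi / 2"] height_strict_mono[OF assms(1,2), of "- (pi / 2)" \<theta>]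
    height_odd[OF assms(1,2), of "pi / 2"] assms(3,4)
  by (auto simp: top_height_def)

lemma angle_props:
  assumes "m > 0" "b > 0" "- top_height m b < t" "t < top_height m b"
  shows "- pi / 2 < angle m b t" "angle m b t < pi / 2" "height m b (angle m b t) = t"
proof -
  have 0: "height m b (- pi / 2) = - top_height m b"
    using height_odd[OF assms(1,2), of "pi / 2"] by (simp add: top_height_def)
  have "\<exists>x\<ge>- pi / 2. x \<le> pi / 2 \<and> height m b x = t"
    by (rule IVT'[OF _ _ _ continuous_on_height[OF assms(1,2)]])
      (use assms(3,4) 0 in \<open>simp_all add: top_height_def\<close>)
  then obtain x where x: "- pi / 2 \<le> x" "x \<le> pi / 2" "height m b x = t" by blast
  have "x \<noteq> - pi / 2" using x(3) assms(3) 0 by (metis less_irrefl)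
  moreover have "x \<noteq> pi / 2" using x(3) assms(4) unfolding top_height_def by (metis less_irrefl)
  ultimately have "- pi / 2 < x \<and> x < pi / 2 \<and> height m b x = t" using x by linarith
  then have "\<exists>x. - pi / 2 < x \<and> x < pi / 2 \<and> height m b x = t" by blast
  from someI_ex[OF this] show "- pi / 2 < angle m b t" "angle m b t < pi / 2" "height m b (angle m b t) = t"
    unfolding angle_def by auto
qed

lemma has_derivative_height_pair:
  assumes m: "m > 0" and p: "b > 0" "- pi / 2 < \<theta>" "\<theta> < pi / 2"
  shows "((\<lambda>(b, \<theta>). height m b \<theta>) has_derivative
     (\<lambda>(x, y). height_b m b \<theta> * x + tanh_rad m b \<theta> / m * y)) (at (b, \<theta>))"
proof -
  let ?X = "{0<..} :: real set" and ?Y = "{- pi / 2<..<pi / 2} :: real set"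
  have op: "open (?X \<times> ?Y)" "(b, \<theta>) \<in> ?X \<times> ?Y" using p by (auto intro!: open_Times)
  have "((\<lambda>(b, \<theta>). height m b \<theta>) has_derivative
     (\<lambda>(x, y). height_b m b \<theta> * x + blinfun_mult_right (tanh_rad m b \<theta> / m) y)) (at (b, \<theta>) within ?X \<times> ?Y)"
  proof (rule has_derivative_partialsI)
    show "((\<lambda>b. height m b \<theta>) has_derivative (*) (height_b m b \<theta>)) (at b within ?X)"
      using height_b_deriv[OF m p(1), of \<theta>] p
      by (auto simp: has_field_derivative_def intro: has_derivative_at_withinI)
    show "(height m x has_derivative blinfun_apply (blinfun_mult_right (tanh_rad m x y / m))) (at y within ?Y)"
      if "x \<in> ?X" "y \<in> ?Y" for x y
      using height_deriv(1)[OF m, of x y] that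
      by (auto simp: has_field_derivative_def intro: has_derivative_at_withinI)
    have "continuous_on (?X \<times> ?Y) (\<lambda>(x, y). tanh_rad m x y)"
      by (rule continuous_on_subset[OF continuous_on_tanh_rad_pair(1)[OF m]]) auto
    then have "continuous (at (b, \<theta>) within ?X \<times> ?Y) (\<lambda>p. tanh_rad m (fst p) (snd p))"
      using op(2) by (auto simp: continuous_on_eq_continuous_within case_prod_beta)
    then show "continuous (at (b, \<theta>) within ?X \<times> ?Y) (\<lambda>(x, y). blinfun_mult_right (tanh_rad m x y / m))"
      unfolding case_prod_beta using m
      by (intro bounded_linear.continuous[OF bounded_linear_blinfun_mult_right] continuous_intros) auto
  qed (use p in auto)
  then show ?thesis
    using at_within_open[OF op(2,1)] by (simp add: case_prod_beta)
qed

text \<open>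
  The map \<open>(b, \<theta>) \<mapsto> (b, height m b \<theta>)\<close> is injective with invertible derivative, so its inverse
  \<open>(b, t) \<mapsto> (b, angle m b t)\<close> is differentiable.
\<close>

lemma has_derivative_angle:
  assumes m: "m > 0" and b: "b > 0" and t: "- top_height m b < t" "t < top_height m b"
  defines "\<theta> \<equiv> angle m b t"
  shows "((\<lambda>(b, t). angle m b t) has_derivative
     (\<lambda>(x, y). (y - height_b m b \<theta> * x) * m / tanh_rad m b \<theta>)) (at (b, t))"
proof -
  note th = angle_props[OF m b t, folded \<theta>_def]
  let ?S = "{0<..} \<times> {- pi / 2<..<pi / 2} :: (real \<times> real) set"
  let ?f = "\<lambda>(b, \<theta>). (b, height m b \<theta>)"
  let ?g = "\<lambda>(b, t). (b, angle m b t)"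
  have d: "(?f has_derivative (\<lambda>(x, y). (x, height_b m b \<theta> * x + tanh_rad m b \<theta> / m * y))) (at (b, \<theta>))"
    if "b > 0" "- pi / 2 < \<theta>" "\<theta> < pi / 2" for b \<theta>
    using has_derivative_Pair[OF has_derivative_fst[OF has_derivative_ident] has_derivative_height_pair[OF m that]]
    by (simp add: case_prod_unfold)
  have s: "tanh_rad m b \<theta> > 0" by (rule tanh_rad_pos[OF b])
  have "(?g has_derivative (\<lambda>(x, y). (x, (y - height_b m b \<theta> * x) * m / tanh_rad m b \<theta>))) (at (?f (b, \<theta>)))"
  proof (rule has_derivative_inverse_strong[where S = ?S and f = ?f and g = ?g and x = "(b, \<theta>)"])
    show "open ?S" by (intro open_Times) auto
    show "(b, \<theta>) \<in> ?S" using b th by simp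
    show "continuous_on ?S ?f"
    proof (intro continuous_at_imp_continuous_on ballI)
      fix p assume "p \<in> ?S"
      then obtain b' \<theta>' where "p = (b', \<theta>')" "b' > 0" "- pi / 2 < \<theta>'" "\<theta>' < pi / 2"
        by auto
      then show "isCont ?f p" using has_derivative_continuous[OF d] by blast
    qed
    show "?g (?f p) = p" if "p \<in> ?S" for p
      using that angle_height[OF m] by auto
    show "(?f has_derivative (\<lambda>(x, y). (x, height_b m b \<theta> * x + tanh_rad m b \<theta> / m * y))) (at (b, \<theta>))"
      by (rule d) (use b th in auto)
    show "(\<lambda>(x, y). (x, height_b m b \<theta> * x + tanh_rad m b \<theta> / m * y)) \<circ>
        (\<lambda>(x, y). (x, (y - height_b m b \<theta> * x) * m / tanh_rad m b \<theta>)) = id"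
      using s m by (auto simp: fun_eq_iff)
  qed
  then have "(?g has_derivative (\<lambda>(x, y). (x, (y - height_b m b \<theta> * x) * m / tanh_rad m b \<theta>))) (at (b, t))"
    using th by simp
  from has_derivative_snd[OF this] show ?thesis by (simp add: case_prod_unfold)
qed

lemma angle_deriv:
  assumes m: "m > 0" and b: "b > 0" and t: "- top_height m b < t" "t < top_height m b"
  shows "(angle m b has_real_derivative m / tanh_rad m b (angle m b t)) (at t)"
    "((\<lambda>b. angle m b t) has_real_derivative - height_b m b (angle m b t) * m / tanh_rad m b (angle m b t)) (at b)"
proof -
  note D = has_derivative_angle[OF assms]
  have "((\<lambda>t. (b, t)) has_derivative (\<lambda>y. (0, y))) (at t)" by (auto intro!: derivative_eq_intros)
  from has_derivative_compose[OF this D]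
  have "(angle m b has_derivative (\<lambda>y. y * m / tanh_rad m b (angle m b t))) (at t)" by simp
  then show "(angle m b has_real_derivative m / tanh_rad m b (angle m b t)) (at t)"
    by (rule has_derivative_imp_has_field_derivative) simp
  have "((\<lambda>b. (b, t)) has_derivative (\<lambda>x. (x, 0))) (at b)" by (auto intro!: derivative_eq_intros)
  from has_derivative_compose[OF this D]
  have "((\<lambda>b. angle m b t) has_derivative (\<lambda>x. - (height_b m b (angle m b t) * x * m / tanh_rad m b (angle m b t)))) (at b)"
    by simp
  then show "((\<lambda>b. angle m b t) has_real_derivative - height_b m b (angle m b t) * m / tanh_rad m b (angle m b t)) (at b)"
    by (rule has_derivative_imp_has_field_derivative) simp
qed

lemma profile_props:
  assumes m: "m > 0" and b: "b > 0" and t: "- top_height m b < t" "t < top_height m b"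
  defines "\<theta> \<equiv> angle m b t" and "x \<equiv> profile m b t"
  shows "x > 0" "sinh x * cos_root m \<theta> = sinh b"
    "tanh_rad m b \<theta> = sinh x / cosh x" "tanh_rad_b m b \<theta> = cosh b / sinh b * sinh x / cosh x ^ 3"
proof -
  note th = angle_props[OF m b t, folded \<theta>_def]
  have c: "cos_root m \<theta> > 0" by (rule cos_root_pos[OF th(1,2)])
  have S: "sinh x = sinh b / cos_root m \<theta>" by (simp add: x_def \<theta>_def profile_def)
  show eq: "sinh x * cos_root m \<theta> = sinh b" using c by (simp add: S)
  have "sinh x > 0" unfolding S using b c by simp
  then show "x > 0" by simp
  show "tanh_rad m b \<theta> = sinh x / cosh x" "tanh_rad_b m b \<theta> = cosh b / sinh b * sinh x / cosh x ^ 3"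
    by (rule tanh_rad_eq_tanh[OF b th(1,2) eq])+
qed

lemma arsinh_deriv: "(arsinh has_real_derivative 1 / cosh (arsinh x)) (at x)" for x :: real
proof -
  have "cosh (arsinh x) = sqrt (x\<^sup>2 + 1)"
    using cosh_square_eq[of "arsinh x"] by (intro real_sqrt_unique[symmetric]) (auto simp: add.commute)
  then show ?thesis using arsinh_real_has_field_derivative[of x UNIV] by simp
qed

lemma profile_deriv:
  assumes m: "m > 0" and b: "b > 0" and t: "- top_height m b < t" "t < top_height m b"
  defines "\<theta> \<equiv> angle m b t" and "x \<equiv> profile m b t"
  shows "(profile m b has_real_derivative tan \<theta>) (at t)"
    "((\<lambda>b. profile m b t) has_real_derivative
       tanh_rad m b \<theta> * (cosh b / sinh b) - tan \<theta> * height_b m b \<theta>) (at b)"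
    "((\<lambda>t. tan (angle m b t)) has_real_derivative m * (cosh x / sinh x) * (1 + (tan \<theta>)\<^sup>2)) (at t)"
proof -
  note th = angle_props[OF m b t, folded \<theta>_def]
  note P = profile_props[OF m b t, folded \<theta>_def x_def]
  have c: "cos_root m \<theta> > 0" by (rule cos_root_pos[OF th(1,2)])
  have cs: "cos \<theta> > 0" using cos_gt_zero_pi[of \<theta>] th by simp
  have S: "sinh x > 0" using P(1) by simp
  have Sb: "sinh b > 0" using b by simp
  have C: "cosh x > 0" by simp
  have x: "sinh b / cos_root m \<theta> = sinh x" using c P(2) by (simp add: field_simps)
  have xx: "arsinh (sinh x) = x" by (simp add: arsinh_sinh_real)
  have dt: "(angle m b has_real_derivative m * cosh x / sinh x) (at t)"
    using angle_deriv(1)[OF m b t] P(3) S C by (simp flip: \<theta>_def)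
  have db: "((\<lambda>b. angle m b t) has_real_derivative - height_b m b \<theta> * m * cosh x / sinh x) (at b)"
    using angle_deriv(2)[OF m b t] P(3) S C by (simp flip: \<theta>_def)
  have ct: "((\<lambda>t. cos_root m (angle m b t)) has_real_derivative
      - (tan \<theta> * cos_root m \<theta> / m) * (m * cosh x / sinh x)) (at t)"
    using DERIV_chain2[OF cos_root_deriv[OF m th(1,2), unfolded \<theta>_def] dt] by (simp flip: \<theta>_def)
  have cb: "((\<lambda>b. cos_root m (angle m b t)) has_real_derivative
      - (tan \<theta> * cos_root m \<theta> / m) * (- height_b m b \<theta> * m * cosh x / sinh x)) (at b)"
    using DERIV_chain2[OF cos_root_deriv[OF m th(1,2), unfolded \<theta>_def] db] by (simp flip: \<theta>_def)
  have a: "(arsinh has_real_derivative 1 / cosh x) (at (sinh b / cos_root m (angle m b t)))"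
    using arsinh_deriv[of "sinh x"] by (simp add: xx x flip: \<theta>_def)
  have "((\<lambda>t. sinh b / cos_root m (angle m b t)) has_real_derivative
      - (sinh b * (- (tan \<theta> * cos_root m \<theta> / m) * (m * cosh x / sinh x))) / (cos_root m \<theta> * cos_root m \<theta>)) (at t)"
    using c m by (auto intro!: derivative_eq_intros ct simp flip: \<theta>_def)
  note d1 = DERIV_chain2[OF a this]
  have "1 / cosh x * (- (sinh b * (- (tan \<theta> * cos_root m \<theta> / m) * (m * cosh x / sinh x)))
      / (cos_root m \<theta> * cos_root m \<theta>)) = tan \<theta>"
    unfolding P(2)[symmetric] using c m S C by simp
  then show "(profile m b has_real_derivative tan \<theta>) (at t)"
    using d1 unfolding profile_def[abs_def] by (simp only:)
  have "((\<lambda>b. sinh b / cos_root m (angle m b t)) has_real_derivative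
      (cosh b * cos_root m \<theta> - sinh b * (- (tan \<theta> * cos_root m \<theta> / m) * (- height_b m b \<theta> * m * cosh x / sinh x)))
        / (cos_root m \<theta> * cos_root m \<theta>)) (at b)"
    using c m by (auto intro!: derivative_eq_intros cb simp flip: \<theta>_def)
  note d2 = DERIV_chain2[OF a this]
  have "1 / cosh x * ((cosh b * cos_root m \<theta> - sinh b * (- (tan \<theta> * cos_root m \<theta> / m)
         * (- height_b m b \<theta> * m * cosh x / sinh x))) / (cos_root m \<theta> * cos_root m \<theta>))
      = tanh_rad m b \<theta> * (cosh b / sinh b) - tan \<theta> * height_b m b \<theta>"
    unfolding P(3) P(2)[symmetric] using c m S C by (simp add: field_simps)
  then show "((\<lambda>b. profile m b t) has_real_derivative
       tanh_rad m b \<theta> * (cosh b / sinh b) - tan \<theta> * height_b m b \<theta>) (at b)"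
    using d2 unfolding profile_def[abs_def] by (simp only:)
  have "1 + (tan \<theta>)\<^sup>2 = inverse ((cos \<theta>)\<^sup>2)" using cs tan_sec[of \<theta>] by (simp add: power_inverse)
  then show "((\<lambda>t. tan (angle m b t)) has_real_derivative m * (cosh x / sinh x) * (1 + (tan \<theta>)\<^sup>2)) (at t)"
    using DERIV_chain2[OF DERIV_tan dt] cs by (simp add: mult_ac flip: \<theta>_def)
qed

section \<open>Jacobi fields and the envelope\<close>

lemma top_height_pos: "m > 0 \<Longrightarrow> b > 0 \<Longrightarrow> top_height m b > 0"
  using height_strict_mono[of m b 0 "pi / 2"] by (simp add: top_height_def)

lemma isCont_top_height: "m > 0 \<Longrightarrow> b > 0 \<Longrightarrow> isCont (top_height m) b"
  unfolding top_height_def[abs_def] by (rule DERIV_isCont, rule height_b_deriv) auto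

lemma angle_0 [simp]: "m > 0 \<Longrightarrow> b > 0 \<Longrightarrow> angle m b 0 = 0"
  using angle_height[of m b 0] by simp

lemma angle_odd:
  assumes "m > 0" "b > 0" "- top_height m b < t" "t < top_height m b"
  shows "angle m b (- t) = - angle m b t"
  using angle_props[OF assms] height_odd[OF assms(1,2), of "angle m b t"]
    angle_height[OF assms(1,2), of "- angle m b t"] by simp

lemma cos_root_even: "cos_root m (- \<theta>) = cos_root m \<theta>"
  by (simp add: cos_root_def)

lemma profile_even:
  assumes "m > 0" "b > 0" "- top_height m b < t" "t < top_height m b"
  shows "profile m b (- t) = profile m b t"
  by (simp add: profile_def angle_odd[OF assms] cos_root_even)

lemma profile_catenary_solution:
  assumes n: "n \<ge> 2" and b: "b > 0"
  defines "m \<equiv> real n - 1"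
  shows "catenary_solution n b {- top_height m b<..<top_height m b} (profile m b)"
proof -
  have m: "m > 0" using n by (simp add: m_def)
  have 0: "0 \<in> {- top_height m b<..<top_height m b}" using top_height_pos[OF m b] by simp
  have p0: "profile m b 0 = b" using m b by (simp add: profile_def arsinh_sinh_real)
  have "\<forall>t\<in>{- top_height m b<..<top_height m b}. profile m b t > 0 \<and>
          (profile m b has_real_derivative tan (angle m b t)) (at t) \<and>
          ((\<lambda>t. tan (angle m b t)) has_real_derivative
             (real n - 1) * (cosh (profile m b t) / sinh (profile m b t)) * (1 + (tan (angle m b t))\<^sup>2)) (at t)"
    using profile_props(1)[OF m b] profile_deriv(1,3)[OF m b] by (auto simp flip: m_def)
  moreover have "tan (angle m b 0) = 0" using m b by simp
  ultimately show ?thesis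
    unfolding catenary_solution_def using 0 p0 by (auto simp: is_interval_oo)
qed

text \<open>
  Every solution is a restriction of \<open>profile m b\<close>, which is itself a solution on
  \<open>]-top_height m b, top_height m b[\<close>.
\<close>

lemma maximal_catenary_solution_eq_profile:
  assumes max: "maximal_catenary_solution n b {- T<..<T} g" and n: "n \<ge> 2" and b: "b > 0" and T: "T > 0"
  defines "m \<equiv> real n - 1"
  shows "T = top_height m b" "\<And>t. - T < t \<Longrightarrow> t < T \<Longrightarrow> g t = profile m b t"
proof -
  have m: "m > 0" using n by (simp add: m_def)
  have sol: "catenary_solution n b {- T<..<T} g" using max by (simp add: maximal_catenary_solution_def)
  obtain g1 where g1: "\<And>t. t \<in> {- T<..<T} \<Longrightarrow> sinh (g t) * cos_root m (arctan (g1 t)) = sinh b"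
    "\<And>t. t \<in> {- T<..<T} \<Longrightarrow> height m b (arctan (g1 t)) = t"
    using catenary_solution_quadrature[OF sol n b] unfolding m_def by metis
  have top: "top_height m b > 0" by (rule top_height_pos[OF m b])
  have le: "T \<le> top_height m b"
  proof (rule ccontr)
    assume "\<not> T \<le> top_height m b"
    then have "top_height m b \<in> {- T<..<T}" using top by auto
    from g1(2)[OF this] show False
      using height_bound(2)[OF m b arctan_range, of "g1 (top_height m b)"] by simp
  qed
  show eq: "g t = profile m b t" if t: "- T < t" "t < T" for t
  proof -
    have t': "t \<in> {- T<..<T}" using t by simp
    have "angle m b t = arctan (g1 t)"
      using angle_height[OF m b arctan_range, of "g1 t"] g1(2)[OF t'] by simp
    moreover have "sinh (g t) = sinh b / cos_root m (arctan (g1 t))"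
      using g1(1)[OF t'] cos_root_pos[OF arctan_range, of m "g1 t"] by (simp add: field_simps)
    ultimately show ?thesis by (metis profile_def arsinh_sinh_real)
  qed
  have "catenary_solution n b {- top_height m b<..<top_height m b} (profile m b)"
    unfolding m_def by (rule profile_catenary_solution[OF n b])
  moreover have "{- T<..<T} \<subseteq> {- top_height m b<..<top_height m b}" using le by auto
  moreover have "\<forall>t\<in>{- T<..<T}. profile m b t = g t" using eq by simp
  ultimately have I: "{- top_height m b<..<top_height m b} = {- T<..<T}"
    using max unfolding maximal_catenary_solution_def by blast
  have "\<not> T < top_height m b"
  proof
    assume "T < top_height m b"
    then have "T \<in> {- top_height m b<..<top_height m b}" using T by simp
    then show False unfolding I by simp
  qed
  then show "T = top_height m b" using le by simp
qed

text \<open>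
  The coefficient \<open>p\<close> of the equation \<open>W'' = - p W\<close> for rotation invariant Jacobi fields, at a point of hyperbolic
  radius \<open>x\<close>.
\<close>

definition jacobi_potential :: "real \<Rightarrow> real \<Rightarrow> real" where
  "jacobi_potential m x = m * ((m + 1) * (cosh x / sinh x)\<^sup>2 - 1)"

text \<open>
  Up to sign, the vertical component of the unit normal, that is, the Jacobi field of the vertical translations.
\<close>

definition odd_field :: "real \<Rightarrow> real \<Rightarrow> real \<Rightarrow> real" where
  "odd_field m b t = sin (angle m b t)"

text \<open>
  The derivative of \<open>odd_field\<close> in \<open>t\<close>.
\<close>

definition odd_field1 :: "real \<Rightarrow> real \<Rightarrow> real \<Rightarrow> real" where
  "odd_field1 m b t = m * cos (angle m b t) * (cosh (profile m b t) / sinh (profile m b t))"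

text \<open>
  The normal component of the variation of the catenoid with the initial value \<open>b\<close>, written out as
  \<open>tanh f coth b cos \<theta> - sin \<theta> height_b\<close>; see \<open>profile_b_deriv\<close> for its relation to that variation.
\<close>

definition even_field :: "real \<Rightarrow> real \<Rightarrow> real \<Rightarrow> real" where
  "even_field m b t = sinh (profile m b t) / cosh (profile m b t) * (cosh b / sinh b) * cos (angle m b t)
     - sin (angle m b t) * height_b m b (angle m b t)"

text \<open>
  The derivative of \<open>even_field\<close> in \<open>t\<close>.
\<close>

definition even_field1 :: "real \<Rightarrow> real \<Rightarrow> real \<Rightarrow> real" where
  "even_field1 m b t = - m * (cosh b / sinh b * sin (angle m b t)
     + cos (angle m b t) * (cosh (profile m b t) / sinh (profile m b t)) * height_b m b (angle m b t))"

text \<open>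
  The symmetry of \<open>height\<close> is differentiated in \<open>b\<close>.
\<close>

lemma height_b_odd:
  assumes m: "m > 0" and b: "b > 0" and th: "- pi / 2 \<le> \<theta>" "\<theta> \<le> pi / 2"
  shows "height_b m b (- \<theta>) = - height_b m b \<theta>"
proof -
  have "((\<lambda>b. - height m b \<theta>) has_real_derivative - height_b m b \<theta>) (at b)"
    using height_b_deriv[OF m b, of \<theta>] th by (auto intro: DERIV_minus)
  then have "((\<lambda>b. height m b (- \<theta>)) has_real_derivative - height_b m b \<theta>) (at b)"
    by (rule has_field_derivative_transform_within_open[where S = "{0<..}"])
      (use b m th in \<open>auto simp: height_odd\<close>)
  moreover have "((\<lambda>b. height m b (- \<theta>)) has_real_derivative height_b m b (- \<theta>)) (at b)"
    by (rule height_b_deriv[OF m b]) (use th in auto)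
  ultimately show ?thesis by (rule DERIV_unique[symmetric])
qed

context
  fixes m b t :: real
  assumes m: "m > 0" and b: "b > 0" and t: "- top_height m b < t" "t < top_height m b"
begin

lemma angle_deriv': "(angle m b has_real_derivative m * (cosh (profile m b t) / sinh (profile m b t))) (at t)"
  using angle_deriv(1)[OF m b t] profile_props(1,3)[OF m b t] by simp

lemma coth_profile_deriv:
  "((\<lambda>t. cosh (profile m b t) / sinh (profile m b t)) has_real_derivative
     - tan (angle m b t) / (sinh (profile m b t))\<^sup>2) (at t)"
proof -
  let ?x = "profile m b t"
  have S: "sinh ?x > 0" using profile_props(1)[OF m b t] by simp
  have e: "tan (angle m b t) * (sinh ?x * sinh ?x - cosh ?x * cosh ?x) = - tan (angle m b t)"
    using cosh_square_eq[of ?x] by (simp add: power2_eq_square)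
  have "((\<lambda>t. cosh (profile m b t) / sinh (profile m b t)) has_real_derivative
     tan (angle m b t) * (sinh ?x * sinh ?x - cosh ?x * cosh ?x) / (sinh ?x)\<^sup>2) (at t)"
    using S by (auto intro!: derivative_eq_intros profile_deriv(1)[OF m b t] simp: power2_eq_square algebra_simps)
  then show ?thesis unfolding e .
qed

lemma tanh_profile_deriv:
  "((\<lambda>t. sinh (profile m b t) / cosh (profile m b t)) has_real_derivative
     tan (angle m b t) / (cosh (profile m b t))\<^sup>2) (at t)"
proof -
  let ?x = "profile m b t"
  have e: "tan (angle m b t) * (cosh ?x * cosh ?x - sinh ?x * sinh ?x) = tan (angle m b t)"
    using cosh_square_eq[of ?x] by (simp add: power2_eq_square)
  have "((\<lambda>t. sinh (profile m b t) / cosh (profile m b t)) has_real_derivative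
     tan (angle m b t) * (cosh ?x * cosh ?x - sinh ?x * sinh ?x) / (cosh ?x)\<^sup>2) (at t)"
    by (auto intro!: derivative_eq_intros profile_deriv(1)[OF m b t] simp: power2_eq_square algebra_simps)
  then show ?thesis unfolding e .
qed

lemma height_b_angle_deriv:
  "((\<lambda>t. height_b m b (angle m b t)) has_real_derivative
     cosh b / sinh b / (cosh (profile m b t))\<^sup>2) (at t)"
proof -
  let ?x = "profile m b t"
  note th = angle_props[OF m b t]
  have S: "sinh ?x > 0" using profile_props(1)[OF m b t] by simp
  have "tanh_rad_b m b (angle m b t) / m * (m * (cosh ?x / sinh ?x)) = cosh b / sinh b / (cosh ?x)\<^sup>2"
    unfolding profile_props(4)[OF m b t] using S m by (simp add: power2_eq_square power3_eq_cube)
  then show ?thesis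
    using DERIV_chain2[OF height_deriv(2)[OF m b th(1,2)] angle_deriv'] by (simp only:)
qed

lemma odd_field_deriv:
  "(odd_field m b has_real_derivative odd_field1 m b t) (at t)"
  "(odd_field1 m b has_real_derivative - jacobi_potential m (profile m b t) * odd_field m b t) (at t)"
proof -
  let ?x = "profile m b t" and ?th = "angle m b t"
  have S: "sinh ?x > 0" using profile_props(1)[OF m b t] by simp
  have cs: "cos ?th > 0" using cos_gt_zero_pi[of ?th] angle_props[OF m b t] by simp
  show "(odd_field m b has_real_derivative odd_field1 m b t) (at t)"
    unfolding odd_field_def[abs_def] odd_field1_def
    by (auto intro!: derivative_eq_intros angle_deriv')
  define k where "k = cosh ?x / sinh ?x"
  have k: "1 / (sinh ?x)\<^sup>2 = k\<^sup>2 - 1"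
    using S cosh_square_eq[of ?x] by (simp add: k_def power_divide field_simps)
  define K where "K = (\<lambda>t. cosh (profile m b t) / sinh (profile m b t))"
  have dK: "(K has_real_derivative - tan ?th / (sinh ?x)\<^sup>2) (at t)" and Kt: "K t = k"
    using coth_profile_deriv by (simp_all add: K_def k_def)
  have "((\<lambda>t. m * cos (angle m b t) * K t) has_real_derivative
     m * (- sin ?th * (m * k)) * k + m * cos ?th * (- tan ?th / (sinh ?x)\<^sup>2)) (at t)"
    by (auto intro!: derivative_eq_intros angle_deriv'[folded k_def] dK simp: Kt)
  then have "(odd_field1 m b has_real_derivative
     m * (- sin ?th * (m * k)) * k + m * cos ?th * (- tan ?th / (sinh ?x)\<^sup>2)) (at t)"
    unfolding odd_field1_def[abs_def] K_def .
  moreover have "m * (- sin ?th * (m * k)) * k + m * cos ?th * (- tan ?th / (sinh ?x)\<^sup>2)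
      = - jacobi_potential m ?x * odd_field m b t"
  proof -
    have e: "cos ?th * (- tan ?th / (sinh ?x)\<^sup>2) = - sin ?th * (k\<^sup>2 - 1)"
      using cs unfolding k[symmetric] by (simp add: tan_def)
    have "m * cos ?th * (- tan ?th / (sinh ?x)\<^sup>2) = m * (- sin ?th * (k\<^sup>2 - 1))" by (simp only: mult.assoc e)
    then show ?thesis
      unfolding jacobi_potential_def odd_field_def k_def[symmetric] by (simp add: power2_eq_square algebra_simps)
  qed
  ultimately show "(odd_field1 m b has_real_derivative - jacobi_potential m (profile m b t) * odd_field m b t) (at t)"
    by simp
qed

lemma even_field_deriv:
  "(even_field m b has_real_derivative even_field1 m b t) (at t)"
  "(even_field1 m b has_real_derivative - jacobi_potential m (profile m b t) * even_field m b t) (at t)"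
proof -
  let ?x = "profile m b t" and ?th = "angle m b t" and ?D = "height_b m b (angle m b t)"
  have S: "sinh ?x > 0" using profile_props(1)[OF m b t] by simp
  have cs: "cos ?th > 0" using cos_gt_zero_pi[of ?th] angle_props[OF m b t] by simp
  define k where "k = cosh ?x / sinh ?x"
  define B where "B = cosh b / sinh b"
  have k0: "k > 0" using S by (simp add: k_def)
  have ik: "sinh ?x / cosh ?x = 1 / k" by (simp add: k_def)
  have k: "1 / (sinh ?x)\<^sup>2 = k\<^sup>2 - 1"
    using S cosh_square_eq[of ?x] by (simp add: k_def power_divide field_simps)
  have k': "1 / (cosh ?x)\<^sup>2 = (k\<^sup>2 - 1) / k\<^sup>2"
    unfolding k[symmetric] using S by (simp add: k_def power_divide)
  have sn: "sin ?th = tan ?th * cos ?th" using cs by (simp add: tan_def)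
  define K L D where "K = (\<lambda>t. cosh (profile m b t) / sinh (profile m b t))"
    and "L = (\<lambda>t. sinh (profile m b t) / cosh (profile m b t))" and "D = (\<lambda>t. height_b m b (angle m b t))"
  have dK: "(K has_real_derivative - tan ?th / (sinh ?x)\<^sup>2) (at t)" and Kt: "K t = k"
    using coth_profile_deriv by (simp_all add: K_def k_def)
  have dL: "(L has_real_derivative tan ?th / (cosh ?x)\<^sup>2) (at t)" and Lt: "L t = 1 / k"
    using tanh_profile_deriv by (simp_all add: L_def ik)
  have dD: "(D has_real_derivative B / (cosh ?x)\<^sup>2) (at t)" and Dt: "D t = ?D"
    using height_b_angle_deriv[folded B_def] by (simp_all add: D_def)
  have "((\<lambda>t. L t * B * cos (angle m b t) - sin (angle m b t) * D t) has_real_derivative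
      (tan ?th / (cosh ?x)\<^sup>2 * B * cos ?th + 1 / k * B * (- sin ?th * (m * k)))
       - (cos ?th * (m * k) * ?D + sin ?th * (B / (cosh ?x)\<^sup>2))) (at t)"
    by (auto intro!: derivative_eq_intros angle_deriv'[folded k_def] dL dD simp: Lt Dt)
  then have "(even_field m b has_real_derivative
      (tan ?th / (cosh ?x)\<^sup>2 * B * cos ?th + 1 / k * B * (- sin ?th * (m * k)))
       - (cos ?th * (m * k) * ?D + sin ?th * (B / (cosh ?x)\<^sup>2))) (at t)"
    unfolding even_field_def[abs_def] B_def[symmetric] L_def D_def .
  moreover have "(tan ?th / (cosh ?x)\<^sup>2 * B * cos ?th + 1 / k * B * (- sin ?th * (m * k)))
       - (cos ?th * (m * k) * ?D + sin ?th * (B / (cosh ?x)\<^sup>2)) = even_field1 m b t"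
    unfolding even_field1_def B_def[symmetric] k_def[symmetric] sn using k0 by (simp add: algebra_simps)
  ultimately show "(even_field m b has_real_derivative even_field1 m b t) (at t)" by simp
  have "((\<lambda>t. - m * (B * sin (angle m b t) + cos (angle m b t) * K t * D t)) has_real_derivative
      - m * (B * (cos ?th * (m * k)) + ((- sin ?th * (m * k) * k + cos ?th * (- tan ?th / (sinh ?x)\<^sup>2)) * ?D
         + cos ?th * k * (B / (cosh ?x)\<^sup>2)))) (at t)"
    by (auto intro!: derivative_eq_intros angle_deriv'[folded k_def] dK dD simp: Kt Dt mult_ac)
  then have "(even_field1 m b has_real_derivative
      - m * (B * (cos ?th * (m * k)) + ((- sin ?th * (m * k) * k + cos ?th * (- tan ?th / (sinh ?x)\<^sup>2)) * ?D
         + cos ?th * k * (B / (cosh ?x)\<^sup>2)))) (at t)"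
    unfolding even_field1_def[abs_def] B_def[symmetric] K_def D_def .
  moreover have "- m * (B * (cos ?th * (m * k)) + ((- sin ?th * (m * k) * k + cos ?th * (- tan ?th / (sinh ?x)\<^sup>2)) * ?D
         + cos ?th * k * (B / (cosh ?x)\<^sup>2))) = - jacobi_potential m ?x * even_field m b t"
  proof -
    have 1: "cos ?th * (- tan ?th / (sinh ?x)\<^sup>2) = - sin ?th * (k\<^sup>2 - 1)"
      using cs unfolding k[symmetric] by (simp add: tan_def)
    have 2: "B / (cosh ?x)\<^sup>2 = B * ((k\<^sup>2 - 1) / k\<^sup>2)" unfolding k'[symmetric] by simp
    show ?thesis
      unfolding jacobi_potential_def even_field_def k_def[symmetric] ik B_def[symmetric] 1 2
      using k0 by (simp add: power2_eq_square field_simps)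
  qed
  ultimately show "(even_field1 m b has_real_derivative - jacobi_potential m (profile m b t) * even_field m b t) (at t)"
    by simp
qed

lemma wronskian: "even_field m b t * odd_field1 m b t - even_field1 m b t * odd_field m b t = m * (cosh b / sinh b)"
proof -
  let ?x = "profile m b t" and ?th = "angle m b t"
  have S: "sinh ?x > 0" using profile_props(1)[OF m b t] by simp
  define k B s c D where "k = cosh ?x / sinh ?x" and "B = cosh b / sinh b" and "s = sin ?th"
    and "c = cos ?th" and "D = height_b m b ?th"
  have k: "k > 0" using S by (simp add: k_def)
  have ik: "sinh ?x / cosh ?x = 1 / k" by (simp add: k_def)
  have sc: "s * s + c * c = 1" by (simp add: s_def c_def flip: power2_eq_square)
  have "even_field m b t * odd_field1 m b t - even_field1 m b t * odd_field m b t
     = (1 / k * B * c - s * D) * (m * c * k) + m * (B * s + c * k * D) * s"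
    unfolding even_field_def odd_field_def even_field1_def odd_field1_def ik k_def[symmetric] B_def[symmetric]
      s_def[symmetric] c_def[symmetric] D_def[symmetric] by simp
  also have "\<dots> = m * B * (s * s + c * c)" using k by (simp add: field_simps)
  finally show ?thesis by (simp add: sc B_def)
qed

lemma odd_field_odd: "odd_field m b (- t) = - odd_field m b t"
  by (simp add: odd_field_def angle_odd[OF m b t])

lemma even_field_even: "even_field m b (- t) = even_field m b t"
  using angle_props[OF m b t]
  by (simp add: even_field_def angle_odd[OF m b t] profile_even[OF m b t] height_b_odd[OF m b])

lemma odd_field_pos: "0 < t \<Longrightarrow> odd_field m b t > 0"
proof -
  assume "0 < t"
  note th = angle_props[OF m b t]
  have "angle m b t > 0"
  proof (rule ccontr)
    assume "\<not> angle m b t > 0"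
    then have "height m b (angle m b t) \<le> 0"
      using height_strict_mono[OF m b, of "angle m b t" 0] th by (cases "angle m b t = 0") auto
    then show False using th(3) \<open>0 < t\<close> by simp
  qed
  then show ?thesis unfolding odd_field_def using th by (intro sin_gt_zero2) auto
qed

lemma profile_b_deriv:
  "((\<lambda>b. profile m b t) has_real_derivative even_field m b t / cos (angle m b t)) (at b)"
proof -
  have cs: "cos (angle m b t) > 0" using cos_gt_zero_pi[of "angle m b t"] angle_props[OF m b t] by simp
  have "tanh_rad m b (angle m b t) * (cosh b / sinh b) - tan (angle m b t) * height_b m b (angle m b t)
     = even_field m b t / cos (angle m b t)"
    unfolding even_field_def profile_props(3)[OF m b t] using cs by (simp add: diff_divide_distrib tan_def)
  then show ?thesis using profile_deriv(2)[OF m b t] by (simp only:)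
qed

end

lemma even_field_0: "m > 0 \<Longrightarrow> b > 0 \<Longrightarrow> even_field m b 0 = 1"
  by (simp add: even_field_def profile_def arsinh_sinh_real)

lemma field_quotient_decreasing:
  assumes m: "m > 0" and b: "b > 0" and st: "0 < s" "s < t" "t < top_height m b"
  shows "even_field m b t / odd_field m b t < even_field m b s / odd_field m b s"
proof (rule DERIV_neg_imp_decreasing[OF st(2)])
  fix x assume "s \<le> x" "x \<le> t"
  then have x: "- top_height m b < x" "x < top_height m b" "0 < x" using st by auto
  have v: "odd_field m b x > 0" by (rule odd_field_pos[OF m b x])
  have "((\<lambda>x. even_field m b x / odd_field m b x) has_real_derivative
     (even_field1 m b x * odd_field m b x - even_field m b x * odd_field1 m b x) / (odd_field m b x * odd_field m b x)) (at x)"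
    using DERIV_divide[OF even_field_deriv(1)[OF m b x(1,2)] odd_field_deriv(1)[OF m b x(1,2)]] v by simp
  moreover have "even_field1 m b x * odd_field m b x - even_field m b x * odd_field1 m b x < 0"
    using wronskian[OF m b x(1,2)] m b by (simp add: algebra_simps)
  ultimately show "\<exists>y. ((\<lambda>x. even_field m b x / odd_field m b x) has_real_derivative y) (at x) \<and> y < 0"
    using v by (blast intro: divide_neg_pos mult_pos_pos)
qed

text \<open>
  The second coordinate is the curve parameter itself, so the envelope condition says that the derivative of
  \<open>tanh (f b t / 2)\<close> in \<open>b\<close> vanishes.
\<close>

lemma touches_envelope_iff:
  assumes f: "\<And>b. b > 0 \<Longrightarrow> T b > 0 \<and> maximal_catenary_solution n b {- T b<..<T b} (f b)"
    and n: "n \<ge> 2" and a: "a > 0" and t: "- T a < t" "t < T a"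
  defines "m \<equiv> real n - 1"
  shows "touches_envelope (\<lambda>b t. tanh (f b t / 2)) (\<lambda>b t. t) a t \<longleftrightarrow> even_field m a t = 0"
proof -
  have m: "m > 0" using n by (simp add: m_def)
  have T: "T b = top_height m b" if "b > 0" for b
    unfolding m_def using maximal_catenary_solution_eq_profile(1)[of n b "T b" "f b"] f[OF that] n that by blast
  have fp: "f b t = profile m b t" if "b > 0" "- T b < t" "t < T b" for b t
    unfolding m_def using maximal_catenary_solution_eq_profile(2)[of n b "T b" "f b" t] f[OF that(1)] n that by blast
  have t': "- top_height m a < t" "t < top_height m a" using t T[OF a] by auto
  have cs: "cos (angle m a t) > 0" using cos_gt_zero_pi[of "angle m a t"] angle_props[OF m a t'] by simp
  have "(top_height m \<longlongrightarrow> top_height m a) (nhds a)"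
    using isCont_top_height[OF m a] unfolding continuous_at tendsto_at_iff_tendsto_nhds .
  then have "\<forall>\<^sub>F b in nhds a. \<bar>t\<bar> < top_height m b"
    by (rule order_tendstoD(1)) (use t' in auto)
  moreover have "\<forall>\<^sub>F b in nhds a. b \<in> {0<..}"
    by (rule eventually_nhds_in_open) (use a in auto)
  ultimately have "\<forall>\<^sub>F b in nhds a. b > 0 \<and> \<bar>t\<bar> < top_height m b"
    by eventually_elim simp
  then have ev: "\<forall>\<^sub>F b in nhds a. profile m b t = f b t"
    by (rule eventually_mono) (use T fp in auto)
  have "((\<lambda>b. f b t) has_real_derivative even_field m a t / cos (angle m a t)) (at a)"
    using profile_b_deriv[OF m a t'] DERIV_cong_ev[OF refl ev refl] by simp
  then have xa: "((\<lambda>b. tanh (f b t / 2)) has_real_derivative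
     (1 - (tanh (f a t / 2))\<^sup>2) * (even_field m a t / cos (angle m a t) / 2)) (at a)"
    by (auto intro!: derivative_eq_intros)
  have pos: "1 - (tanh (f a t / 2))\<^sup>2 > 0"
    using tanh_real_bounds[of "f a t / 2"] by (auto simp: abs_square_less_1 abs_if)
  have "(profile m a has_real_derivative tan (angle m a t)) (at t)" by (rule profile_deriv(1)[OF m a t'])
  then have "(f a has_real_derivative tan (angle m a t)) (at t)"
    by (rule has_field_derivative_transform_within_open[where S = "{- T a<..<T a}"])
      (use t fp[OF a] in auto)
  then have xt: "((\<lambda>s. tanh (f a s / 2)) has_real_derivative
     (1 - (tanh (f a t / 2))\<^sup>2) * (tan (angle m a t) / 2)) (at t)"
    by (auto intro!: derivative_eq_intros)
  have ya: "((\<lambda>b. t) has_real_derivative 0) (at a)" and yt: "((\<lambda>s. s) has_real_derivative 1) (at t)"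
    by (auto intro!: derivative_eq_intros)
  show ?thesis
  proof
    assume "touches_envelope (\<lambda>b t. tanh (f b t / 2)) (\<lambda>b t. t) a t"
    then obtain x_a x_t y_a y_t where d: "((\<lambda>b. tanh (f b t / 2)) has_real_derivative x_a) (at a)"
      "((\<lambda>b. t) has_real_derivative y_a) (at a)" "((\<lambda>s. s) has_real_derivative y_t) (at t)"
      "x_a * y_t - x_t * y_a = 0" unfolding touches_envelope_def by blast
    have "x_a = 0" using d(4) DERIV_unique[OF d(2) ya] DERIV_unique[OF d(3) yt] by simp
    then show "even_field m a t = 0" using DERIV_unique[OF d(1) xa] pos cs by auto
  next
    assume "even_field m a t = 0"
    then have "(1 - (tanh (f a t / 2))\<^sup>2) * (even_field m a t / cos (angle m a t) / 2) * 1
        - (1 - (tanh (f a t / 2))\<^sup>2) * (tan (angle m a t) / 2) * 0 = 0" by simp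
    then show "touches_envelope (\<lambda>b t. tanh (f b t / 2)) (\<lambda>b t. t) a t"
      unfolding touches_envelope_def using xa xt ya yt by blast
  qed
qed

section \<open>A shooting problem for second-order linear equations\<close>

text \<open>
  Two solutions \<open>u\<close>, \<open>v\<close> of \<open>y'' = - p y\<close> with constant Wronskian \<open>c \<noteq> 0\<close>, and a weight \<open>e\<close>. The solutions of
  \<open>y'' = (\<mu> e - p) y\<close> with initial values of \<open>A u + B v\<close> are constructed as power series in \<open>\<mu>\<close>, which makes them
  continuous in \<open>\<mu>\<close>.
\<close>

locale fundamental_system =
  fixes \<alpha> \<beta> :: real and u u1 v v1 p e :: "real \<Rightarrow> real" and c :: real
  assumes le: "\<alpha> < \<beta>"
    and u: "\<And>t. t \<in> {\<alpha>..\<beta>} \<Longrightarrow> (u has_real_derivative u1 t) (at t within {\<alpha>..\<beta>})"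
    and u1: "\<And>t. t \<in> {\<alpha>..\<beta>} \<Longrightarrow> (u1 has_real_derivative - p t * u t) (at t within {\<alpha>..\<beta>})"
    and v: "\<And>t. t \<in> {\<alpha>..\<beta>} \<Longrightarrow> (v has_real_derivative v1 t) (at t within {\<alpha>..\<beta>})"
    and v1: "\<And>t. t \<in> {\<alpha>..\<beta>} \<Longrightarrow> (v1 has_real_derivative - p t * v t) (at t within {\<alpha>..\<beta>})"
    and wr: "\<And>t. t \<in> {\<alpha>..\<beta>} \<Longrightarrow> u t * v1 t - u1 t * v t = c" and c: "c \<noteq> 0"
    and p: "continuous_on {\<alpha>..\<beta>} p" and e: "continuous_on {\<alpha>..\<beta>} e"
begin

abbreviation I :: "real set" where "I \<equiv> {\<alpha>..\<beta>}"

text \<open>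
  The coefficients of the power series in \<open>\<mu>\<close>: each solves \<open>y'' + p y = e (previous coefficient)\<close> with zero initial
  values, by variation of constants. \<open>iter1\<close> and \<open>iter2\<close> are the first two derivatives.
\<close>

primrec iter :: "real \<Rightarrow> real \<Rightarrow> nat \<Rightarrow> real \<Rightarrow> real" where
  "iter A B 0 = (\<lambda>t. A * u t + B * v t)"
| "iter A B (Suc k) = (\<lambda>t. (v t * integral {\<alpha>..t} (\<lambda>s. u s * e s * iter A B k s)
      - u t * integral {\<alpha>..t} (\<lambda>s. v s * e s * iter A B k s)) / c)"

primrec iter1 :: "real \<Rightarrow> real \<Rightarrow> nat \<Rightarrow> real \<Rightarrow> real" where
  "iter1 A B 0 = (\<lambda>t. A * u1 t + B * v1 t)"
| "iter1 A B (Suc k) = (\<lambda>t. (v1 t * integral {\<alpha>..t} (\<lambda>s. u s * e s * iter A B k s)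
      - u1 t * integral {\<alpha>..t} (\<lambda>s. v s * e s * iter A B k s)) / c)"

primrec iter2 :: "real \<Rightarrow> real \<Rightarrow> nat \<Rightarrow> real \<Rightarrow> real" where
  "iter2 A B 0 = (\<lambda>t. - p t * iter A B 0 t)"
| "iter2 A B (Suc k) = (\<lambda>t. - p t * iter A B (Suc k) t + e t * iter A B k t)"

lemma cont: "continuous_on I u" "continuous_on I v" "continuous_on I u1" "continuous_on I v1"
  by (rule DERIV_continuous_on, erule u v u1 v1)+

lemma iter_deriv_aux:
  assumes "continuous_on I (iter A B k)" "t \<in> I"
  shows "((\<lambda>t. integral {\<alpha>..t} (\<lambda>s. u s * e s * iter A B k s)) has_real_derivative u t * e t * iter A B k t) (at t within I)"
    "((\<lambda>t. integral {\<alpha>..t} (\<lambda>s. v s * e s * iter A B k s)) has_real_derivative v t * e t * iter A B k t) (at t within I)"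
  by (rule integral_has_real_derivative[OF _ assms(2)], intro continuous_intros cont e assms(1))+

lemma iter_Suc_deriv:
  assumes "continuous_on I (iter A B k)" "t \<in> I"
  shows "(iter A B (Suc k) has_real_derivative iter1 A B (Suc k) t) (at t within I)"
    "(iter1 A B (Suc k) has_real_derivative iter2 A B (Suc k) t) (at t within I)"
proof -
  define X Y where "X = (\<lambda>t. integral {\<alpha>..t} (\<lambda>s. u s * e s * iter A B k s))"
    and "Y = (\<lambda>t. integral {\<alpha>..t} (\<lambda>s. v s * e s * iter A B k s))"
  note X = iter_deriv_aux(1)[OF assms, folded X_def] and Y = iter_deriv_aux(2)[OF assms, folded Y_def]
  have "((\<lambda>t. (v t * X t - u t * Y t) / c) has_real_derivative (v1 t * X t - u1 t * Y t) / c) (at t within I)"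
    by (rule DERIV_cdivide) (auto intro!: derivative_eq_intros u[OF assms(2)] v[OF assms(2)] X Y simp: algebra_simps)
  then show "(iter A B (Suc k) has_real_derivative iter1 A B (Suc k) t) (at t within I)"
    by (simp add: X_def Y_def)
  have "((\<lambda>t. (v1 t * X t - u1 t * Y t) / c) has_real_derivative
      (- p t * v t * X t + v1 t * (u t * e t * iter A B k t) - (- p t * u t * Y t + u1 t * (v t * e t * iter A B k t))) / c) (at t within I)"
    by (rule DERIV_cdivide) (auto intro!: derivative_eq_intros u1[OF assms(2)] v1[OF assms(2)] X Y simp: algebra_simps)
  moreover have "(- p t * v t * X t + v1 t * (u t * e t * iter A B k t) - (- p t * u t * Y t + u1 t * (v t * e t * iter A B k t))) / c
     = iter2 A B (Suc k) t"
  proof -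
    have q: "- p t * v t * X t + v1 t * (u t * e t * iter A B k t) - (- p t * u t * Y t + u1 t * (v t * e t * iter A B k t))
      = - p t * (v t * X t - u t * Y t) + e t * iter A B k t * (u t * v1 t - u1 t * v t)"
      by (simp add: algebra_simps)
    have "(- p t * (v t * X t - u t * Y t) + e t * iter A B k t * c) / c
      = - p t * ((v t * X t - u t * Y t) / c) + e t * iter A B k t"
      using c by (simp add: field_simps)
    then show ?thesis
      unfolding q wr[OF assms(2)] by (simp add: X_def Y_def)
  qed
  ultimately show "(iter1 A B (Suc k) has_real_derivative iter2 A B (Suc k) t) (at t within I)"
    by (simp add: X_def Y_def)
qed

lemma continuous_on_iter: "continuous_on I (iter A B k)"
proof (induction k)
  case 0
  then show ?case by (auto intro!: continuous_intros cont)
next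
  case (Suc k)
  show ?case by (rule DERIV_continuous_on, rule iter_Suc_deriv(1)[OF Suc])
qed

lemma iter_deriv:
  assumes t: "t \<in> I"
  shows "(iter A B k has_real_derivative iter1 A B k t) (at t within I)"
    "(iter1 A B k has_real_derivative iter2 A B k t) (at t within I)"
proof -
  have "(iter A B k has_real_derivative iter1 A B k t) (at t within I) \<and>
    (iter1 A B k has_real_derivative iter2 A B k t) (at t within I)"
  proof (cases k)
    case 0
    have "((\<lambda>t. A * u1 t + B * v1 t) has_real_derivative A * (- p t * u t) + B * (- p t * v t)) (at t within I)"
      by (intro DERIV_add DERIV_cmult u1 v1 t)
    moreover have "((\<lambda>t. A * u t + B * v t) has_real_derivative A * u1 t + B * v1 t) (at t within I)"
      by (intro DERIV_add DERIV_cmult u v t)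
    ultimately show ?thesis by (simp add: 0 algebra_simps)
  next
    case (Suc j)
    then show ?thesis using iter_Suc_deriv[OF continuous_on_iter t] by blast
  qed
  then show "(iter A B k has_real_derivative iter1 A B k t) (at t within I)"
    "(iter1 A B k has_real_derivative iter2 A B k t) (at t within I)" by blast+
qed

lemma bounded_on:
  assumes "continuous_on I g"
  shows "\<exists>M\<ge>1. \<forall>t\<in>I. \<bar>g t\<bar> \<le> (M::real)"
proof -
  have "compact (g ` I)" by (intro compact_continuous_image assms) simp
  then have "bounded (g ` I)" by (rule compact_imp_bounded)
  then obtain M where "\<forall>x\<in>g ` I. norm x \<le> M" unfolding bounded_iff by blast
  then show ?thesis by (intro exI[of _ "max 1 M"]) auto
qed

text \<open>
  The factorial makes the series converge for every \<open>\<mu>\<close>. The induction runs with the sharper bound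
  \<open>K (l (t - \<alpha>))\<^sup>k / k!\<close>, which reproduces itself under integration.
\<close>

lemma iter_bound:
  obtains K L where "K \<ge> 0" "L > 0"
    "\<And>k t. t \<in> I \<Longrightarrow> \<bar>iter A B k t\<bar> \<le> K * (L ^ k / fact k)"
    "\<And>k t. t \<in> I \<Longrightarrow> \<bar>iter1 A B k t\<bar> \<le> K * (L ^ k / fact k)"
proof -
  obtain M1 where b1: "M1 \<ge> 1" "\<forall>t\<in>I. \<bar>u t\<bar> \<le> M1" using bounded_on[OF cont(1)] by blast
  obtain M2 where b2: "M2 \<ge> 1" "\<forall>t\<in>I. \<bar>v t\<bar> \<le> M2" using bounded_on[OF cont(2)] by blast
  obtain M3 where b3: "M3 \<ge> 1" "\<forall>t\<in>I. \<bar>u1 t\<bar> \<le> M3" using bounded_on[OF cont(3)] by blast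
  obtain M4 where b4: "M4 \<ge> 1" "\<forall>t\<in>I. \<bar>v1 t\<bar> \<le> M4" using bounded_on[OF cont(4)] by blast
  obtain E where bE: "E \<ge> 1" "\<forall>t\<in>I. \<bar>e t\<bar> \<le> E" using bounded_on[OF e] by blast
  \<comment> \<open>A common bound for the fundamental system and its derivatives.\<close>
  define M where "M = M1 + M2 + M3 + M4"
  have M: "M > 0" using b1(1) b2(1) b3(1) b4(1) by (simp add: M_def)
  have bM: "\<bar>u t\<bar> \<le> M" "\<bar>v t\<bar> \<le> M" "\<bar>u1 t\<bar> \<le> M" "\<bar>v1 t\<bar> \<le> M" if "t \<in> I" for t
    using b1(1) b2(1) b3(1) b4(1) bspec[OF b1(2) that] bspec[OF b2(2) that] bspec[OF b3(2) that] bspec[OF b4(2) that]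
    by (simp_all add: M_def)
  define l where "l = 2 * M * M * E / \<bar>c\<bar>"
  have l: "l > 0" using M bE(1) c by (simp add: l_def)
  define K where "K = (\<bar>A\<bar> + \<bar>B\<bar>) * M"
  have K: "K \<ge> 0" using M by (simp add: K_def)
  define bnd where "bnd k t = (l * (t - \<alpha>)) ^ k / fact k" for k t
  have bnd_int: "((\<lambda>s. l * bnd k s) has_integral bnd (Suc k) t) {\<alpha>..t}" if "\<alpha> \<le> t" for k t
  proof -
    have "((\<lambda>s. l * bnd k s) has_integral bnd (Suc k) t - bnd (Suc k) \<alpha>) {\<alpha>..t}"
    proof (rule fundamental_theorem_of_calculus[OF that])
      fix s
      have "(bnd (Suc k) has_real_derivative real (Suc k) * (l * (s - \<alpha>)) ^ k * l / fact (Suc k)) (at s within {\<alpha>..t})"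
      proof -
        have "((\<lambda>t. l * (t - \<alpha>)) has_real_derivative l) (at s within {\<alpha>..t})"
          by (auto intro!: derivative_eq_intros)
        then have "((\<lambda>t. (l * (t - \<alpha>)) ^ Suc k) has_real_derivative real (Suc k) * (l * (l * (s - \<alpha>)) ^ k)) (at s within {\<alpha>..t})"
          using DERIV_power[of "\<lambda>t. l * (t - \<alpha>)" l s _ "Suc k"] by (simp del: power_Suc of_nat_Suc)
        from DERIV_cdivide[OF this, of "fact (Suc k)"] show ?thesis
          unfolding bnd_def[abs_def] by (simp add: mult_ac del: power_Suc of_nat_Suc fact_Suc)
      qed
      moreover have "real (Suc k) * (l * (s - \<alpha>)) ^ k * l / fact (Suc k) = l * bnd k s"
        by (simp add: bnd_def fact_Suc del: of_nat_Suc)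
      ultimately show "(bnd (Suc k) has_vector_derivative l * bnd k s) (at s within {\<alpha>..t})"
        by (simp add: has_real_derivative_iff_has_vector_derivative)
    qed
    then show ?thesis by (simp add: bnd_def)
  qed
  have comb: "\<bar>(x * X - y * Y) / c\<bar> \<le> K * z"
    if "\<bar>x\<bar> \<le> M" "\<bar>y\<bar> \<le> M" "\<bar>X\<bar> \<le> M * E * K / l * z" "\<bar>Y\<bar> \<le> M * E * K / l * z" for x y X Y z
  proof -
    have "\<bar>x * X - y * Y\<bar> \<le> \<bar>x\<bar> * \<bar>X\<bar> + \<bar>y\<bar> * \<bar>Y\<bar>"
      by (metis abs_mult abs_triangle_ineq4)
    also have "\<dots> \<le> M * (M * E * K / l * z) + M * (M * E * K / l * z)"
      by (intro add_mono mult_mono that) (use M in auto)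
    also have "\<dots> = \<bar>c\<bar> * (K * z)"
      using l M bE(1) c by (simp add: l_def field_simps)
    finally show ?thesis using c by (simp add: abs_divide divide_le_eq mult.commute)
  qed
  have "\<forall>t\<in>I. \<bar>iter A B k t\<bar> \<le> K * bnd k t \<and> \<bar>iter1 A B k t\<bar> \<le> K * bnd k t" for k
  proof (induction k)
    case 0
    have "\<bar>A * x + B * y\<bar> \<le> K" if "\<bar>x\<bar> \<le> M" "\<bar>y\<bar> \<le> M" for x y
    proof -
      have "\<bar>A * x + B * y\<bar> \<le> \<bar>A\<bar> * \<bar>x\<bar> + \<bar>B\<bar> * \<bar>y\<bar>" by (metis abs_mult abs_triangle_ineq)
      also have "\<dots> \<le> \<bar>A\<bar> * M + \<bar>B\<bar> * M" by (intro add_mono mult_mono that) (use M in auto)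
      finally show ?thesis by (simp add: K_def distrib_right)
    qed
    then show ?case using bM by (simp add: bnd_def)
  next
    case (Suc k)
    show ?case
    proof
      fix t assume t: "t \<in> I"
      have X: "\<bar>integral {\<alpha>..t} (\<lambda>s. w s * e s * iter A B k s)\<bar> \<le> M * E * K / l * bnd (Suc k) t"
        if w: "continuous_on I w" "\<And>s. s \<in> I \<Longrightarrow> \<bar>w s\<bar> \<le> M" for w
      proof -
        have sub: "{\<alpha>..t} \<subseteq> I" using t by auto
        have hi: "((\<lambda>s. M * E * K / l * (l * bnd k s)) has_integral M * E * K / l * bnd (Suc k) t) {\<alpha>..t}"
          by (rule has_integral_mult_right[OF bnd_int]) (use t in auto)
        have "norm (integral {\<alpha>..t} (\<lambda>s. w s * e s * iter A B k s)) \<le> integral {\<alpha>..t} (\<lambda>s. M * E * K / l * (l * bnd k s))"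
        proof (rule integral_norm_bound_integral)
          show "(\<lambda>s. w s * e s * iter A B k s) integrable_on {\<alpha>..t}"
            by (intro integrable_continuous_interval continuous_on_subset[OF _ sub] continuous_intros w(1) e continuous_on_iter)
          show "(\<lambda>s. M * E * K / l * (l * bnd k s)) integrable_on {\<alpha>..t}" using hi by blast
          fix s assume "s \<in> {\<alpha>..t}"
          then have s: "s \<in> I" using sub by blast
          have "\<bar>w s\<bar> * \<bar>e s\<bar> * \<bar>iter A B k s\<bar> \<le> M * E * (K * bnd k s)"
            by (intro mult_mono w(2) bspec[OF bE(2)] s) (use Suc s M bE(1) in auto)
          then show "norm (w s * e s * iter A B k s) \<le> M * E * K / l * (l * bnd k s)"
            using l by (simp add: abs_mult mult.assoc)
        qed
        then show ?thesis using integral_unique[OF hi] by simp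
      qed
      show "\<bar>iter A B (Suc k) t\<bar> \<le> K * bnd (Suc k) t \<and> \<bar>iter1 A B (Suc k) t\<bar> \<le> K * bnd (Suc k) t"
        using comb[OF bM(2,1)[OF t] X[OF cont(1) bM(1)] X[OF cont(2) bM(2)]]
          comb[OF bM(4,3)[OF t] X[OF cont(1) bM(1)] X[OF cont(2) bM(2)]] by simp
    qed
  qed
  moreover have "K * bnd k t \<le> K * ((l * (\<beta> - \<alpha>)) ^ k / fact k)" if "t \<in> I" for k t
    unfolding bnd_def using that l K by (intro mult_left_mono divide_right_mono power_mono) auto
  ultimately show ?thesis
    using that[of K "l * (\<beta> - \<alpha>)"] K l le by (meson diff_gt_0_iff_gt mult_pos_pos order_trans)
qed

text \<open>
  The solution of \<open>y'' = (\<mu> e - p) y\<close> that has the value and the derivative of \<open>A u + B v\<close> at \<open>\<alpha>\<close>.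
\<close>

definition shoot :: "real \<Rightarrow> real \<Rightarrow> real \<Rightarrow> real \<Rightarrow> real" where
  "shoot A B \<mu> t = (\<Sum>k. iter A B k t * \<mu> ^ k)"

text \<open>
  The derivative of \<open>shoot\<close> in \<open>t\<close>.
\<close>

definition shoot1 :: "real \<Rightarrow> real \<Rightarrow> real \<Rightarrow> real \<Rightarrow> real" where
  "shoot1 A B \<mu> t = (\<Sum>k. iter1 A B k t * \<mu> ^ k)"

lemma summable_exp_bound: "summable (\<lambda>k. K * (L ^ k / fact k) * \<bar>\<mu>\<bar> ^ k)" for K L \<mu> :: real
  using summable_mult[OF summable_exp[of "L * \<bar>\<mu>\<bar>"], of K]
  by (simp add: power_mult_distrib divide_inverse mult_ac)

lemma iter_series:
  shows "t \<in> I \<Longrightarrow> summable (\<lambda>k. iter A B k t * \<mu> ^ k)"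
    and "t \<in> I \<Longrightarrow> summable (\<lambda>k. iter1 A B k t * \<mu> ^ k)"
    and "uniform_limit I (\<lambda>n t. \<Sum>k<n. iter1 A B k t * \<mu> ^ k) (\<lambda>t. \<Sum>k. iter1 A B k t * \<mu> ^ k) sequentially"
    and "uniform_limit I (\<lambda>n t. \<Sum>k<n. iter2 A B k t * \<mu> ^ k) (\<lambda>t. \<Sum>k. iter2 A B k t * \<mu> ^ k) sequentially"
    and "t \<in> I \<Longrightarrow> (\<Sum>k. iter2 A B k t * \<mu> ^ k) = (\<mu> * e t - p t) * shoot A B \<mu> t"
proof -
  obtain K L where KL: "K \<ge> 0" "L > 0"
    "\<And>k t. t \<in> I \<Longrightarrow> \<bar>iter A B k t\<bar> \<le> K * (L ^ k / fact k)"
    "\<And>k t. t \<in> I \<Longrightarrow> \<bar>iter1 A B k t\<bar> \<le> K * (L ^ k / fact k)"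
    using iter_bound by blast
  have b: "norm (iter A B k t * \<mu> ^ k) \<le> K * (L ^ k / fact k) * \<bar>\<mu>\<bar> ^ k"
      "norm (iter1 A B k t * \<mu> ^ k) \<le> K * (L ^ k / fact k) * \<bar>\<mu>\<bar> ^ k" if "t \<in> I" for k t
    unfolding real_norm_def abs_mult power_abs
    by (rule mult_right_mono[OF KL(3)[OF that]], simp) (rule mult_right_mono[OF KL(4)[OF that]], simp)
  show s: "summable (\<lambda>k. iter A B k t * \<mu> ^ k)" if "t \<in> I" for t
    by (rule summable_comparison_test'[OF summable_exp_bound b(1)[OF that]])
  show "summable (\<lambda>k. iter1 A B k t * \<mu> ^ k)" if "t \<in> I" for t
    by (rule summable_comparison_test'[OF summable_exp_bound b(2)[OF that]])
  show "uniform_limit I (\<lambda>n t. \<Sum>k<n. iter1 A B k t * \<mu> ^ k) (\<lambda>t. \<Sum>k. iter1 A B k t * \<mu> ^ k) sequentially"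
    by (rule Weierstrass_m_test[OF b(2) summable_exp_bound])
  obtain P where P: "P \<ge> 1" "\<forall>t\<in>I. \<bar>p t\<bar> \<le> P" using bounded_on[OF p] by blast
  obtain E where E: "E \<ge> 1" "\<forall>t\<in>I. \<bar>e t\<bar> \<le> E" using bounded_on[OF e] by blast
  define F where "F k = P * (K * (L ^ k / fact k) * \<bar>\<mu>\<bar> ^ k)
     + (case k of 0 \<Rightarrow> 0 | Suc j \<Rightarrow> E * \<bar>\<mu>\<bar> * (K * (L ^ j / fact j) * \<bar>\<mu>\<bar> ^ j))" for k
  have F: "summable F"
  proof -
    have "summable (\<lambda>k. case Suc k of 0 \<Rightarrow> 0 | Suc j \<Rightarrow> E * \<bar>\<mu>\<bar> * (K * (L ^ j / fact j) * \<bar>\<mu>\<bar> ^ j))"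
      using summable_mult[OF summable_exp_bound] by simp
    then have "summable (\<lambda>k. case k of 0 \<Rightarrow> 0 | Suc j \<Rightarrow> E * \<bar>\<mu>\<bar> * (K * (L ^ j / fact j) * \<bar>\<mu>\<bar> ^ j))"
      by (subst (asm) summable_Suc_iff)
    then show ?thesis unfolding F_def by (intro summable_add summable_mult summable_exp_bound)
  qed
  have "norm (iter2 A B k t * \<mu> ^ k) \<le> F k" if t: "t \<in> I" for k t
  proof -
    have 1: "norm (p t * (iter A B k t * \<mu> ^ k)) \<le> P * (K * (L ^ k / fact k) * \<bar>\<mu>\<bar> ^ k)" for k
      unfolding norm_mult[of "p t"] using b(1)[OF t, of k] P(1) bspec[OF P(2) t]
      by (intro mult_mono) auto
    show ?thesis
    proof (cases k)
      case 0
      then show ?thesis using 1[of 0] by (simp add: F_def)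
    next
      case (Suc j)
      have 2: "norm (e t * \<mu> * (iter A B j t * \<mu> ^ j)) \<le> E * \<bar>\<mu>\<bar> * (K * (L ^ j / fact j) * \<bar>\<mu>\<bar> ^ j)"
        unfolding norm_mult[of "e t * \<mu>"] norm_mult[of "e t"] using b(1)[OF t, of j] E(1) bspec[OF E(2) t]
        by (intro mult_mono) auto
      have "iter2 A B k t * \<mu> ^ k = - (p t * (iter A B k t * \<mu> ^ k)) + e t * \<mu> * (iter A B j t * \<mu> ^ j)"
        by (simp add: Suc algebra_simps del: iter.simps)
      then have "norm (iter2 A B k t * \<mu> ^ k) \<le> norm (p t * (iter A B k t * \<mu> ^ k)) + norm (e t * \<mu> * (iter A B j t * \<mu> ^ j))"
        by (metis norm_minus_cancel norm_triangle_ineq)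
      then show ?thesis using 1[of k] 2 by (simp add: F_def Suc)
    qed
  qed
  then show "uniform_limit I (\<lambda>n t. \<Sum>k<n. iter2 A B k t * \<mu> ^ k) (\<lambda>t. \<Sum>k. iter2 A B k t * \<mu> ^ k) sequentially"
    by (rule Weierstrass_m_test[OF _ F])
  show "(\<Sum>k. iter2 A B k t * \<mu> ^ k) = (\<mu> * e t - p t) * shoot A B \<mu> t" if t: "t \<in> I"
  proof -
    let ?a = "\<lambda>k. iter A B k t * \<mu> ^ k"
    have S: "?a sums shoot A B \<mu> t" unfolding shoot_def by (rule summable_sums[OF s[OF t]])
    have "(\<lambda>k. case Suc k of 0 \<Rightarrow> 0 | Suc j \<Rightarrow> e t * \<mu> * ?a j) sums (e t * \<mu> * shoot A B \<mu> t)"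
      using sums_mult[OF S] by simp
    then have "(\<lambda>k. case k of 0 \<Rightarrow> 0 | Suc j \<Rightarrow> e t * \<mu> * ?a j) sums (e t * \<mu> * shoot A B \<mu> t)"
      by (subst (asm) sums_Suc_iff) simp
    from sums_add[OF sums_mult[OF S, of "- p t"] this]
    have "(\<lambda>k. - p t * ?a k + (case k of 0 \<Rightarrow> 0 | Suc j \<Rightarrow> e t * \<mu> * ?a j)) sums
        (- p t * shoot A B \<mu> t + e t * \<mu> * shoot A B \<mu> t)" .
    moreover have "- p t * ?a k + (case k of 0 \<Rightarrow> 0 | Suc j \<Rightarrow> e t * \<mu> * ?a j) = iter2 A B k t * \<mu> ^ k" for k
      by (cases k) (simp_all add: algebra_simps del: iter.simps)
    ultimately show ?thesis by (simp add: sums_iff algebra_simps)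
  qed
qed

lemma shoot_deriv:
  assumes t: "t \<in> I"
  shows "(shoot A B \<mu> has_real_derivative shoot1 A B \<mu> t) (at t within I)"
    "(shoot1 A B \<mu> has_real_derivative (\<mu> * e t - p t) * shoot A B \<mu> t) (at t within I)"
proof -
  have "\<exists>g. \<forall>x\<in>I. (\<lambda>k. iter A B k x * \<mu> ^ k) sums g x \<and>
      (g has_real_derivative (\<Sum>k. iter1 A B k x * \<mu> ^ k)) (at x within I)"
    by (rule has_field_derivative_series[where S = "I" and f = "\<lambda>k t. iter A B k t * \<mu> ^ k"
          and f' = "\<lambda>k t. iter1 A B k t * \<mu> ^ k" and ?x0.0 = t])
       (auto intro!: DERIV_cmult_right iter_deriv iter_series t simp del: iter.simps iter1.simps atLeastAtMost_iff)
  then obtain g where g: "\<And>x. x \<in> I \<Longrightarrow> (\<lambda>k. iter A B k x * \<mu> ^ k) sums g x"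
    "\<And>x. x \<in> I \<Longrightarrow> (g has_real_derivative shoot1 A B \<mu> x) (at x within I)"
    unfolding shoot1_def by blast
  have eq: "g x = shoot A B \<mu> x" if "x \<in> I" for x using g(1)[OF that] by (simp add: shoot_def sums_iff)
  show "(shoot A B \<mu> has_real_derivative shoot1 A B \<mu> t) (at t within I)"
    by (rule has_field_derivative_transform_within[OF g(2)[OF t] zero_less_one t eq])
  have "\<exists>g. \<forall>x\<in>I. (\<lambda>k. iter1 A B k x * \<mu> ^ k) sums g x \<and>
      (g has_real_derivative (\<Sum>k. iter2 A B k x * \<mu> ^ k)) (at x within I)"
    by (rule has_field_derivative_series[where S = "I" and f = "\<lambda>k t. iter1 A B k t * \<mu> ^ k"
          and f' = "\<lambda>k t. iter2 A B k t * \<mu> ^ k" and ?x0.0 = t])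
       (auto intro!: DERIV_cmult_right iter_deriv iter_series t simp del: iter.simps iter1.simps atLeastAtMost_iff)
  then obtain h where h: "\<And>x. x \<in> I \<Longrightarrow> (\<lambda>k. iter1 A B k x * \<mu> ^ k) sums h x"
    "\<And>x. x \<in> I \<Longrightarrow> (h has_real_derivative (\<Sum>k. iter2 A B k x * \<mu> ^ k)) (at x within I)" by blast
  have eq1: "h x = shoot1 A B \<mu> x" if "x \<in> I" for x using h(1)[OF that] by (simp add: shoot1_def sums_iff)
  show "(shoot1 A B \<mu> has_real_derivative (\<mu> * e t - p t) * shoot A B \<mu> t) (at t within I)"
    using has_field_derivative_transform_within[OF h(2)[OF t] zero_less_one t eq1] unfolding iter_series(5)[OF t] .
qed

lemma shoot_initial: "shoot A B \<mu> \<alpha> = A * u \<alpha> + B * v \<alpha>" "shoot1 A B \<mu> \<alpha> = A * u1 \<alpha> + B * v1 \<alpha>"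
proof -
  have "iter A B k \<alpha> * \<mu> ^ k = (if k = 0 then A * u \<alpha> + B * v \<alpha> else 0)"
    "iter1 A B k \<alpha> * \<mu> ^ k = (if k = 0 then A * u1 \<alpha> + B * v1 \<alpha> else 0)" for k
    by (cases k; simp)+
  moreover have "(\<Sum>k::nat. if k = 0 then x else 0) = x" for x :: real
    using sums_single[of 0 "\<lambda>_. x"] by (simp add: sums_iff)
  ultimately show "shoot A B \<mu> \<alpha> = A * u \<alpha> + B * v \<alpha>" "shoot1 A B \<mu> \<alpha> = A * u1 \<alpha> + B * v1 \<alpha>"
    unfolding shoot_def shoot1_def by simp_all
qed

lemma shoot_0: "shoot A B 0 t = A * u t + B * v t"
  by (simp add: shoot_def powser_zero)

lemma isCont_shoot: "t \<in> I \<Longrightarrow> isCont (\<lambda>\<mu>. shoot A B \<mu> t) \<mu>"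
  unfolding shoot_def by (rule isCont_powser[OF iter_series(1)[of t _ _ "\<bar>\<mu>\<bar> + 1"]]) auto

end

text \<open>
  \<open>W W'\<close> is nondecreasing and starts at \<open>0\<close>, so \<open>W\<^sup>2\<close> is nondecreasing and \<open>W\<close> cannot return to \<open>0\<close>.
\<close>

lemma positive_of_convex:
  fixes W W1 q :: "real \<Rightarrow> real"
  assumes le: "\<alpha> < \<beta>"
    and W: "\<And>t. t \<in> {\<alpha>..\<beta>} \<Longrightarrow> (W has_real_derivative W1 t) (at t within {\<alpha>..\<beta>})"
    and W1: "\<And>t. t \<in> {\<alpha>..\<beta>} \<Longrightarrow> (W1 has_real_derivative q t * W t) (at t within {\<alpha>..\<beta>})"
    and q: "\<And>t. t \<in> {\<alpha>..\<beta>} \<Longrightarrow> q t \<ge> 0" and init: "W \<alpha> = 0" "W1 \<alpha> > 0"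
  shows "W \<beta> > 0"
proof -
  have cW: "continuous_on {\<alpha>..\<beta>} W" and cW1: "continuous_on {\<alpha>..\<beta>} W1"
    by (rule DERIV_continuous_on, erule W W1)+
  have at: "(W has_real_derivative W1 t) (at t)" "(W1 has_real_derivative q t * W t) (at t)" if "\<alpha> < t" "t < \<beta>" for t
    using W[of t] W1[of t] that by (auto simp: at_within_Icc_at)
  have h: "W t * W1 t \<ge> 0" if "t \<in> {\<alpha>..\<beta>}" for t
  proof -
    have "W \<alpha> * W1 \<alpha> \<le> W t * W1 t"
    proof (rule DERIV_nonneg_imp_increasing_open[where f = "\<lambda>t. W t * W1 t"])
      show "continuous_on {\<alpha>..t} (\<lambda>t. W t * W1 t)"
        by (intro continuous_intros continuous_on_subset[OF cW] continuous_on_subset[OF cW1]) (use that in auto)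
      fix x assume x: "\<alpha> < x" "x < t"
      then have "((\<lambda>t. W t * W1 t) has_real_derivative W1 x * W1 x + q x * W x * W x) (at x)"
        using DERIV_mult[OF at, of x] that by simp
      moreover have "W1 x * W1 x + q x * W x * W x \<ge> 0" using q[of x] x that by (simp add: mult.assoc)
      ultimately show "\<exists>y. ((\<lambda>t. W t * W1 t) has_real_derivative y) (at x) \<and> 0 \<le> y" by blast
    qed (use that in auto)
    then show ?thesis using init by simp
  qed
  have mono: "(W s)\<^sup>2 \<le> (W t)\<^sup>2" if "\<alpha> \<le> s" "s \<le> t" "t \<le> \<beta>" for s t
  proof (rule DERIV_nonneg_imp_increasing_open[where f = "\<lambda>t. (W t)\<^sup>2", OF that(2)])
    show "continuous_on {s..t} (\<lambda>t. (W t)\<^sup>2)"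
      by (intro continuous_intros continuous_on_subset[OF cW]) (use that in auto)
    fix x assume x: "s < x" "x < t"
    then have "((\<lambda>t. (W t)\<^sup>2) has_real_derivative 2 * (W x * W1 x)) (at x)"
      using at(1)[of x] that by (auto intro!: derivative_eq_intros)
    then show "\<exists>y. ((\<lambda>t. (W t)\<^sup>2) has_real_derivative y) (at x) \<and> 0 \<le> y"
      using h[of x] x that by force
  qed
  obtain d where d: "d > 0" "\<And>h. h > 0 \<Longrightarrow> \<alpha> + h \<in> {\<alpha>..\<beta>} \<Longrightarrow> h < d \<Longrightarrow> W \<alpha> < W (\<alpha> + h)"
    using has_real_derivative_pos_inc_right[OF W[of \<alpha>] init(2)] le by auto
  define s where "s = \<alpha> + min d (\<beta> - \<alpha>) / 2"
  have s: "\<alpha> < s" "s < \<beta>" "W s > 0"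
    using d(1) le d(2)[of "min d (\<beta> - \<alpha>) / 2"] init by (auto simp: s_def min_def field_simps split: if_splits)
  show ?thesis
  proof (rule ccontr)
    assume "\<not> W \<beta> > 0"
    then have "\<exists>z\<ge>s. z \<le> \<beta> \<and> W z = 0"
      using s by (intro IVT2') (auto intro!: continuous_on_subset[OF cW])
    then obtain z where z: "s \<le> z" "z \<le> \<beta>" "W z = 0" by blast
    have "(W s)\<^sup>2 \<le> (W z)\<^sup>2" by (rule mono) (use s z in auto)
    then show False using s z by simp
  qed
qed

context fundamental_system begin

text \<open>
  For \<open>\<mu> = 0\<close> the solution is \<open>A u + B v\<close>, negative at \<open>\<beta>\<close>; once \<open>\<mu> e \<ge> p\<close>, it is positive at \<open>\<beta>\<close>. An
  intermediate \<open>\<mu>\<close> gives a solution that vanishes at both ends.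
\<close>

lemma exists_dirichlet_mode:
  assumes A: "A * u \<alpha> + B * v \<alpha> = 0" "A * u1 \<alpha> + B * v1 \<alpha> > 0" "A * u \<beta> + B * v \<beta> < 0"
    and e1: "\<And>t. t \<in> I \<Longrightarrow> e t \<ge> 1"
  obtains \<mu> W W1 where "\<mu> > 0"
    "\<And>t. t \<in> I \<Longrightarrow> (W has_real_derivative W1 t) (at t within I)"
    "\<And>t. t \<in> I \<Longrightarrow> (W1 has_real_derivative (\<mu> * e t - p t) * W t) (at t within I)"
    "W \<alpha> = 0" "W \<beta> = 0" "\<exists>t. \<alpha> < t \<and> t < \<beta> \<and> W t \<noteq> 0"
proof -
  obtain P where P: "P \<ge> 1" "\<forall>t\<in>I. \<bar>p t\<bar> \<le> P" using bounded_on[OF p] by blast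
  have q0: "P * e t - p t \<ge> 0" if "t \<in> I" for t
  proof -
    have "p t \<le> P" using bspec[OF P(2) that] by simp
    also have "P \<le> P * e t" using mult_left_mono[OF e1[OF that], of P] P(1) by simp
    finally show ?thesis by simp
  qed
  have "shoot A B P \<beta> > 0"
    by (rule positive_of_convex[OF le shoot_deriv q0]) (simp_all add: shoot_initial A)
  moreover have "shoot A B 0 \<beta> < 0" using A(3) by (simp add: shoot_0)
  moreover have "\<beta> \<in> I" using le by simp
  then have "continuous_on {0..P} (\<lambda>\<mu>. shoot A B \<mu> \<beta>)"
    by (intro continuous_at_imp_continuous_on ballI isCont_shoot)
  ultimately have "\<exists>\<mu>\<ge>0. \<mu> \<le> P \<and> shoot A B \<mu> \<beta> = 0"
    using P(1) by (intro IVT') auto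
  then obtain \<mu> where \<mu>: "\<mu> \<ge> 0" "shoot A B \<mu> \<beta> = 0" by blast
  have "\<mu> \<noteq> 0" using \<mu>(2) \<open>shoot A B 0 \<beta> < 0\<close> by auto
  then have pos: "\<mu> > 0" using \<mu>(1) by simp
  have W1: "shoot1 A B \<mu> \<alpha> > 0" and W: "shoot A B \<mu> \<alpha> = 0" using A by (simp_all add: shoot_initial)
  obtain d where d: "d > 0" "\<And>h. h > 0 \<Longrightarrow> \<alpha> + h \<in> I \<Longrightarrow> h < d \<Longrightarrow> shoot A B \<mu> \<alpha> < shoot A B \<mu> (\<alpha> + h)"
    using has_real_derivative_pos_inc_right[OF shoot_deriv(1)[of \<alpha>] W1] le by auto
  define h where "h = min d (\<beta> - \<alpha>) / 2"
  have h: "h > 0" "h < d" "\<alpha> + h < \<beta>" using d(1) le by (auto simp: h_def min_def field_simps)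
  have "\<alpha> < \<alpha> + h \<and> \<alpha> + h < \<beta> \<and> shoot A B \<mu> (\<alpha> + h) \<noteq> 0"
    using d(2)[of h] h W by simp
  then show ?thesis
    using that[OF pos shoot_deriv W \<mu>(2)] by blast
qed

end

section \<open>Dirichlet eigenvalues of rotation invariant domains\<close>

lemma C2_on_radial:
  assumes W: "\<And>t. \<alpha> < t \<Longrightarrow> t < \<beta> \<Longrightarrow> (W has_real_derivative W1 t) (at t)"
    and W1: "\<And>t. \<alpha> < t \<Longrightarrow> t < \<beta> \<Longrightarrow> (W1 has_real_derivative W2 t) (at t)"
    and W2: "continuous_on {\<alpha><..<\<beta>} W2"
  shows "C2_on (annulus \<alpha> \<beta>) (\<lambda>y :: real^'n::finite. W (ln (norm y)))"
proof -
  let ?S = "annulus \<alpha> \<beta> :: (real^'n) set"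
  have S: "y \<noteq> 0" "\<alpha> < ln (norm y)" "ln (norm y) < \<beta>" if "y \<in> ?S" for y
    using that by (auto simp: annulus_iff)
  have ln: "continuous_on ?S (\<lambda>y. ln (norm y))"
    by (intro continuous_intros) (use S(1) in auto)
  have c: "continuous_on ?S (\<lambda>y. g (ln (norm y)))" if "continuous_on {\<alpha><..<\<beta>} g" for g :: "real \<Rightarrow> real"
    by (rule continuous_on_compose2[OF that ln]) (use S(2,3) in auto)
  have cW1: "continuous_on {\<alpha><..<\<beta>} W1"
    by (intro continuous_at_imp_continuous_on ballI DERIV_isCont) (auto intro: W1)
  have pW: "partial i (\<lambda>y. W (ln (norm y))) y = W1 (ln (norm y)) * (y $ i / (norm y)\<^sup>2)" if "y \<in> ?S" for y i
    by (rule partial_radial[OF W]) (use S[OF that] in auto)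
  have ppW: "partial i (partial j (\<lambda>y. W (ln (norm y)))) y = radial_tensor (W1 (ln (norm y)) / (norm y)\<^sup>2)
          ((W2 (ln (norm y)) - 2 * W1 (ln (norm y))) / (norm y)^4) y i j" if "y \<in> ?S" for y i j
    by (rule partial_partial_radial[OF that W W1]) (use S[OF that] in auto)
  have c1: "continuous_on ?S (partial i (\<lambda>y. W (ln (norm y))))" for i
  proof (rule continuous_on_eq)
    show "continuous_on ?S (\<lambda>y. W1 (ln (norm y)) * (y $ i / (norm y)\<^sup>2))"
      by (intro continuous_intros c cW1) (use S(1) in auto)
  qed (rule pW[symmetric])
  have c2: "continuous_on ?S (partial i (partial j (\<lambda>y. W (ln (norm y)))))" for i j
  proof (rule continuous_on_eq)
    show "continuous_on ?S (\<lambda>y. radial_tensor (W1 (ln (norm y)) / (norm y)\<^sup>2)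
          ((W2 (ln (norm y)) - 2 * W1 (ln (norm y))) / (norm y)^4) y i j)"
      unfolding radial_tensor_def
      by (intro continuous_intros c cW1 W2) (use S(1) in auto)
  qed (rule ppW[symmetric])
  have d1: "(\<lambda>y. W (ln (norm y))) differentiable (at y)" if "y \<in> ?S" for y
    by (rule differentiable_radial[OF W]) (use S[OF that] in auto)
  have d2: "partial j (\<lambda>y. W (ln (norm y))) differentiable (at y)" if "y \<in> ?S" for y j
    by (rule differentiable_partial_radial[OF that W W1]) (use S[OF that] in auto)
  show ?thesis
    unfolding C2_on_def C1_on_def using c1 c2 d1 d2 by blast
qed

context catenary_chart begin

lemma dirichlet_eigenvalue_radial:
  fixes N :: "'n::finite ambient \<Rightarrow> 'n ambient"
  assumes n: "n = real CARD('n)" and sub: "- T \<le> \<alpha>" "\<beta> \<le> T"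
    and N: "unit_normal (catenoid_chart f a) (annulus (- T) T) N"
    and W0: "continuous_on {\<alpha>..\<beta>} W" "W \<alpha> = 0" "W \<beta> = 0" "\<exists>t. \<alpha> < t \<and> t < \<beta> \<and> W t \<noteq> 0"
    and W: "\<And>t. \<alpha> < t \<Longrightarrow> t < \<beta> \<Longrightarrow> (W has_real_derivative W1 t) (at t)"
    and W1: "\<And>t. \<alpha> < t \<Longrightarrow> t < \<beta> \<Longrightarrow> (W1 has_real_derivative W2 t) (at t)"
    and W2: "continuous_on {\<alpha><..<\<beta>} W2"
    and eq: "\<And>t. \<alpha> < t \<Longrightarrow> t < \<beta> \<Longrightarrow>
       - W2 t - (n - 1) * (n * (cosh (f a t) / sinh (f a t))\<^sup>2 - 1) * W t = l * (1 + (f1 t)\<^sup>2) * W t"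
  shows "dirichlet_eigenvalue (catenoid_chart f a) (annulus (- T) T) N (catenoid_domain f a \<alpha> \<beta>) l"
  unfolding dirichlet_eigenvalue_def chart_preimage_domain[OF sub]
proof (intro exI[of _ "\<lambda>p. W (snd p)"] conjI ballI impI)
  let ?\<Omega> = "catenoid_domain f a \<alpha> \<beta> :: 'n ambient set"
  have comp: "(\<lambda>p. W (snd p)) \<circ> catenoid_chart f a = (\<lambda>y :: real^'n. W (ln (norm y)))"
    by (simp add: fun_eq_iff catenoid_chart_def catenoid_param_def)
  obtain t where t: "\<alpha> < t" "t < \<beta>" "W t \<noteq> 0" using W0(4) by blast
  have "catenoid_param f a t (axis undefined 1) \<in> ?\<Omega>"
    unfolding catenoid_domain_def using t by (auto intro!: exI[of _ t] exI[of _ "axis undefined 1"])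
  then show "\<exists>p\<in>?\<Omega>. W (snd p) \<noteq> 0"
    by (rule bexI[rotated]) (simp add: catenoid_param_def t)
  show "continuous_on (closure ?\<Omega>) (\<lambda>p. W (snd p))"
    by (rule continuous_on_compose2[OF W0(1)]) (auto intro!: continuous_intros dest: snd_closure_domain)
  show "W (snd p) = 0" if "p \<in> boundary_in (catenoid_chart f a ` annulus (- T) T) ?\<Omega>" for p
  proof -
    have p: "p \<in> catenoid_domain f a (- T) T" "p \<in> closure ?\<Omega>" "p \<notin> ?\<Omega>"
      using that unfolding boundary_in_def catenoid_chart_image by auto
    then have "snd p \<le> \<alpha> \<or> \<beta> \<le> snd p"
      unfolding catenoid_domain_def by (force simp: catenoid_param_def)
    then have "snd p = \<alpha> \<or> snd p = \<beta>" using snd_closure_domain[OF p(2)] by auto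
    then show ?thesis using W0 by auto
  qed
  show "C2_on (annulus \<alpha> \<beta>) ((\<lambda>p. W (snd p)) \<circ> (catenoid_chart f a :: real^'n \<Rightarrow> _))"
    unfolding comp by (rule C2_on_radial[OF W W1 W2])
  fix y :: "real^'n" assume "y \<in> annulus (- T) T" "catenoid_chart f a y \<in> ?\<Omega>"
  then have y: "y \<in> annulus \<alpha> \<beta>" using chart_preimage_domain[OF sub, of f a] by blast
  define t where "t = ln (norm y)"
  have t: "\<alpha> < t" "t < \<beta>" using y by (auto simp: annulus_iff t_def)
  have E: "1 + (f1 t)\<^sup>2 > 0" by (simp add: add_pos_nonneg)
  have "jacobi_op (catenoid_chart f a) N (\<lambda>y. W (ln (norm y))) y
    = (- W2 t - (n - 1) * (n * (cosh (f a t) / sinh (f a t))\<^sup>2 - 1) * W t) / (1 + (f1 t)\<^sup>2)"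
    unfolding t_def by (rule jacobi_op_radial[OF n y sub N W W1[OF t[unfolded t_def]]])
  also have "\<dots> = l * W t" unfolding eq[OF t] using E by simp
  finally show "jacobi_op (catenoid_chart f a) N ((\<lambda>p. W (snd p)) \<circ> catenoid_chart f a) y = l * W (snd (catenoid_chart f a y))"
    unfolding comp by (simp add: t_def catenoid_chart_def catenoid_param_def)
qed

text \<open>
  The supersolution is \<open>u (c - exp (K t))\<close>: \<open>K\<close> is chosen so large that \<open>2 u' + K u > 0\<close> on the closed
  interval, and \<open>c\<close> so that the factor stays positive.
\<close>

lemma no_dirichlet_kernel_if_positive_solution:
  fixes N :: "'n::finite ambient \<Rightarrow> 'n ambient"
  assumes n: "n = real CARD('n)" and sub: "- T \<le> \<alpha>" "\<alpha> < \<beta>" "\<beta> \<le> T"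
    and N: "unit_normal (catenoid_chart f a) (annulus (- T) T) N"
    and rel: "relatively_compact_domain (catenoid_chart f a ` annulus (- T) T) (catenoid_domain f a \<alpha> \<beta> :: 'n ambient set)"
    and u: "\<And>t. t \<in> {\<alpha>..\<beta>} \<Longrightarrow> (u has_real_derivative u1 t) (at t)"
    and u1: "\<And>t. t \<in> {\<alpha>..\<beta>} \<Longrightarrow> (u1 has_real_derivative
        - ((n - 1) * (n * (cosh (f a t) / sinh (f a t))\<^sup>2 - 1)) * u t) (at t)"
    and pos: "\<And>t. t \<in> {\<alpha>..\<beta>} \<Longrightarrow> u t > 0"
  shows "\<not> dirichlet_eigenvalue (catenoid_chart f a) (annulus (- T) T) N (catenoid_domain f a \<alpha> \<beta>) 0"
proof -
  have cu: "continuous_on {\<alpha>..\<beta>} u" and cu1: "continuous_on {\<alpha>..\<beta>} (\<lambda>t. - u1 t)"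
    by (intro continuous_at_imp_continuous_on ballI DERIV_isCont, erule u)
      (intro continuous_at_imp_continuous_on ballI isCont_minus DERIV_isCont, erule u1)
  have ne: "{\<alpha>..\<beta>} \<noteq> {}" using sub by simp
  \<comment> \<open>The minimum of \<open>u\<close> and of \<open>u1\<close> on the closed interval fix the constant \<open>K\<close>.\<close>
  obtain x where x: "x \<in> {\<alpha>..\<beta>}" "\<forall>y\<in>{\<alpha>..\<beta>}. u x \<le> u y"
    using continuous_attains_inf[OF compact_Icc ne cu] by (rule bexE)
  obtain z where z: "z \<in> {\<alpha>..\<beta>}" "\<forall>y\<in>{\<alpha>..\<beta>}. - u1 y \<le> - u1 z"
    using continuous_attains_sup[OF compact_Icc ne cu1] by (rule bexE)
  define K where "K = (2 * \<bar>u1 z\<bar> + 1) / u x"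
  have ux: "u x > 0" by (rule pos[OF x(1)])
  have K: "K > 0" using ux by (simp add: K_def)
  have key: "2 * u1 t + K * u t > 0" if t: "t \<in> {\<alpha>..\<beta>}" for t
  proof -
    have "2 * \<bar>u1 z\<bar> + 1 = K * u x" using ux by (simp add: K_def)
    also have "\<dots> \<le> K * u t" using bspec[OF x(2) t] K by simp
    finally show ?thesis using bspec[OF z(2) t] by simp
  qed
  define c where "c = exp (K * \<beta>) + 1"
  have g: "c - exp (K * t) > 0" if "t \<le> \<beta>" for t
  proof -
    have "exp (K * t) \<le> exp (K * \<beta>)" using that K by simp
    then show ?thesis unfolding c_def by linarith
  qed
  let ?p = "\<lambda>t. (n - 1) * (n * (cosh (f a t) / sinh (f a t))\<^sup>2 - 1)"
  let ?V = "\<lambda>t. u t * (c - exp (K * t))"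
  let ?V1 = "\<lambda>t. u1 t * (c - exp (K * t)) - u t * (K * exp (K * t))"
  let ?V2 = "\<lambda>t. - ?p t * u t * (c - exp (K * t)) - 2 * u1 t * (K * exp (K * t)) - u t * (K * K * exp (K * t))"
  show ?thesis
  proof (rule no_dirichlet_kernel_if_supersolution[OF n sub(1,3) N rel, where V = ?V and ?V1.0 = ?V1 and ?V2.0 = ?V2])
    show "continuous_on {\<alpha>..\<beta>} ?V" by (intro continuous_intros cu)
    show "?V t > 0" if "\<alpha> \<le> t" "t \<le> \<beta>" for t using pos[of t] g[of t] that by simp
    fix t assume t: "\<alpha> < t" "t < \<beta>"
    then have t': "t \<in> {\<alpha>..\<beta>}" by simp
    show "(?V has_real_derivative ?V1 t) (at t)"
      by (auto intro!: derivative_eq_intros u[OF t'] simp: algebra_simps)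
    define q where "q = ?p t"
    have "(?V1 has_real_derivative (- q * u t) * (c - exp (K * t)) - u1 t * (K * exp (K * t))
         - (u1 t * (K * exp (K * t)) + u t * (K * (K * exp (K * t))))) (at t)"
      by (auto intro!: derivative_eq_intros u[OF t'] u1[OF t', folded q_def] simp: algebra_simps)
    moreover have "(- q * u t) * (c - exp (K * t)) - u1 t * (K * exp (K * t))
         - (u1 t * (K * exp (K * t)) + u t * (K * (K * exp (K * t)))) = ?V2 t"
      unfolding q_def[symmetric] by (simp add: algebra_simps)
    ultimately show "(?V1 has_real_derivative ?V2 t) (at t)" by (simp only:)
    \<comment> \<open>The terms with \<open>p\<close> cancel because \<open>u\<close> solves the equation.\<close>
    have "?V2 t + ?p t * ?V t = - (K * exp (K * t) * (2 * u1 t + K * u t))"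
      unfolding q_def[symmetric] by (simp add: algebra_simps)
    also have "\<dots> < 0" using K key[OF t'] by simp
    finally show "?V2 t + ?p t * ?V t < 0" .
  qed
qed

lemma continuous_on_chart: "continuous_on (annulus (- T) T) (catenoid_chart f a :: real^'n::finite \<Rightarrow> _)"
  by (intro continuous_at_imp_continuous_on ballI has_derivative_continuous[OF has_derivative_chart])

lemma connected_domain:
  assumes "2 \<le> CARD('n::finite)" "- T \<le> \<alpha>" "\<beta> \<le> T"
  shows "connected (catenoid_domain f a \<alpha> \<beta> :: 'n ambient set)"
proof -
  have "annulus \<alpha> \<beta> = {y :: real^'n. exp \<alpha> < norm (y - 0) \<and> norm (y - 0) < exp \<beta>}"
    by (simp add: annulus_def)
  then have "connected (annulus \<alpha> \<beta> :: (real^'n) set)"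
    using connected_annulus(1)[where a = "0 :: real^'n" and ?r1.0 = "exp \<alpha>" and ?r2.0 = "exp \<beta>"] assms(1) by (simp add: norm_minus_commute)
  moreover have "continuous_on (annulus \<alpha> \<beta>) (catenoid_chart f a :: real^'n \<Rightarrow> _)"
    by (rule continuous_on_subset[OF continuous_on_chart]) (use assms in \<open>auto simp: annulus_iff\<close>)
  ultimately show ?thesis
    unfolding catenoid_chart_image[symmetric] by (rule connected_continuous_image[rotated])
qed

end

section \<open>Domains of the catenoid bounded by spheres\<close>

lemma mem_catenoid_domain_iff:
  assumes "- T \<le> \<alpha>" "\<beta> \<le> T"
  shows "p \<in> catenoid_domain f a \<alpha> \<beta> \<longleftrightarrow> p \<in> catenoid_domain f a (- T) T \<and> \<alpha> < snd p \<and> snd p < \<beta>"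
  using assms by (auto simp: catenoid_domain_def catenoid_param_def)

lemma mem_catenoid_sphere_iff:
  assumes "- T < t" "t < T"
  shows "p \<in> catenoid_sphere f a t \<longleftrightarrow> p \<in> catenoid_domain f a (- T) T \<and> snd p = t"
  using assms by (auto simp: catenoid_domain_def catenoid_sphere_def catenoid_param_def)

lemma rotation_invariant_catenoid_domain:
  "rotation_invariant (catenoid_domain f a \<alpha> \<beta> :: 'n::finite ambient set)"
  unfolding rotation_invariant_def
proof (intro allI impI)
  fix R :: "real^'n^'n"
  assume "rotation_matrix R"
  then have R: "orthogonal_matrix R" by (simp add: rotation_matrix_def)
  then have Rt: "orthogonal_matrix (transpose R)" by (simp add: orthogonal_matrix_transpose)
  have RRt: "R ** transpose R = mat 1" using R by (simp add: orthogonal_matrix_def)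
  have inv: "R *v (transpose R *v x) = x" for x
    unfolding matrix_vector_mul_assoc RRt by simp
  have norm: "norm (Q *v x) = norm x" if "orthogonal_matrix Q" for Q :: "real^'n^'n" and x
    using that orthogonal_transformation_matrix[of "(*v) Q"] orthogonal_transformation_norm[of "(*v) Q" x]
    by (simp add: matrix_vector_mul_linear)
  show "(\<lambda>(x, t). (R *v x, t)) ` catenoid_domain f a \<alpha> \<beta> = catenoid_domain f a \<alpha> \<beta>"
  proof (intro set_eqI iffI)
    fix p assume "p \<in> (\<lambda>(x, t). (R *v x, t)) ` catenoid_domain f a \<alpha> \<beta>"
    then obtain t and \<xi> :: "real^'n" where t: "\<alpha> < t" "t < \<beta>" "norm \<xi> = 1"
      and p: "p = (R *v (tanh (f a t / 2) *\<^sub>R \<xi>), t)"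
      by (auto simp: catenoid_domain_def catenoid_param_def)
    have "p = catenoid_param f a t (R *v \<xi>)"
      by (simp add: p catenoid_param_def matrix_vector_mult_scaleR)
    then show "p \<in> catenoid_domain f a \<alpha> \<beta>"
      unfolding catenoid_domain_def using t norm[OF R, of \<xi>] by auto
  next
    fix p :: "'n ambient" assume "p \<in> catenoid_domain f a \<alpha> \<beta>"
    then obtain t and \<xi> :: "real^'n" where t: "\<alpha> < t" "t < \<beta>" "norm \<xi> = 1"
      and p: "p = catenoid_param f a t \<xi>"
      by (auto simp: catenoid_domain_def)
    have "p = (\<lambda>(x, t). (R *v x, t)) (catenoid_param f a t (transpose R *v \<xi>))"
      by (simp add: p catenoid_param_def matrix_vector_mult_scaleR inv del: transpose_matrix_vector)
    moreover have "catenoid_param f a t (transpose R *v \<xi>) \<in> catenoid_domain f a \<alpha> \<beta>"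
      unfolding catenoid_domain_def using t norm[OF Rt, of \<xi>] by auto
    ultimately show "p \<in> (\<lambda>(x, t). (R *v x, t)) ` catenoid_domain f a \<alpha> \<beta>" by blast
  qed
qed

lemma symmetric_catenoid_domain:
  assumes "\<And>t. - \<sigma> < t \<Longrightarrow> t < \<sigma> \<Longrightarrow> f a (- t) = f a t"
  shows "symmetric_set (catenoid_domain f a (- \<sigma>) \<sigma> :: 'n::finite ambient set)"
  unfolding symmetric_set_def
proof -
  have sub: "(\<lambda>(x, t). (x, - t)) p \<in> catenoid_domain f a (- \<sigma>) \<sigma>" if pD: "p \<in> catenoid_domain f a (- \<sigma>) \<sigma>" for p :: "'n ambient"
  proof -
    obtain t and \<xi> :: "real^'n" where t: "- \<sigma> < t" "t < \<sigma>" "\<xi> \<in> sphere 0 1" and p: "p = catenoid_param f a t \<xi>"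
      using pD unfolding catenoid_domain_def by blast
    have "(\<lambda>(x, t). (x, - t)) p = catenoid_param f a (- t) \<xi>"
      using assms[OF t(1,2)] by (simp add: p catenoid_param_def)
    moreover have "- \<sigma> < - t" "- t < \<sigma>" using t by auto
    ultimately show ?thesis unfolding catenoid_domain_def using t(3) by blast
  qed
  show "(\<lambda>(x, t). (x, - t)) ` catenoid_domain f a (- \<sigma>) \<sigma> = (catenoid_domain f a (- \<sigma>) \<sigma> :: 'n ambient set)"
  proof (intro set_eqI iffI)
    fix p :: "'n ambient" assume "p \<in> catenoid_domain f a (- \<sigma>) \<sigma>"
    then have "(\<lambda>(x, t). (x, - t)) p \<in> catenoid_domain f a (- \<sigma>) \<sigma>" by (rule sub)
    moreover have "p = (\<lambda>(x, t). (x, - t)) ((\<lambda>(x, t). (x, - t)) p)" by (cases p) simp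
    ultimately show "p \<in> (\<lambda>(x, t). (x, - t)) ` catenoid_domain f a (- \<sigma>) \<sigma>" by blast
  qed (use sub in auto)
qed

context catenary_chart begin

lemma boundary_catenoid_domain:
  assumes \<sigma>: "0 < \<sigma>" "\<sigma> < T"
  shows "boundary_in (catenoid_domain f a (- T) T) (catenoid_domain f a (- \<sigma>) \<sigma> :: 'n::finite ambient set)
    = catenoid_sphere f a (- \<sigma>) \<union> catenoid_sphere f a \<sigma>" (is "boundary_in ?M ?D = ?S")
proof (intro set_eqI iffI)
  fix p :: "'n ambient" assume "p \<in> boundary_in ?M ?D"
  then have p: "p \<in> ?M" "p \<in> closure ?D" "p \<notin> ?D" by (auto simp: boundary_in_def)
  have "- \<sigma> \<le> snd p" "snd p \<le> \<sigma>" using snd_closure_domain[OF p(2)] by auto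
  moreover have "\<not> (- \<sigma> < snd p \<and> snd p < \<sigma>)"
    using p(1,3) mem_catenoid_domain_iff[of T "- \<sigma>" \<sigma> p f a] \<sigma> by auto
  ultimately have "snd p = - \<sigma> \<or> snd p = \<sigma>" by auto
  then show "p \<in> ?S"
    using p(1) mem_catenoid_sphere_iff[of T "- \<sigma>" p f a] mem_catenoid_sphere_iff[of T \<sigma> p f a] \<sigma> by auto
next
  fix p :: "'n ambient" assume "p \<in> ?S"
  then obtain t and \<xi> :: "real^'n" where t: "t = - \<sigma> \<or> t = \<sigma>" and \<xi>: "\<xi> \<in> sphere 0 1" and p: "p = catenoid_param f a t \<xi>"
    unfolding catenoid_sphere_def by blast
  \<comment> \<open>The meridian through \<open>p\<close> approaches it from inside the domain.\<close>
  have "continuous_on {- \<sigma>..\<sigma>} (\<lambda>t. catenoid_param f a t \<xi>)"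
  proof -
    have "continuous_on {- \<sigma>..\<sigma>} (f a)"
      by (intro continuous_at_imp_continuous_on ballI DERIV_isCont[OF f_deriv]) (use \<sigma> in auto)
    then show ?thesis
      unfolding catenoid_param_def by (intro continuous_intros) auto
  qed
  then have "continuous_on (closure {- \<sigma><..<\<sigma>}) (\<lambda>t. catenoid_param f a t \<xi>)"
    using \<sigma> by simp
  moreover have "(\<lambda>t. catenoid_param f a t \<xi>) ` {- \<sigma><..<\<sigma>} \<subseteq> closure ?D"
  proof (rule subset_trans[OF image_subsetI closure_subset])
    show "catenoid_param f a s \<xi> \<in> ?D" if "s \<in> {- \<sigma><..<\<sigma>}" for s
      unfolding catenoid_domain_def using that \<xi> by auto
  qed
  ultimately have "(\<lambda>t. catenoid_param f a t \<xi>) ` closure {- \<sigma><..<\<sigma>} \<subseteq> closure ?D"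
    by (rule image_closure_subset[OF _ closed_closure])
  moreover have "t \<in> closure {- \<sigma><..<\<sigma>}" using t \<sigma> by auto
  ultimately have "p \<in> closure ?D" unfolding p by blast
  moreover have "p \<in> ?M" using t \<sigma> \<xi> unfolding p catenoid_domain_def by force
  moreover have "p \<notin> ?D" using t unfolding p catenoid_domain_def by (auto simp: catenoid_param_def)
  ultimately show "p \<in> boundary_in ?M ?D" by (simp add: boundary_in_def)
qed

text \<open>
  A relatively open set whose relative boundary misses a connected subdomain is open and closed in that
  subdomain.
\<close>

lemma domain_subset_if_meets:
  fixes \<Omega> :: "'n::finite ambient set"
  assumes card: "2 \<le> CARD('n)" and sub: "- T \<le> \<alpha>" "\<beta> \<le> T"
    and op: "openin (top_of_set (catenoid_domain f a (- T) T)) \<Omega>"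
    and bd: "boundary_in (catenoid_domain f a (- T) T) \<Omega> \<inter> catenoid_domain f a \<alpha> \<beta> = {}"
    and meets: "\<Omega> \<inter> catenoid_domain f a \<alpha> \<beta> \<noteq> {}"
  shows "catenoid_domain f a \<alpha> \<beta> \<subseteq> \<Omega>"
proof -
  let ?M = "catenoid_domain f a (- T) T :: 'n ambient set" and ?A = "catenoid_domain f a \<alpha> \<beta> :: 'n ambient set"
  have AM: "?A \<subseteq> ?M" using mem_catenoid_domain_iff[OF sub] by blast
  obtain U where U: "open U" "\<Omega> = ?M \<inter> U" using op by (auto simp: openin_open)
  have "?A \<inter> \<Omega> = ?A \<inter> U" using U AM by blast
  then have o: "openin (top_of_set ?A) (?A \<inter> \<Omega>)" using U(1) by (auto simp: openin_open)
  have "?A \<inter> closure \<Omega> \<subseteq> \<Omega>" using bd AM unfolding boundary_in_def by blast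
  then have "?A \<inter> \<Omega> = ?A \<inter> closure \<Omega>" using closure_subset[of \<Omega>] by blast
  then have "closedin (top_of_set ?A) (?A \<inter> \<Omega>)" by (auto simp: closedin_closed)
  then have "?A \<inter> \<Omega> = {} \<or> ?A \<inter> \<Omega> = ?A"
    using connected_domain[OF card sub] o unfolding connected_clopen by blast
  then show ?thesis using meets by blast
qed

text \<open>
  Off the two spheres the catenoid falls into three connected subdomains, separated by height. The set is the
  union of those that it meets, and neither end can belong to it, for its heights form a relatively compact
  subset of \<open>]-T, T[\<close>.
\<close>

lemma domain_eq_if_boundary_spheres:
  fixes \<Omega> :: "'n::finite ambient set"
  assumes card: "2 \<le> CARD('n)" and \<sigma>: "0 < \<sigma>" "\<sigma> < T"
    and rel: "relatively_compact_domain (catenoid_domain f a (- T) T) \<Omega>"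
    and bd: "boundary_in (catenoid_domain f a (- T) T) \<Omega> = catenoid_sphere f a (- \<sigma>) \<union> catenoid_sphere f a \<sigma>"
  shows "\<Omega> = catenoid_domain f a (- \<sigma>) \<sigma>"
proof -
  let ?M = "catenoid_domain f a (- T) T :: 'n ambient set"
  have \<Omega>: "\<Omega> \<noteq> {}" "openin (top_of_set ?M) \<Omega>" "connected \<Omega>" "compact (closure \<Omega>)" "closure \<Omega> \<subseteq> ?M"
    using rel by (auto simp: relatively_compact_domain_def)
  have \<Omega>M: "\<Omega> \<subseteq> ?M" using \<Omega>(5) closure_subset[of \<Omega>] by blast
  have snd_bd: "snd p = - \<sigma> \<or> snd p = \<sigma>" if "p \<in> boundary_in ?M \<Omega>" for p
    using that unfolding bd catenoid_sphere_def catenoid_param_def by auto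
  have off: "snd p \<noteq> - \<sigma> \<and> snd p \<noteq> \<sigma>" if "p \<in> \<Omega>" for p
  proof -
    have "p \<notin> boundary_in ?M \<Omega>" using that by (simp add: boundary_in_def)
    then show ?thesis
      using that \<Omega>M \<sigma> mem_catenoid_sphere_iff[of T "- \<sigma>" p f a] mem_catenoid_sphere_iff[of T \<sigma> p f a]
      unfolding bd by auto
  qed
  have disj: "boundary_in ?M \<Omega> \<inter> catenoid_domain f a \<alpha> \<beta> = {}" if "\<sigma> \<le> \<alpha> \<or> \<beta> \<le> - \<sigma> \<or> (\<alpha> = - \<sigma> \<and> \<beta> = \<sigma>)" for \<alpha> \<beta>
    using snd_bd that \<sigma> by (fastforce simp: catenoid_domain_def catenoid_param_def)
  have cs: "compact (snd ` closure \<Omega>)" by (intro compact_continuous_image continuous_intros \<Omega>(4))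
  have range: "- T < t \<and> t < T" if "t \<in> snd ` closure \<Omega>" for t
    using that \<Omega>(5) by (auto simp: catenoid_domain_def catenoid_param_def)
  have no_end: False if "\<alpha> < \<beta>" "{\<alpha><..<\<beta>} \<subseteq> {- T<..<T}" "\<alpha> = - T \<or> \<beta> = T"
      "catenoid_domain f a \<alpha> \<beta> \<subseteq> \<Omega>" for \<alpha> \<beta>
  proof -
    have "{\<alpha><..<\<beta>} \<subseteq> snd ` closure \<Omega>"
    proof
      fix t assume t: "t \<in> {\<alpha><..<\<beta>}"
      have "catenoid_param f a t (axis undefined 1 :: real^'n) \<in> catenoid_domain f a \<alpha> \<beta>"
        unfolding catenoid_domain_def using t by (auto intro!: exI[of _ t] exI[of _ "axis undefined 1"])
      then have "catenoid_param f a t (axis undefined 1 :: real^'n) \<in> closure \<Omega>"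
        using that(4) closure_subset[of \<Omega>] by blast
      from imageI[OF this, of snd] show "t \<in> snd ` closure \<Omega>" by (simp add: catenoid_param_def)
    qed
    then have "closure {\<alpha><..<\<beta>} \<subseteq> snd ` closure \<Omega>"
      by (rule closure_minimal) (rule compact_imp_closed[OF cs])
    then have ends: "\<alpha> \<in> snd ` closure \<Omega>" "\<beta> \<in> snd ` closure \<Omega>" using that(1) by auto
    show False using range[OF ends(1)] range[OF ends(2)] that(3) by auto
  qed
  let ?A = "catenoid_domain f a (- \<sigma>) \<sigma> :: 'n ambient set"
  have "\<Omega> \<inter> ?A \<noteq> {}"
  proof
    assume empty: "\<Omega> \<inter> ?A = {}"
    obtain p where p: "p \<in> \<Omega>" using \<Omega>(1) by blast
    have "p \<in> ?M" using p \<Omega>M by blast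
    moreover have "\<not> (- \<sigma> < snd p \<and> snd p < \<sigma>)"
      using empty p \<open>p \<in> ?M\<close> mem_catenoid_domain_iff[of T "- \<sigma>" \<sigma> p f a] \<sigma> by auto
    ultimately consider "p \<in> catenoid_domain f a (- T) (- \<sigma>)" | "p \<in> catenoid_domain f a \<sigma> T"
      using off[OF p] mem_catenoid_domain_iff[of T "- T" "- \<sigma>" p f a] mem_catenoid_domain_iff[of T \<sigma> T p f a] \<sigma>
      by (force simp: catenoid_domain_def catenoid_param_def)
    then show False
    proof cases
      case 1
      have "catenoid_domain f a (- T) (- \<sigma>) \<subseteq> \<Omega>"
        by (rule domain_subset_if_meets[OF card _ _ \<Omega>(2) disj]) (use 1 p \<sigma> in auto)
      moreover have "{- T<..<- \<sigma>} \<subseteq> {- T<..<T}" by (rule subsetI) (use \<sigma> in simp)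
      ultimately show False using no_end[of "- T" "- \<sigma>"] \<sigma> by simp
    next
      case 2
      have "catenoid_domain f a \<sigma> T \<subseteq> \<Omega>"
        by (rule domain_subset_if_meets[OF card _ _ \<Omega>(2) disj]) (use 2 p \<sigma> in auto)
      moreover have "{\<sigma><..<T} \<subseteq> {- T<..<T}" by (rule subsetI) (use \<sigma> in simp)
      ultimately show False using no_end[of "\<sigma>" "T"] \<sigma> by simp
    qed
  qed
  then have A\<Omega>: "?A \<subseteq> \<Omega>"
    by (intro domain_subset_if_meets[OF card _ _ \<Omega>(2) disj]) (use \<sigma> in auto)
  have "\<Omega> \<inter> {p. - \<sigma> < snd p \<and> snd p < \<sigma>} = \<Omega> \<inter> {p. - \<sigma> \<le> snd p \<and> snd p \<le> \<sigma>}"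
    using off by force
  moreover have "open {p :: 'n ambient. - \<sigma> < snd p \<and> snd p < \<sigma>}"
    by (intro open_Collect_conj open_Collect_less continuous_intros)
  moreover have "closed {p :: 'n ambient. - \<sigma> \<le> snd p \<and> snd p \<le> \<sigma>}"
    by (intro closed_Collect_conj closed_Collect_le continuous_intros)
  ultimately have "openin (top_of_set \<Omega>) (\<Omega> \<inter> {p. - \<sigma> < snd p \<and> snd p < \<sigma>})"
    "closedin (top_of_set \<Omega>) (\<Omega> \<inter> {p. - \<sigma> < snd p \<and> snd p < \<sigma>})"
    by (auto simp: openin_open closedin_closed)
  then have "\<Omega> \<inter> {p. - \<sigma> < snd p \<and> snd p < \<sigma>} = {} \<or> \<Omega> \<inter> {p. - \<sigma> < snd p \<and> snd p < \<sigma>} = \<Omega>"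
    using \<Omega>(3) unfolding connected_clopen by blast
  moreover have "\<Omega> \<inter> {p. - \<sigma> < snd p \<and> snd p < \<sigma>} = ?A"
    using A\<Omega> \<Omega>M mem_catenoid_domain_iff[of T "- \<sigma>" \<sigma> _ f a] \<sigma> by auto
  ultimately show ?thesis using \<open>\<Omega> \<inter> ?A \<noteq> {}\<close> by blast
qed

end

section \<open>Stability and the envelope\<close>

lemma catenary_chart_maximal_solution:
  assumes sol: "maximal_catenary_solution n a {- T<..<T} (f a)" and n: "n \<ge> 2" and a: "a > 0" and T: "T > 0"
  shows "catenary_chart f a T (\<lambda>t. tan (angle (real n - 1) a t)) (real n)"
proof
  define m where "m = real n - 1"
  have m: "m > 0" using n by (simp add: m_def)
  have T': "T = top_height m a" and fp: "\<And>t. - T < t \<Longrightarrow> t < T \<Longrightarrow> f a t = profile m a t"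
    using maximal_catenary_solution_eq_profile[OF sol n a T] unfolding m_def by auto
  fix t assume t: "- T < t" "t < T"
  then have t': "- top_height m a < t" "t < top_height m a" by (auto simp: T')
  show "f a t > 0" using profile_props(1)[OF m a t'] fp[OF t] by simp
  show "(f a has_real_derivative tan (angle (real n - 1) a t)) (at t)"
    unfolding m_def[symmetric]
    by (rule has_field_derivative_transform_within_open[OF profile_deriv(1)[OF m a t'], of "{- T<..<T}"])
      (use t fp in auto)
  show "((\<lambda>t. tan (angle (real n - 1) a t)) has_real_derivative
      (real n - 1) * (cosh (f a t) / sinh (f a t)) * (1 + (tan (angle (real n - 1) a t))\<^sup>2)) (at t)"
    using profile_deriv(3)[OF m a t'] unfolding fp[OF t] m_def .
qed

text \<open>
  A positive value at \<open>\<sigma>\<close> would exclude the eigenvalue \<open>0\<close>, and a negative one would produce a negative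
  eigenvalue.
\<close>

lemma even_field_zero_at_stability_bound:
  fixes N :: "'n::finite ambient \<Rightarrow> 'n ambient"
  assumes card: "CARD('n) \<ge> 2" and a: "a > 0"
    and sol: "maximal_catenary_solution CARD('n) a {- T<..<T} (f a)" and T: "T > 0"
    and N: "unit_normal (catenoid_chart f a) (annulus (- T) T) N"
    and \<sigma>: "0 < \<sigma>" "\<sigma> < T"
    and su: "stable_unstable (catenoid_chart f a) (annulus (- T) T) N (catenoid_domain f a (- \<sigma>) \<sigma>)"
  shows "even_field (real CARD('n) - 1) a \<sigma> = 0"
proof -
  define m where "m = real CARD('n) - 1"
  have m: "m > 0" using card by (simp add: m_def)
  have T': "T = top_height m a" and fp: "\<And>t. - T < t \<Longrightarrow> t < T \<Longrightarrow> f a t = profile m a t"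
    using maximal_catenary_solution_eq_profile[OF sol card a T] unfolding m_def by auto
  have tt: "- top_height m a < t" "t < top_height m a" if "- T < t" "t < T" for t
    using that unfolding T' by auto
  define f1 where "f1 t = tan (angle m a t)" for t
  interpret catenary_chart f a T f1 "real CARD('n)"
    using catenary_chart_maximal_solution[of "CARD('n)" a T f, OF sol card a T] unfolding f1_def[abs_def] m_def .
  have pot: "(real CARD('n) - 1) * (real CARD('n) * (cosh (f a t) / sinh (f a t))\<^sup>2 - 1)
      = jacobi_potential m (profile m a t)" if "- T < t" "t < T" for t
    unfolding fp[OF that] jacobi_potential_def by (simp add: m_def)
  have sub: "- T \<le> - \<sigma>" "- \<sigma> < \<sigma>" "\<sigma> \<le> T" using \<sigma> by auto
  have in_T: "- T < t" "t < T" if "t \<in> {- \<sigma>..\<sigma>}" for t using that \<sigma> by auto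
  have in_top: "- top_height m a < t" "t < top_height m a" if "t \<in> {- \<sigma>..\<sigma>}" for t
    using tt[OF in_T[OF that]] .
  have v: "odd_field m a \<sigma> > 0"
    by (rule odd_field_pos[OF m a in_top]) (use \<sigma> in auto)
  have rel: "relatively_compact_domain (catenoid_chart f a ` annulus (- T) T) (catenoid_domain f a (- \<sigma>) \<sigma> :: 'n ambient set)"
    and zero: "dirichlet_eigenvalue (catenoid_chart f a) (annulus (- T) T) N (catenoid_domain f a (- \<sigma>) \<sigma>) 0"
    and low: "\<And>l. dirichlet_eigenvalue (catenoid_chart f a) (annulus (- T) T) N (catenoid_domain f a (- \<sigma>) \<sigma>) l \<Longrightarrow> 0 \<le> l"
    using su unfolding stable_unstable_def by auto
  have "\<not> even_field m a \<sigma> > 0"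
  proof
    assume pos: "even_field m a \<sigma> > 0"
    have pos': "even_field m a t > 0" if t: "0 \<le> t" "t \<le> \<sigma>" for t
    proof -
      consider "t = 0" | "t = \<sigma>" | "0 < t" "t < \<sigma>" using t by linarith
      then show ?thesis
      proof cases
        case 1
        then show ?thesis by (simp add: even_field_0[OF m a])
      next
        case 2
        then show ?thesis using pos by simp
      next
        case 3
        have "0 < even_field m a \<sigma> / odd_field m a \<sigma>" using pos v by simp
        also have "\<dots> < even_field m a t / odd_field m a t"
          by (rule field_quotient_decreasing[OF m a 3]) (use \<sigma> in \<open>simp add: T'\<close>)
        finally have "0 < even_field m a t / odd_field m a t" .
        moreover have "odd_field m a t > 0"
          by (rule odd_field_pos[OF m a in_top]) (use 3 in auto)
        ultimately show ?thesis by (simp add: zero_less_divide_iff)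
      qed
    qed
    have "\<not> dirichlet_eigenvalue (catenoid_chart f a) (annulus (- T) T) N (catenoid_domain f a (- \<sigma>) \<sigma>) 0"
    proof (rule no_dirichlet_kernel_if_positive_solution[OF refl sub N rel])
      fix t assume t: "t \<in> {- \<sigma>..\<sigma>}"
      show "(even_field m a has_real_derivative even_field1 m a t) (at t)"
        by (rule even_field_deriv(1)[OF m a in_top[OF t]])
      show "(even_field1 m a has_real_derivative
          - ((real CARD('n) - 1) * (real CARD('n) * (cosh (f a t) / sinh (f a t))\<^sup>2 - 1)) * even_field m a t) (at t)"
        unfolding pot[OF in_T[OF t]] by (rule even_field_deriv(2)[OF m a in_top[OF t]])
      show "even_field m a t > 0"
      proof (cases "0 \<le> t")
        case True
        then show ?thesis using pos' t by simp
      next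
        case False
        then show ?thesis using pos'[of "- t"] t even_field_even[OF m a in_top[OF t]] by simp
      qed
    qed
    then show False using zero by blast
  qed
  moreover have "\<not> even_field m a \<sigma> < 0"
  proof
    assume neg: "even_field m a \<sigma> < 0"
    have \<sigma>t: "\<sigma> \<in> {- \<sigma>..\<sigma>}" "- \<sigma> \<in> {- \<sigma>..\<sigma>}" using \<sigma> by auto
    have cp: "continuous_on {- \<sigma>..\<sigma>} (profile m a)"
      by (intro continuous_at_imp_continuous_on ballI DERIV_isCont[OF profile_deriv(1)[OF m a in_top]])
    have cf1: "continuous_on {- \<sigma>..\<sigma>} f1"
      by (intro continuous_at_imp_continuous_on ballI DERIV_isCont[OF f1_deriv[OF in_T]])
    have ppos: "profile m a t > 0" if "t \<in> {- \<sigma>..\<sigma>}" for t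
      by (rule profile_props(1)[OF m a in_top[OF that]])
    interpret fs: fundamental_system "- \<sigma>" \<sigma> "even_field m a" "even_field1 m a" "odd_field m a" "odd_field1 m a"
      "\<lambda>t. jacobi_potential m (profile m a t)" "\<lambda>t. 1 + (f1 t)\<^sup>2" "m * (cosh a / sinh a)"
    proof
      show "continuous_on {- \<sigma>..\<sigma>} (\<lambda>t. jacobi_potential m (profile m a t))"
        unfolding jacobi_potential_def
        by (intro continuous_intros cp) (use ppos in force)
      show "continuous_on {- \<sigma>..\<sigma>} (\<lambda>t. 1 + (f1 t)\<^sup>2)" by (intro continuous_intros cf1)
      show "m * (cosh a / sinh a) \<noteq> 0" using m a by simp
      fix t assume t: "t \<in> {- \<sigma>..\<sigma>}"
      note t' = in_top[OF t]
      show "(even_field m a has_real_derivative even_field1 m a t) (at t within {- \<sigma>..\<sigma>})"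
        by (rule has_field_derivative_at_within[OF even_field_deriv(1)[OF m a t']])
      show "(even_field1 m a has_real_derivative - jacobi_potential m (profile m a t) * even_field m a t) (at t within {- \<sigma>..\<sigma>})"
        by (rule has_field_derivative_at_within[OF even_field_deriv(2)[OF m a t']])
      show "(odd_field m a has_real_derivative odd_field1 m a t) (at t within {- \<sigma>..\<sigma>})"
        by (rule has_field_derivative_at_within[OF odd_field_deriv(1)[OF m a t']])
      show "(odd_field1 m a has_real_derivative - jacobi_potential m (profile m a t) * odd_field m a t) (at t within {- \<sigma>..\<sigma>})"
        by (rule has_field_derivative_at_within[OF odd_field_deriv(2)[OF m a t']])
      show "even_field m a t * odd_field1 m a t - even_field1 m a t * odd_field m a t = m * (cosh a / sinh a)"
        by (rule wronskian[OF m a t'])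
    qed (use \<sigma> in simp)
    have evn: "even_field m a (- \<sigma>) = even_field m a \<sigma>" by (rule even_field_even[OF m a in_top[OF \<sigma>t(1)]])
    have odd: "odd_field m a (- \<sigma>) = - odd_field m a \<sigma>" by (rule odd_field_odd[OF m a in_top[OF \<sigma>t(1)]])
    \<comment> \<open>The combination of the two fields that vanishes at the left end has slope equal to the Wronskian there.\<close>
  have i1: "odd_field m a \<sigma> * even_field m a (- \<sigma>) + even_field m a \<sigma> * odd_field m a (- \<sigma>) = 0"
      by (simp add: evn odd)
    have "odd_field m a \<sigma> * even_field1 m a (- \<sigma>) + even_field m a \<sigma> * odd_field1 m a (- \<sigma>) = m * (cosh a / sinh a)"
      using wronskian[OF m a in_top[OF \<sigma>t(2)]] by (simp add: evn odd algebra_simps)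
    then have i2: "odd_field m a \<sigma> * even_field1 m a (- \<sigma>) + even_field m a \<sigma> * odd_field1 m a (- \<sigma>) > 0"
      using m a by simp
    have i3: "odd_field m a \<sigma> * even_field m a \<sigma> + even_field m a \<sigma> * odd_field m a \<sigma> < 0"
      using mult_pos_neg[OF v neg] by (simp add: mult.commute)
    obtain \<mu> W W1 where \<mu>: "\<mu> > 0"
      and W: "\<And>t. t \<in> {- \<sigma>..\<sigma>} \<Longrightarrow> (W has_real_derivative W1 t) (at t within {- \<sigma>..\<sigma>})"
      and W1: "\<And>t. t \<in> {- \<sigma>..\<sigma>} \<Longrightarrow> (W1 has_real_derivative
            (\<mu> * (1 + (f1 t)\<^sup>2) - jacobi_potential m (profile m a t)) * W t) (at t within {- \<sigma>..\<sigma>})"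
      and Wb: "W (- \<sigma>) = 0" "W \<sigma> = 0" "\<exists>t. - \<sigma> < t \<and> t < \<sigma> \<and> W t \<noteq> 0"
      by (rule fs.exists_dirichlet_mode[OF i1 i2 i3]) auto
    let ?W2 = "\<lambda>t. (\<mu> * (1 + (f1 t)\<^sup>2) - jacobi_potential m (profile m a t)) * W t"
    have cW: "continuous_on {- \<sigma>..\<sigma>} W" by (rule DERIV_continuous_on) (rule W)
    have "dirichlet_eigenvalue (catenoid_chart f a) (annulus (- T) T) N (catenoid_domain f a (- \<sigma>) \<sigma>) (- \<mu>)"
    proof (rule dirichlet_eigenvalue_radial[OF refl sub(1,3) N cW Wb, where ?W1.0 = W1 and ?W2.0 = ?W2])
      show "continuous_on {- \<sigma><..<\<sigma>} ?W2"
        by (rule continuous_on_subset[of "{- \<sigma>..\<sigma>}"]) (auto intro!: continuous_intros cW fs.p cf1)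
      fix t assume t: "- \<sigma> < t" "t < \<sigma>"
      then show "(W has_real_derivative W1 t) (at t)" "(W1 has_real_derivative ?W2 t) (at t)"
        using W[of t] W1[of t] by (auto simp: at_within_Icc_at)
      have "- T < t" "t < T" using t \<sigma> by auto
      from pot[OF this] show "- ?W2 t - (real CARD('n) - 1) * (real CARD('n) * (cosh (f a t) / sinh (f a t))\<^sup>2 - 1) * W t
          = - \<mu> * (1 + (f1 t)\<^sup>2) * W t"
        by (simp only:) (simp add: algebra_simps)
    qed
    from low[OF this] show False using \<mu> by simp
  qed
  ultimately show ?thesis by (simp add: m_def)
qed

theorem corollary3p7:
  fixes f :: "real \<Rightarrow> real \<Rightarrow> real" and T :: "real \<Rightarrow> real" and a \<sigma> :: real
    and N :: "'n::finite ambient \<Rightarrow> 'n ambient"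
  assumes n: "CARD('n) \<ge> 2"
    and f: "\<And>b. b > 0 \<Longrightarrow> T b > 0 \<and>
              maximal_catenary_solution CARD('n) b {- T b<..<T b} (f b)"
    and a: "a > 0"
    and N: "unit_normal (catenoid_chart f a) (annulus (- T a) (T a)) N"
    and \<sigma>: "0 < \<sigma>" "\<sigma> < T a"
    and stable_unstable: "stable_unstable (catenoid_chart f a) (annulus (- T a) (T a)) N
              (catenoid_domain f a (- \<sigma>) \<sigma>)"
  shows "envelope_heights f T a = {- \<sigma>, \<sigma>} \<and>
    (\<forall>\<Omega> :: 'n ambient set.
       \<Omega> = catenoid_domain f a (- \<sigma>) \<sigma> \<longleftrightarrow>
       symmetric_set \<Omega> \<and> rotation_invariant \<Omega> \<and>
       relatively_compact_domain (catenoid f T a) \<Omega> \<and>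
       boundary_in (catenoid f T a) \<Omega> =
         (\<Union>t\<in>envelope_heights f T a. catenoid_sphere f a t))"
proof -
  define m where "m = real CARD('n) - 1"
  have m: "m > 0" using n by (simp add: m_def)
  have Ta: "T a > 0" and sol: "maximal_catenary_solution CARD('n) a {- T a<..<T a} (f a)"
    using f[OF a] by auto
  have T': "T a = top_height m a" and fp: "\<And>t. - T a < t \<Longrightarrow> t < T a \<Longrightarrow> f a t = profile m a t"
    using maximal_catenary_solution_eq_profile[OF sol n a Ta] unfolding m_def by auto
  have zero: "even_field m a \<sigma> = 0"
    unfolding m_def by (rule even_field_zero_at_stability_bound[OF n a sol Ta N \<sigma> stable_unstable])
  have pos_zero: "even_field m a t = 0 \<longleftrightarrow> t = \<sigma>" if t: "0 < t" "t < T a" for t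
  proof
    assume z: "even_field m a t = 0"
    show "t = \<sigma>"
      using field_quotient_decreasing[OF m a, of t \<sigma>] field_quotient_decreasing[OF m a, of \<sigma> t] t \<sigma> z zero
      by (cases t \<sigma> rule: linorder_cases) (auto simp: T')
  qed (simp add: zero)
  have env: "envelope_heights f T a = {- \<sigma>, \<sigma>}"
  proof -
    have "even_field m a t = 0 \<longleftrightarrow> t = - \<sigma> \<or> t = \<sigma>" if t: "- T a < t" "t < T a" for t
    proof -
      consider "t = 0" | "0 < t" | "t < 0" by linarith
      then show ?thesis
      proof cases
        case 1
        then show ?thesis using \<sigma> by (simp add: even_field_0[OF m a])
      next
        case 2
        then show ?thesis using pos_zero[of t] t \<sigma> by auto
      next
        case 3
        then show ?thesis
          using pos_zero[of "- t"] t \<sigma> even_field_even[OF m a, of t] by (auto simp: T')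
      qed
    qed
    then show ?thesis
      unfolding envelope_heights_def
      using touches_envelope_iff[OF f n a, folded m_def] \<sigma> by auto
  qed
  have cat: "catenoid f T a = (catenoid_domain f a (- T a) (T a) :: 'n ambient set)"
    by (simp add: catenoid_def)
  interpret catenary_chart f a "T a" "\<lambda>t. tan (angle m a t)" "real CARD('n)"
    unfolding m_def by (rule catenary_chart_maximal_solution[of "CARD('n)" a "T a" f, OF sol n a Ta])
  have sym: "f a (- t) = f a t" if "- \<sigma> < t" "t < \<sigma>" for t
    using profile_even[OF m a, of t] fp[of t] fp[of "- t"] that \<sigma> by (simp add: T')
  have rel: "relatively_compact_domain (catenoid_domain f a (- T a) (T a)) (catenoid_domain f a (- \<sigma>) \<sigma> :: 'n ambient set)"
    using stable_unstable unfolding stable_unstable_def catenoid_chart_image by blast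
  have "\<Omega> = catenoid_domain f a (- \<sigma>) \<sigma> \<longleftrightarrow>
       symmetric_set \<Omega> \<and> rotation_invariant \<Omega> \<and>
       relatively_compact_domain (catenoid f T a) \<Omega> \<and>
       boundary_in (catenoid f T a) \<Omega> = (\<Union>t\<in>envelope_heights f T a. catenoid_sphere f a t)"
    for \<Omega> :: "'n ambient set"
  proof
    assume eq: "\<Omega> = catenoid_domain f a (- \<sigma>) \<sigma>"
    show "symmetric_set \<Omega> \<and> rotation_invariant \<Omega> \<and>
       relatively_compact_domain (catenoid f T a) \<Omega> \<and>
       boundary_in (catenoid f T a) \<Omega> = (\<Union>t\<in>envelope_heights f T a. catenoid_sphere f a t)"
      unfolding eq cat env boundary_catenoid_domain[OF \<sigma>]
      by (intro conjI symmetric_catenoid_domain sym rotation_invariant_catenoid_domain rel) simp_all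
  next
    assume "symmetric_set \<Omega> \<and> rotation_invariant \<Omega> \<and>
       relatively_compact_domain (catenoid f T a) \<Omega> \<and>
       boundary_in (catenoid f T a) \<Omega> = (\<Union>t\<in>envelope_heights f T a. catenoid_sphere f a t)"
    then show "\<Omega> = catenoid_domain f a (- \<sigma>) \<sigma>"
      by (intro domain_eq_if_boundary_spheres[OF n \<sigma>]) (simp_all add: cat env)
  qed
  with env show ?thesis by blast
qed

end
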